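(* Let $g\in\mathbb M$ be a non-Fricke element of the Monster. Let $\ell$ be the minimal positive integer with $c(\ell,0)\ne 0$. Then the Monstrous Lie algebra $\mathfrak m_g$ can be expressed as a direct sum of vector spaces $$\mathfrak m_g=\mathfrak u^-\oplus\mathcal H\oplus\mathbb C h_{(1,1)}\oplus\mathfrak u^+,$$ where $\mathfrak u^{\pm}$ are the free subalgebras with free generating sets $$U^+=\{\operatorname{ad}(e_{j_1})^{\ell_1}\cdots\operatorname{ad}(e_{j_n})^{\ell_n}e_i: n\ge0,\ j_1<\dots<j_n\in I_-,\ \ell_k>0,\ i\in I_+\},$$ $$U^-=\{\operatorname{ad}(f_{j_1})^{\ell_1}\cdots\operatorname{ad}(f_{j_n})^{\ell_n}f_i: n\ge0,\ j_1<\dots<j_n\in I_-,\ \ell_k>0,\ i\in I_+\},$$ and $\mathcal H$ is the infinite-dimensional Heisenberg Lie algebra spanned by $\{e_i,f_i\}_{i\in I_-}$ and its central element $h_{(-\ell,1)}$.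
   Context: All Lie algebras are over $\mathbb C$. Borcherds algebras. For a countable set $I$ and a real symmetric matrix $A=(a_{ij})_{i,j\in I}$ with $a_{ij}\le0$ for all $i,j\in I$ (a symmetrized Borcherds Cartan matrix with no real simple roots), the Borcherds algebra $\mathfrak g(A)$ is the Lie algebra with generators $\{e_i,f_i,h_i\}_{i\in I}$ and relations $[h_i,h_j]=0$, $[h_i,e_j]=a_{ij}e_j$, $[h_i,f_j]=-a_{ij}f_j$, $[e_i,f_j]=\delta_{ij}h_i$ for all $i,j\in I$, and $[e_i,e_j]=0=[f_i,f_j]$ whenever $a_{ij}=0$. McKay–Thompson series. Let $\mathbb M$ be the Monster group and $V^\natural=\bigoplus_{n\ge0}V^\natural_n$ the Moonshine module vertex operator algebra of Frenkel–Lepowsky–Meurman, with automorphism group $\mathbb M$. For $g\in\mathbb M$, the McKay–Thompson series is, up to an additive constant, $T_g(\tau)=\sum_{n\ge0}\operatorname{Tr}(g|_{V^\natural_n})q^{n-1}$, $q=e^{2\pi i\tau}$. The element $g$ is Fricke if $T_g$ is invariant under $\tau\mapsto-1/N\tau$ for some integer $N\ge1$, and non-Fricke otherwise. For $g$ non-Fricke, the additive constant is normalized so that $T_g(-1/\tau)\to0$ as $\tau\to i\infty$; then it is known that $T_g(\tau)=\eta(a_1\tau)^{b_1}\cdots\eta(a_s\tau)^{b_s}$ for certain integers $a_i>0$, $b_i$, where $\eta(\tau)=q^{1/24}\prod_{n\ge1}(1-q^n)$. The sequences. For $g$ non-Fricke, there are unique non-negative integers $c(m,0)$ ($m\ge1$)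 with $T_g(\tau)=q^{-1}\prod_{m>0}(1-q^m)^{c(m,0)}$, and a unique integer $N>0$ and unique non-negative integers $c(1,n/N)$ ($n\ge1$) with $c(1,1/N)\neq0$ and $T_g(-1/\tau)=\sum_{n>0}c(1,n/N)q^{n/N}$. Moreover $c(m,0)\ne0$ for some $m>0$. (These known facts are taken as given.) The Lie algebra $\mathfrak m_g$. Put $I_-=\{(-m,j)\in\mathbb Z^2: m>0,\ 1\le j\le c(m,0)\}$, $I_+=\{(n,k)\in\mathbb Z^2: n>0,\ 1\le k\le c(1,n/N)\}$, $I=I_-\cup I_+$, totally ordered lexicographically. Let $A_g$ be the $I\times I$ matrix with $a_{(-m,j),(-n,k)}=0$ for both indices in $I_-$; $a_{(-m,j),(n,k)}=a_{(n,k),(-m,j)}=-mn$ for $(-m,j)\in I_-$, $(n,k)\in I_+$; and $a_{(m,j),(n,k)}=-(m+n)$ for both indices in $I_+$. The Monstrous Lie algebra is $\mathfrak m_g=\mathfrak g(A_g)/\mathfrak z$, where $\mathfrak z$ is the center of $\mathfrak g(A_g)$. The images of $e_i,f_i,h_i$ in $\mathfrak m_g$ are denoted by the same symbols. A Heisenberg Lie algebra is a Lie algebra whose derived subalgebra equals its center and is one-dimensional. *)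

theory Defs
  imports "HOL-Analysis.Analysis" "HOL-Library.Groups_Big_Fun"
begin

section \<open>Complex Lie algebras\<close>

record 'a lie_alg =
  lscale :: "complex \<Rightarrow> 'a \<Rightarrow> 'a"
  lbracket :: "'a \<Rightarrow> 'a \<Rightarrow> 'a"

locale lie_algebra = vector_space "lscale L"
  for L :: "('a::ab_group_add) lie_alg" +
  assumes bracket_add_left: "lbracket L (x + y) z = lbracket L x z + lbracket L y z"
    and bracket_add_right: "lbracket L x (y + z) = lbracket L x y + lbracket L x z"
    and bracket_scale_left: "lbracket L (lscale L r x) y = lscale L r (lbracket L x y)"
    and bracket_scale_right: "lbracket L x (lscale L r y) = lscale L r (lbracket L x y)"
    and bracket_self: "lbracket L x x = 0"
    and jacobi: "lbracket L x (lbracket L y z) + lbracket L y (lbracket L z x)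
                   + lbracket L z (lbracket L x y) = 0"

abbreviation lspan :: "('a::ab_group_add) lie_alg \<Rightarrow> 'a set \<Rightarrow> 'a set" where
  "lspan L \<equiv> module.span (lscale L)"

definition lie_subalgebra :: "('a::ab_group_add) lie_alg \<Rightarrow> 'a set \<Rightarrow> bool" where
  "lie_subalgebra L S \<longleftrightarrow>
     module.subspace (lscale L) S \<and> (\<forall>x\<in>S. \<forall>y\<in>S. lbracket L x y \<in> S)"

definition lie_ideal :: "('a::ab_group_add) lie_alg \<Rightarrow> 'a set \<Rightarrow> bool" where
  "lie_ideal L J \<longleftrightarrow>
     module.subspace (lscale L) J \<and> (\<forall>x. \<forall>y\<in>J. lbracket L x y \<in> J)"

definition lie_generated :: "('a::ab_group_add) lie_alg \<Rightarrow> 'a set \<Rightarrow> 'a set" where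
  "lie_generated L U = \<Inter>{S. lie_subalgebra L S \<and> U \<subseteq> S}"

definition lie_ideal_generated :: "('a::ab_group_add) lie_alg \<Rightarrow> 'a set \<Rightarrow> 'a set" where
  "lie_ideal_generated L R = \<Inter>{J. lie_ideal L J \<and> R \<subseteq> J}"

definition lie_hom ::
    "('a::ab_group_add) lie_alg \<Rightarrow> ('b::ab_group_add) lie_alg \<Rightarrow> ('a \<Rightarrow> 'b) \<Rightarrow> bool" where
  "lie_hom L K \<phi> \<longleftrightarrow> Vector_Spaces.linear (lscale L) (lscale K) \<phi> \<and>
     (\<forall>x y. \<phi> (lbracket L x y) = lbracket K (\<phi> x) (\<phi> y))"

text \<open>The center and the derived subalgebra of a subalgebra \<open>S\<close>, both formed within \<open>S\<close>.\<close>

definition lie_center :: "('a::ab_group_add) lie_alg \<Rightarrow> 'a set \<Rightarrow> 'a set" where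
  "lie_center L S = {z \<in> S. \<forall>x\<in>S. lbracket L z x = 0}"

definition lie_derived :: "('a::ab_group_add) lie_alg \<Rightarrow> 'a set \<Rightarrow> 'a set" where
  "lie_derived L S = lspan L {lbracket L x y | x y. x \<in> S \<and> y \<in> S}"

definition heisenberg_lie :: "('a::ab_group_add) lie_alg \<Rightarrow> 'a set \<Rightarrow> bool" where
  "heisenberg_lie L S \<longleftrightarrow> lie_subalgebra L S \<and> lie_derived L S = lie_center L S \<and>
     vector_space.dim (lscale L) (lie_center L S) = 1"

definition lie_quotient_map ::
    "('a::ab_group_add) lie_alg \<Rightarrow> 'a set \<Rightarrow> ('b::ab_group_add) lie_alg \<Rightarrow> ('a \<Rightarrow> 'b) \<Rightarrow> bool" where
  "lie_quotient_map L J K \<pi> \<longleftrightarrow>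
     lie_algebra K \<and> lie_hom L K \<pi> \<and> surj \<pi> \<and> {x. \<pi> x = 0} = J"

definition finite_dim :: "(complex \<Rightarrow> 'a \<Rightarrow> 'a) \<Rightarrow> ('a::ab_group_add) set \<Rightarrow> bool" where
  "finite_dim sc S \<longleftrightarrow> (\<exists>B. finite B \<and> S \<subseteq> module.span sc B)"

definition direct_sum4 ::
    "('a::ab_group_add) set \<Rightarrow> 'a set \<Rightarrow> 'a set \<Rightarrow> 'a set \<Rightarrow> bool" where
  "direct_sum4 A B C D \<longleftrightarrow>
     (\<forall>x. \<exists>!p. p \<in> A \<times> B \<times> C \<times> D \<and> x = (case p of (a, b, c, d) \<Rightarrow> a + b + c + d))"


section \<open>Free Lie algebras\<close>

datatype 'x lie_term =
    TGen 'x
  | TZero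
  | TAdd "'x lie_term" "'x lie_term"
  | TScale complex "'x lie_term"
  | TBr "'x lie_term" "'x lie_term"

text \<open>Equality of Lie words modulo the vector space axioms and the Lie algebra axioms.\<close>

inductive lie_eq :: "'x lie_term \<Rightarrow> 'x lie_term \<Rightarrow> bool" where
  le_refl: "lie_eq s s"
| le_sym: "lie_eq s t \<Longrightarrow> lie_eq t s"
| le_trans: "lie_eq s t \<Longrightarrow> lie_eq t u \<Longrightarrow> lie_eq s u"
| le_add_cong: "lie_eq s s' \<Longrightarrow> lie_eq t t' \<Longrightarrow> lie_eq (TAdd s t) (TAdd s' t')"
| le_scale_cong: "lie_eq s s' \<Longrightarrow> lie_eq (TScale r s) (TScale r s')"
| le_br_cong: "lie_eq s s' \<Longrightarrow> lie_eq t t' \<Longrightarrow> lie_eq (TBr s t) (TBr s' t')"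
| le_assoc: "lie_eq (TAdd (TAdd s t) u) (TAdd s (TAdd t u))"
| le_comm: "lie_eq (TAdd s t) (TAdd t s)"
| le_zero: "lie_eq (TAdd TZero s) s"
| le_inv: "lie_eq (TAdd (TScale (-1) s) s) TZero"
| le_scale_add_right: "lie_eq (TScale r (TAdd s t)) (TAdd (TScale r s) (TScale r t))"
| le_scale_add_left: "lie_eq (TScale (r + r') s) (TAdd (TScale r s) (TScale r' s))"
| le_scale_scale: "lie_eq (TScale r (TScale r' s)) (TScale (r * r') s)"
| le_scale_one: "lie_eq (TScale 1 s) s"
| le_br_add_left: "lie_eq (TBr (TAdd s t) u) (TAdd (TBr s u) (TBr t u))"
| le_br_add_right: "lie_eq (TBr s (TAdd t u)) (TAdd (TBr s t) (TBr s u))"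
| le_br_scale_left: "lie_eq (TBr (TScale r s) t) (TScale r (TBr s t))"
| le_br_scale_right: "lie_eq (TBr s (TScale r t)) (TScale r (TBr s t))"
| le_br_self: "lie_eq (TBr s s) TZero"
| le_jacobi: "lie_eq (TAdd (TAdd (TBr s (TBr t u)) (TBr t (TBr u s))) (TBr u (TBr s t))) TZero"

quotient_type 'x free_lie = "'x lie_term" / lie_eq
  by (rule equivpI)
     (auto simp: reflp_def symp_def transp_def intro: le_refl le_sym le_trans)

instantiation free_lie :: (type) ab_group_add
begin

lift_definition zero_free_lie :: "'a free_lie" is TZero .

lift_definition plus_free_lie :: "'a free_lie \<Rightarrow> 'a free_lie \<Rightarrow> 'a free_lie" is TAdd
  by (rule le_add_cong)

lift_definition uminus_free_lie :: "'a free_lie \<Rightarrow> 'a free_lie" is "TScale (-1)"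
  by (rule le_scale_cong)

lift_definition minus_free_lie :: "'a free_lie \<Rightarrow> 'a free_lie \<Rightarrow> 'a free_lie"
  is "\<lambda>s t. TAdd s (TScale (-1) t)"
  by (intro le_add_cong le_scale_cong)

instance
proof
  fix a b c :: "'a free_lie"
  show "a + b + c = a + (b + c)" by transfer (rule le_assoc)
  show "a + b = b + a" by transfer (rule le_comm)
  show "0 + a = a" by transfer (rule le_zero)
  show "- a + a = 0" by transfer (rule le_inv)
  show "a - b = a + - b" by transfer (rule le_refl)
qed

end

lift_definition free_gen :: "'x \<Rightarrow> 'x free_lie" is TGen .

lift_definition free_scale :: "complex \<Rightarrow> 'x free_lie \<Rightarrow> 'x free_lie" is TScale
  by (rule le_scale_cong)

lift_definition free_bracket :: "'x free_lie \<Rightarrow> 'x free_lie \<Rightarrow> 'x free_lie" is TBr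
  by (rule le_br_cong)

definition free_lie_alg :: "'x free_lie lie_alg" where
  "free_lie_alg = \<lparr>lscale = free_scale, lbracket = free_bracket\<rparr>"

lemma lie_algebra_free: "lie_algebra free_lie_alg"
proof
  fix r r' :: complex and x y z :: "'a free_lie"
  show "lscale free_lie_alg r (x + y) = lscale free_lie_alg r x + lscale free_lie_alg r y"
    unfolding free_lie_alg_def by (simp, transfer) (rule le_scale_add_right)
  show "lscale free_lie_alg (r + r') x = lscale free_lie_alg r x + lscale free_lie_alg r' x"
    unfolding free_lie_alg_def by (simp, transfer) (rule le_scale_add_left)
  show "lscale free_lie_alg r (lscale free_lie_alg r' x) = lscale free_lie_alg (r * r') x"
    unfolding free_lie_alg_def by (simp, transfer) (rule le_scale_scale)
  show "lscale free_lie_alg 1 x = x"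
    unfolding free_lie_alg_def by (simp, transfer) (rule le_scale_one)
  show "lbracket free_lie_alg (x + y) z = lbracket free_lie_alg x z + lbracket free_lie_alg y z"
    unfolding free_lie_alg_def by (simp, transfer) (rule le_br_add_left)
  show "lbracket free_lie_alg x (y + z) = lbracket free_lie_alg x y + lbracket free_lie_alg x z"
    unfolding free_lie_alg_def by (simp, transfer) (rule le_br_add_right)
  show "lbracket free_lie_alg (lscale free_lie_alg r x) y
          = lscale free_lie_alg r (lbracket free_lie_alg x y)"
    unfolding free_lie_alg_def by (simp, transfer) (rule le_br_scale_left)
  show "lbracket free_lie_alg x (lscale free_lie_alg r y)
          = lscale free_lie_alg r (lbracket free_lie_alg x y)"
    unfolding free_lie_alg_def by (simp, transfer) (rule le_br_scale_right)
  show "lbracket free_lie_alg x x = 0"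
    unfolding free_lie_alg_def by (simp, transfer) (rule le_br_self)
  show "lbracket free_lie_alg x (lbracket free_lie_alg y z)
          + lbracket free_lie_alg y (lbracket free_lie_alg z x)
          + lbracket free_lie_alg z (lbracket free_lie_alg x y) = 0"
    unfolding free_lie_alg_def by (simp, transfer) (rule le_jacobi)
qed

text \<open>\<open>S\<close> is a subalgebra of \<open>L\<close> with free generating set \<open>U\<close>: the homomorphism onto \<open>S\<close> from the
  free Lie algebra on the set \<open>U\<close> is injective. The latter algebra is the subalgebra
  of \<open>'a free_lie\<close> generated by the free generators indexed by \<open>U\<close>.\<close>

definition freely_generates :: "('a::ab_group_add) lie_alg \<Rightarrow> 'a set \<Rightarrow> 'a set \<Rightarrow> bool" where
  "freely_generates L U S \<longleftrightarrow> S = lie_generated L U \<and>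
     (\<exists>\<phi>. lie_hom free_lie_alg L \<phi> \<and> (\<forall>u. \<phi> (free_gen u) = u) \<and>
          inj_on \<phi> (lie_generated free_lie_alg (free_gen ` U)))"


section \<open>Borcherds algebras\<close>

datatype 'i bgen = Egen 'i | Fgen 'i | Hgen 'i

text \<open>The index set \<open>I\<close> is a subset of the type \<open>'i\<close>; the last set removes the superfluous
  generators with index outside \<open>I\<close>.\<close>

definition borcherds_relators ::
    "'i set \<Rightarrow> ('i \<Rightarrow> 'i \<Rightarrow> real) \<Rightarrow> 'i bgen free_lie set" where
  "borcherds_relators I A =
     (let E = \<lambda>i. free_gen (Egen i); F = \<lambda>i. free_gen (Fgen i); H = \<lambda>i. free_gen (Hgen i);
          br = free_bracket; sc = free_scale
      in {br (H i) (H j) | i j. i \<in> I \<and> j \<in> I}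
       \<union> {br (H i) (E j) - sc (of_real (A i j)) (E j) | i j. i \<in> I \<and> j \<in> I}
       \<union> {br (H i) (F j) + sc (of_real (A i j)) (F j) | i j. i \<in> I \<and> j \<in> I}
       \<union> {br (E i) (F j) - (if i = j then H i else 0) | i j. i \<in> I \<and> j \<in> I}
       \<union> {br (E i) (E j) | i j. i \<in> I \<and> j \<in> I \<and> A i j = 0}
       \<union> {br (F i) (F j) | i j. i \<in> I \<and> j \<in> I \<and> A i j = 0}
       \<union> {free_gen x | x. \<exists>i. i \<notin> I \<and> x \<in> {Egen i, Fgen i, Hgen i}})"

text \<open>\<open>G\<close>, with the generators \<open>e i\<close>, \<open>f i\<close>, \<open>h i\<close> for \<open>i \<in> I\<close>, is the Lie algebra given by the
  presentation, that is, the quotient of the free Lie algebra by the ideal generated by the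
  relators. The values of \<open>e\<close>, \<open>f\<close>, \<open>h\<close> outside \<open>I\<close> are irrelevant.\<close>

definition borcherds_algebra ::
    "'i set \<Rightarrow> ('i \<Rightarrow> 'i \<Rightarrow> real) \<Rightarrow> ('a::ab_group_add) lie_alg \<Rightarrow>
     ('i \<Rightarrow> 'a) \<Rightarrow> ('i \<Rightarrow> 'a) \<Rightarrow> ('i \<Rightarrow> 'a) \<Rightarrow> bool" where
  "borcherds_algebra I A G e f h \<longleftrightarrow>
     (\<exists>\<phi>. lie_quotient_map free_lie_alg
             (lie_ideal_generated free_lie_alg (borcherds_relators I A)) G \<phi> \<and>
          (\<forall>i\<in>I. \<phi> (free_gen (Egen i)) = e i \<and> \<phi> (free_gen (Fgen i)) = f i \<and>
                 \<phi> (free_gen (Hgen i)) = h i))"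


section \<open>The Monstrous Lie algebra data\<close>

text \<open>Throughout, \<open>c0 m\<close> stands for \<open>c(m,0)\<close> and \<open>c1 n\<close> stands for \<open>c(1,n/N)\<close>.\<close>

definition I_minus :: "(nat \<Rightarrow> nat) \<Rightarrow> (int \<times> int) set" where
  "I_minus c0 = {(- int m, int j) | m j. m > 0 \<and> 1 \<le> j \<and> j \<le> c0 m}"

definition I_plus :: "(nat \<Rightarrow> nat) \<Rightarrow> (int \<times> int) set" where
  "I_plus c1 = {(int n, int k) | n k. n > 0 \<and> 1 \<le> k \<and> k \<le> c1 n}"

definition lex_less :: "int \<times> int \<Rightarrow> int \<times> int \<Rightarrow> bool" where
  "lex_less p q \<longleftrightarrow> fst p < fst q \<or> fst p = fst q \<and> snd p < snd q"

text \<open>In the mixed case the first components are \<open>-m\<close> and \<open>n\<close>, in either order, so that their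
  product is \<open>-mn\<close>.\<close>

definition A_matrix :: "int \<times> int \<Rightarrow> int \<times> int \<Rightarrow> real" where
  "A_matrix p q =
     (if fst p < 0 \<and> fst q < 0 then 0
      else if fst p > 0 \<and> fst q > 0 then - of_int (fst p + fst q)
      else of_int (fst p * fst q))"

text \<open>The elements \<open>ad(x\<^sub>j\<^sub>1)^l\<^sub>1 \<dots> ad(x\<^sub>j\<^sub>n)^l\<^sub>n x\<^sub>i\<close> with \<open>n \<ge> 0\<close>, \<open>j\<^sub>1 < \<dots> < j\<^sub>n\<close> in \<open>J\<close>, all \<open>l\<^sub>k > 0\<close> and
  \<open>i\<close> in \<open>K\<close>; the list \<open>w\<close> consists of the pairs \<open>(j\<^sub>k, l\<^sub>k)\<close>.\<close>

definition ad_words ::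
    "'a lie_alg \<Rightarrow> (int \<times> int \<Rightarrow> 'a) \<Rightarrow> (int \<times> int) set \<Rightarrow> (int \<times> int) set \<Rightarrow> 'a set" where
  "ad_words L x J K =
     {foldr (\<lambda>(j, l) y. (lbracket L (x j) ^^ l) y) w (x i) | w i.
        sorted_wrt lex_less (map fst w) \<and> (\<forall>(j, l) \<in> set w. j \<in> J \<and> l > 0) \<and> i \<in> K}"


section \<open>Vertex operator algebras\<close>

text \<open>\<open>vmode V u n v\<close> is \<open>u\<^sub>n v\<close>, where \<open>Y(u,z) = \<Sum>\<^sub>n u\<^sub>n z^(-n-1)\<close>; \<open>vconf\<close> is the conformal vector.\<close>

record 'v voa =
  vscale :: "complex \<Rightarrow> 'v \<Rightarrow> 'v"
  vmode :: "'v \<Rightarrow> int \<Rightarrow> 'v \<Rightarrow> 'v"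
  vvac :: 'v
  vconf :: 'v

definition virasoro :: "'v voa \<Rightarrow> int \<Rightarrow> 'v \<Rightarrow> 'v" where
  "virasoro V n v = vmode V (vconf V) (n + 1) v"

definition voa_weight :: "('v::ab_group_add) voa \<Rightarrow> int \<Rightarrow> 'v set" where
  "voa_weight V n = {v. virasoro V 0 v = vscale V (of_int n) v}"

text \<open>All sums below are finite by the truncation axiom. The axiom \<open>borcherds\<close> is the component
  form of the Jacobi identity.\<close>

locale vertex_operator_algebra = vector_space "vscale V"
  for V :: "('v::ab_group_add) voa" +
  assumes mode_add_left: "vmode V (u + u') n v = vmode V u n v + vmode V u' n v"
    and mode_add_right: "vmode V u n (v + v') = vmode V u n v + vmode V u n v'"
    and mode_scale_left: "vmode V (vscale V r u) n v = vscale V r (vmode V u n v)"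
    and mode_scale_right: "vmode V u n (vscale V r v) = vscale V r (vmode V u n v)"
    and truncation: "\<exists>K. \<forall>n\<ge>K. vmode V u n v = 0"
    and vacuum: "vmode V (vvac V) n v = (if n = -1 then v else 0)"
    and creation: "vmode V u (-1) (vvac V) = u"
    and creation_regular: "n \<ge> 0 \<Longrightarrow> vmode V u n (vvac V) = 0"
    and borcherds:
      "(\<Sum>j::nat. vscale V (of_int m gchoose j)
           (vmode V (vmode V u (l + int j) v) (m + n - int j) w)) =
       (\<Sum>j::nat. vscale V ((-1) ^ j * (of_int l gchoose j))
           (vmode V u (m + l - int j) (vmode V v (n + int j) w)
            - vscale V ((-1) powi l) (vmode V v (n + l - int j) (vmode V u (m + int j) w))))"
    and virasoro_relations:
      "\<exists>c. \<forall>m n v. virasoro V m (virasoro V n v) - virasoro V n (virasoro V m v) =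
          vscale V (of_int (m - n)) (virasoro V (m + n) v)
          + (if m + n = 0 then vscale V (of_int (m ^ 3 - m) / 12 * c) v else 0)"
    and translation:
      "vmode V (virasoro V (-1) u) n v = vscale V (- of_int n) (vmode V u (n - 1) v)"
    and grading_span: "module.span (vscale V) (\<Union>n. voa_weight V n) = UNIV"
    and grading_finite: "finite_dim (vscale V) (voa_weight V n)"
    and grading_bounded: "\<exists>K. \<forall>n<K. voa_weight V n = {0}"

definition voa_aut :: "('v::ab_group_add) voa \<Rightarrow> ('v \<Rightarrow> 'v) set" where
  "voa_aut V = {g. bij g \<and> Vector_Spaces.linear (vscale V) (vscale V) g \<and>
     g (vvac V) = vvac V \<and> g (vconf V) = vconf V \<and>
     (\<forall>u n v. g (vmode V u n v) = vmode V (g u) n (g v))}"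

definition voa_simple :: "('v::ab_group_add) voa \<Rightarrow> bool" where
  "voa_simple V \<longleftrightarrow> (\<forall>J. module.subspace (vscale V) J \<and> (\<forall>u n. \<forall>v\<in>J. vmode V u n v \<in> J)
     \<longrightarrow> J = {0} \<or> J = UNIV)"


section \<open>The Moonshine module\<close>

text \<open>The even unimodular lattice without roots in 24-dimensional Euclidean space. A self-dual even
  additive subgroup is automatically discrete and of full rank.\<close>

definition leech_lattice :: "(real ^ 24) set \<Rightarrow> bool" where
  "leech_lattice \<Lambda> \<longleftrightarrow> \<Lambda> = {x. \<forall>y\<in>\<Lambda>. x \<bullet> y \<in> \<int>} \<and>
     (\<forall>x\<in>\<Lambda>. \<exists>k::int. x \<bullet> x = 2 * of_int k) \<and> (\<forall>x\<in>\<Lambda>. x \<bullet> x \<noteq> 2)"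

text \<open>\<open>W\<close> is the lattice vertex operator algebra of the Leech lattice \<open>\<Lambda>\<close>. Here \<open>a x\<close> is the
  Heisenberg vector \<open>x(-1)1\<close>, and \<open>ex \<alpha>\<close> is the vector usually written \<open>e\<^sup>\<alpha>\<close>. The products are
  fixed by the bimultiplicative cocycle \<open>\<epsilon>\<close> through the leading coefficients
  \<open>e\<^sup>\<alpha>\<^sub>n e\<^sup>\<beta>\<close>, \<open>n = -\<langle>\<alpha>,\<beta>\<rangle> - 1\<close>. The map \<open>\<theta>\<close> is the lift of \<open>-1\<close> with \<open>\<theta> e\<^sup>\<alpha> = e\<^sup>-\<^sup>\<alpha>\<close>.\<close>

definition leech_voa :: "('v::ab_group_add) voa \<Rightarrow> ('v \<Rightarrow> 'v) \<Rightarrow> bool" where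
  "leech_voa W \<theta> \<longleftrightarrow> vertex_operator_algebra W \<and> \<theta> \<in> voa_aut W \<and>
     (\<exists>\<Lambda> a ex \<epsilon>. leech_lattice \<Lambda> \<and>
        (\<forall>x y. a (x + y) = a x + a y) \<and> (\<forall>r x. a (r *\<^sub>R x) = vscale W (of_real r) (a x)) \<and>
        (\<forall>x y m n v. vmode W (a x) m (vmode W (a y) n v) - vmode W (a y) n (vmode W (a x) m v)
           = (if m + n = 0 then vscale W (of_int m * of_real (x \<bullet> y)) v else 0)) \<and>
        vconf W = vscale W (1 / 2)
           (\<Sum>i\<in>UNIV. vmode W (a (axis i 1)) (-1) (a (axis i 1))) \<and>
        ex 0 = vvac W \<and> (\<forall>\<alpha>\<in>\<Lambda>. ex \<alpha> \<noteq> 0) \<and>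
        (\<forall>\<alpha>\<in>\<Lambda>. \<forall>x. vmode W (a x) 0 (ex \<alpha>) = vscale W (of_real (x \<bullet> \<alpha>)) (ex \<alpha>) \<and>
                    (\<forall>n>0. vmode W (a x) n (ex \<alpha>) = 0)) \<and>
        module.span (vscale W)
          {foldr (\<lambda>(i, k) v. vmode W (a (axis i 1)) (- int (Suc k)) v) w (ex \<alpha>)
             | (w :: (24 \<times> nat) list) \<alpha>. \<alpha> \<in> \<Lambda>} = UNIV \<and>
        (\<forall>\<alpha>\<in>\<Lambda>. \<forall>\<beta>\<in>\<Lambda>. \<epsilon> \<alpha> \<beta> \<in> {1, -1}) \<and>
        (\<forall>\<alpha>\<in>\<Lambda>. \<forall>\<beta>\<in>\<Lambda>. \<forall>\<gamma>\<in>\<Lambda>. \<epsilon> (\<alpha> + \<beta>) \<gamma> = \<epsilon> \<alpha> \<gamma> * \<epsilon> \<beta> \<gamma> \<and>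
                               \<epsilon> \<alpha> (\<beta> + \<gamma>) = \<epsilon> \<alpha> \<beta> * \<epsilon> \<alpha> \<gamma>) \<and>
        (\<forall>\<alpha>\<in>\<Lambda>. \<forall>\<beta>\<in>\<Lambda>.
           vmode W (ex \<alpha>) (- \<lfloor>\<alpha> \<bullet> \<beta>\<rfloor> - 1) (ex \<beta>) = vscale W (\<epsilon> \<alpha> \<beta>) (ex (\<alpha> + \<beta>)) \<and>
           (\<forall>n \<ge> - \<lfloor>\<alpha> \<bullet> \<beta>\<rfloor>. vmode W (ex \<alpha>) n (ex \<beta>) = 0)) \<and>
        (\<forall>x. \<theta> (a x) = - a x) \<and> (\<forall>\<alpha>\<in>\<Lambda>. \<theta> (ex \<alpha>) = ex (- \<alpha>)))"

text \<open>Twisted modules for an involution. The modes of a twisted module are indexed by half-integers: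
  \<open>tmode T u k w\<close> is \<open>u\<^sub>k\<^sub>/\<^sub>2 w\<close>, where \<open>Y(u,z) = \<Sum>\<^sub>k u\<^sub>k\<^sub>/\<^sub>2 z^(-k/2-1)\<close>.\<close>

record ('v, 't) twisted_mod =
  tscale :: "complex \<Rightarrow> 't \<Rightarrow> 't"
  tmode :: "'v \<Rightarrow> int \<Rightarrow> 't \<Rightarrow> 't"

definition twist_parity :: "('v::ab_group_add \<Rightarrow> 'v) \<Rightarrow> 'v \<Rightarrow> int \<Rightarrow> bool" where
  "twist_parity \<theta> u p \<longleftrightarrow> \<theta> u = (if even p then u else - u)"

definition twisted_weight ::
    "('v::ab_group_add) voa \<Rightarrow> ('v, 't::ab_group_add) twisted_mod \<Rightarrow> complex \<Rightarrow> 't set" where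
  "twisted_weight W T \<mu> = {w. tmode T (vconf W) 2 w = tscale T \<mu> w}"

text \<open>Irreducible \<open>\<theta>\<close>-twisted modules, where \<open>\<theta>\<close> is an automorphism of order two; the modes
  \<open>u\<^sub>p\<^sub>/\<^sub>2\<close> with \<open>\<theta> u = \<plusminus>u\<close> vanish unless \<open>p\<close> has the parity of \<open>u\<close>, and \<open>twisted_borcherds\<close> is the
  component form of the twisted Jacobi identity.\<close>

locale irreducible_twisted_module = vector_space "tscale T"
  for W :: "('v::ab_group_add) voa" and \<theta> :: "'v \<Rightarrow> 'v"
    and T :: "('v, 't::ab_group_add) twisted_mod" +
  assumes tmode_add_left: "tmode T (u + u') k w = tmode T u k w + tmode T u' k w"
    and tmode_add_right: "tmode T u k (w + w') = tmode T u k w + tmode T u k w'"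
    and tmode_scale_left: "tmode T (vscale W r u) k w = tscale T r (tmode T u k w)"
    and tmode_scale_right: "tmode T u k (tscale T r w) = tscale T r (tmode T u k w)"
    and twisted_truncation: "\<exists>K. \<forall>k\<ge>K. tmode T u k w = 0"
    and twisted_vacuum: "tmode T (vvac W) k w = (if k = -2 then w else 0)"
    and twisted_parity: "twist_parity \<theta> u (k + 1) \<Longrightarrow> tmode T u k w = 0"
    and twisted_borcherds:
      "twist_parity \<theta> u p \<Longrightarrow> twist_parity \<theta> v q \<Longrightarrow>
       (\<Sum>j::nat. tscale T ((of_int p / 2) gchoose j)
           (tmode T (vmode W u (l + int j) v) (p + q - 2 * int j) w)) =
       (\<Sum>j::nat. tscale T ((-1) ^ j * (of_int l gchoose j))
           (tmode T u (p + 2 * l - 2 * int j) (tmode T v (q + 2 * int j) w)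
            - tscale T ((-1) powi l)
                (tmode T v (q + 2 * l - 2 * int j) (tmode T u (p + 2 * int j) w))))"
    and twisted_grading_span: "module.span (tscale T) (\<Union>\<mu>. twisted_weight W T \<mu>) = UNIV"
    and twisted_grading_finite: "finite_dim (tscale T) (twisted_weight W T \<mu>)"
    and nontrivial: "\<exists>w::'t. w \<noteq> 0"
    and irreducible: "module.subspace (tscale T) S \<Longrightarrow> (\<And>u k w. w \<in> S \<Longrightarrow> tmode T u k w \<in> S)
       \<Longrightarrow> S = {0} \<or> S = UNIV"

text \<open>The Frenkel--Lepowsky--Meurman module: \<open>V = V\<^sub>\<Lambda>\<^sup>+ \<oplus> (V\<^sub>\<Lambda>\<^sup>T)\<^sup>+\<close>, where \<open>V\<^sub>\<Lambda>\<^sup>+\<close> is the fixed-point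
  algebra of \<open>\<theta>\<close> in the Leech lattice algebra and \<open>(V\<^sub>\<Lambda>\<^sup>T)\<^sup>+\<close> is the part of integral weights of the
  irreducible \<open>\<theta>\<close>-twisted module. The action of \<open>V\<^sub>\<Lambda>\<^sup>+\<close> is the given one; the products
  of the two summands respect the resulting grading by \<open>\<int>/2\<close> and make \<open>V\<close> simple, which determines
  them up to isomorphism. Both \<open>V\<^sub>\<Lambda>\<close> and \<open>V\<^sub>\<Lambda>\<^sup>T\<close> have countably infinite dimension, as does \<open>V\<close>, so
  that it is no restriction to realize them on (the additive group of) the same type.\<close>

definition moonshine_module :: "('v::ab_group_add) voa \<Rightarrow> bool" where
  "moonshine_module V \<longleftrightarrow> vertex_operator_algebra V \<and> voa_simple V \<and>
     (\<exists>(W :: 'v voa) \<theta> (T :: ('v, 'v) twisted_mod) \<phi> \<psi>.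
        leech_voa W \<theta> \<and> irreducible_twisted_module W \<theta> T \<and>
        Vector_Spaces.linear (vscale W) (vscale V) \<phi> \<and>
        Vector_Spaces.linear (tscale T) (vscale V) \<psi> \<and>
        (let P = {u. \<theta> u = u};
             Q = module.span (tscale T) (\<Union>n::int. twisted_weight W T (of_int n))
         in inj_on \<phi> P \<and> inj_on \<psi> Q \<and>
            (\<forall>v. \<exists>!p. p \<in> \<phi> ` P \<times> \<psi> ` Q \<and> v = fst p + snd p) \<and>
            \<phi> (vvac W) = vvac V \<and> \<phi> (vconf W) = vconf V \<and>
            (\<forall>u\<in>P. \<forall>u'\<in>P. \<forall>n. \<phi> (vmode W u n u') = vmode V (\<phi> u) n (\<phi> u')) \<and>
            (\<forall>u\<in>P. \<forall>w\<in>Q. \<forall>n. \<psi> (tmode T u (2 * n) w) = vmode V (\<phi> u) n (\<psi> w)) \<and>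
            (\<forall>w\<in>Q. \<forall>w'\<in>Q. \<forall>n. vmode V (\<psi> w) n (\<psi> w') \<in> \<phi> ` P)))"

text \<open>The Monster acts faithfully on the Moonshine module as its full automorphism group.\<close>

abbreviation Monster :: "('v::ab_group_add) voa \<Rightarrow> ('v \<Rightarrow> 'v) set" where
  "Monster V \<equiv> voa_aut V"


section \<open>McKay--Thompson series\<close>

definition trace_on ::
    "(complex \<Rightarrow> 'v \<Rightarrow> 'v) \<Rightarrow> ('v::ab_group_add) set \<Rightarrow> ('v \<Rightarrow> 'v) \<Rightarrow> complex" where
  "trace_on sc S g =
     (let B = (SOME B. \<not> module.dependent sc B \<and> module.span sc B = S)
      in \<Sum>b\<in>B. module.representation sc B (g b) b)"

text \<open>\<open>qpow \<tau> r\<close> is \<open>q\<^sup>r\<close> for \<open>q = exp(2\<pi>i\<tau>)\<close>, that is, \<open>exp(2\<pi>ir\<tau>)\<close>.\<close>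

definition qpow :: "complex \<Rightarrow> real \<Rightarrow> complex" where
  "qpow \<tau> r = exp (2 * of_real pi * \<i> * of_real r * \<tau>)"

definition trace_series :: "('v::ab_group_add) voa \<Rightarrow> ('v \<Rightarrow> 'v) \<Rightarrow> complex \<Rightarrow> complex" where
  "trace_series V g \<tau> =
     suminf (\<lambda>n. trace_on (vscale V) (voa_weight V (int n)) g * qpow \<tau> (of_nat n - 1))"

text \<open>Whether \<open>g\<close> is Fricke does not depend on the additive constant.\<close>

definition fricke :: "('v::ab_group_add) voa \<Rightarrow> ('v \<Rightarrow> 'v) \<Rightarrow> bool" where
  "fricke V g \<longleftrightarrow> (\<exists>N::nat. N \<ge> 1 \<and>
     (\<forall>\<tau>. Im \<tau> > 0 \<longrightarrow> trace_series V g (- 1 / (of_nat N * \<tau>)) = trace_series V g \<tau>))"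

text \<open>The normalization of the additive constant for non-Fricke \<open>g\<close>. The filter describes
  \<open>\<tau> \<rightarrow> i\<infinity>\<close>.\<close>

definition mckay_thompson ::
    "('v::ab_group_add) voa \<Rightarrow> ('v \<Rightarrow> 'v) \<Rightarrow> (complex \<Rightarrow> complex) \<Rightarrow> bool" where
  "mckay_thompson V g T \<longleftrightarrow>
     (\<exists>\<kappa>. \<forall>\<tau>. Im \<tau> > 0 \<longrightarrow> T \<tau> = trace_series V g \<tau> + \<kappa>) \<and>
     ((\<lambda>\<tau>. T (- 1 / \<tau>)) \<longlongrightarrow> 0) (filtercomap Im at_top)"

definition dedekind_eta :: "complex \<Rightarrow> complex" where
  "dedekind_eta \<tau> = qpow \<tau> (1 / 24) * prodinf (\<lambda>n. 1 - qpow \<tau> (of_nat (Suc n)))"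

definition eta_quotient :: "(complex \<Rightarrow> complex) \<Rightarrow> bool" where
  "eta_quotient T \<longleftrightarrow> (\<exists>(s::nat) (a :: nat \<Rightarrow> nat) (b :: nat \<Rightarrow> int). (\<forall>i<s. a i > 0) \<and>
     (\<forall>\<tau>. Im \<tau> > 0 \<longrightarrow> T \<tau> = (\<Prod>i<s. dedekind_eta (of_nat (a i) * \<tau>) powi b i)))"

text \<open>The sequences \<open>c(m,0)\<close> and \<open>c(1,n/N)\<close>; only the values at positive arguments matter.\<close>

definition zero_exponents :: "(complex \<Rightarrow> complex) \<Rightarrow> (nat \<Rightarrow> nat) \<Rightarrow> bool" where
  "zero_exponents T c0 \<longleftrightarrow> (\<forall>\<tau>. Im \<tau> > 0 \<longrightarrow>
     (\<lambda>m. (1 - qpow \<tau> (of_nat (Suc m))) ^ c0 (Suc m)) has_prod (T \<tau> * qpow \<tau> 1))"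

definition one_coefficients :: "(complex \<Rightarrow> complex) \<Rightarrow> nat \<Rightarrow> (nat \<Rightarrow> nat) \<Rightarrow> bool" where
  "one_coefficients T N c1 \<longleftrightarrow> N > 0 \<and> c1 1 \<noteq> 0 \<and> (\<forall>\<tau>. Im \<tau> > 0 \<longrightarrow>
     (\<lambda>n. of_nat (c1 (Suc n)) * qpow \<tau> (of_nat (Suc n) / of_nat N)) sums T (- 1 / \<tau>))"

end

theory Submission
  imports Defs "HOL-Library.Function_Algebras"
begin

text \<open>
  Why the theorem holds. Write \<open>J\<close> for the index set \<open>I\<^sub>-\<close> and \<open>K\<close> for \<open>I\<^sub>+\<close>. The matrix has rank two: in the
  quotient by the center, \<open>h\<close> at \<open>(-m, j)\<close> is \<open>m c\<close> and \<open>h\<close> at \<open>(n, k)\<close> is \<open>n d + c\<close> for two commuting elements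
  \<open>c\<close> and \<open>d\<close>. The element \<open>c\<close> commutes with all \<open>e\<^sub>j\<close>, \<open>f\<^sub>j\<close> with \<open>j \<in> J\<close>, and \<open>[e\<^sub>j, f\<^sub>j]\<close> is a nonzero
  multiple of \<open>c\<close>, so these elements span a Heisenberg algebra. On \<open>e\<^sub>i\<close> with \<open>i \<in> K\<close> the eigenvalue of
  \<open>ad c\<close> is negative, on \<open>f\<^sub>i\<close> it is positive.

  \<^emph>\<open>Decomposition.\<close> The sum of \<open>u\<^sup>-\<close>, the span \<open>X\<close> of \<open>e\<^sub>j\<close>, \<open>f\<^sub>j\<close>, \<open>c\<close>, \<open>d\<close>, and \<open>u\<^sup>+\<close> is
  stable under the adjoint action of all generators, hence it is everything
  (\<open>triangular_decomposition\<close>). The sum is direct because \<open>ad c\<close> has positive, zero and negative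
  eigenvalues on the three summands; inside \<open>X\<close>, the eigenvalues of \<open>ad d\<close> separate \<open>c + d\<close> from the
  Heisenberg algebra.

  \<^emph>\<open>Freeness.\<close> Call a pair \<open>(\<nu>, i)\<close> of a multiset \<open>\<nu>\<close> of elements of \<open>J\<close> and an index \<open>i \<in> K\<close> a block; it
  stands for the element of \<open>U\<^sup>+\<close> obtained from \<open>e\<^sub>i\<close> by applying \<open>ad e\<^sub>j\<close> for the members \<open>j\<close> of \<open>\<nu>\<close>. The
  highest weight module of weight zero on which moreover all \<open>f\<^sub>j\<close> with \<open>j \<in> J\<close> kill the generating vector has
  a basis of words in blocks. On its dual, the functions on words, transposition combined with the
  exchange of \<open>e\<close> and \<open>f\<close> lets the element of a block \<open>b\<close> act as the shift that sends \<open>F\<close> to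
  the function with value \<open>F (b # w)\<close> at \<open>w\<close> (\<open>shift_representation\<close>). By the argument of Dynkin, Specht and Wever,
  a Lie polynomial whose letters act by distinct shifts acts by zero only if it is zero
  (\<open>free_lie_shift_faithful\<close>): applied to the function that sends a word to its iterated bracket,
  it gives at the empty word its own image under the Euler derivation, whose eigenvalues on Lie
  polynomials are positive integers. The passage to the quotient by the center loses nothing, because
  the operators \<open>ad h\<^sub>j\<close> with \<open>j \<in> J\<close> have only negative eigenvalues on the
  subalgebra generated by the elements of blocks and kill every central element
  (\<open>positive_part_free\<close>). The statements on \<open>u\<^sup>-\<close> follow by the Chevalley involution
  that exchanges \<open>e\<close> and \<open>f\<close>.

  \<^emph>\<open>Infinite dimension.\<close> If only finitely many \<open>c(m,0)\<close> were nonzero, the product expansion would force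
  \<open>T(it)\<close> to decay only polynomially for \<open>t \<rightarrow> 0\<close>, while the expansion of \<open>T(-1/\<tau>)\<close> forces
  exponential decay (\<open>infinitely_many_zero_exponents\<close>).
\<close>

section \<open>Generated subalgebras, centralizers and eigenspaces\<close>

lemma linear_of_rules:
  assumes "vector_space s" and "vector_space t"
    and "\<And>x y. F (x + y) = F x + F y" and "\<And>r x. F (s r x) = t r (F x)"
  shows "Vector_Spaces.linear s t F"
proof -
  interpret vector_space_pair s t
    using assms(1,2) by (simp add: vector_space_pair_def)
  show ?thesis
    by unfold_locales (use assms(3,4) in auto)
qed

lemma lie_hom_add: "lie_hom L K \<phi> \<Longrightarrow> \<phi> (x + y) = \<phi> x + \<phi> y"
  unfolding lie_hom_def by (metis Vector_Spaces.linear.axioms(3) module_hom.add)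

lemma lie_hom_scale: "lie_hom L K \<phi> \<Longrightarrow> \<phi> (lscale L r x) = lscale K r (\<phi> x)"
  unfolding lie_hom_def by (metis Vector_Spaces.linear.axioms(3) module_hom.scale)

lemma lie_hom_bracket: "lie_hom L K \<phi> \<Longrightarrow> \<phi> (lbracket L x y) = lbracket K (\<phi> x) (\<phi> y)"
  unfolding lie_hom_def by blast

lemma lie_hom_zero: "lie_hom L K \<phi> \<Longrightarrow> \<phi> 0 = 0"
  by (metis add_cancel_right_right lie_hom_add)

lemma lie_hom_minus: "lie_hom L K \<phi> \<Longrightarrow> \<phi> (- x) = - \<phi> x"
  by (metis add.inverse_unique add.right_inverse lie_hom_add lie_hom_zero)

lemma lie_hom_diff: "lie_hom L K \<phi> \<Longrightarrow> \<phi> (x - y) = \<phi> x - \<phi> y"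
  by (metis add_diff_cancel diff_add_cancel lie_hom_add)

lemmas lie_hom_simps = lie_hom_add lie_hom_scale lie_hom_bracket lie_hom_zero lie_hom_minus
  lie_hom_diff

lemma lie_homI:
  assumes "vector_space (lscale L)" and "vector_space (lscale K)"
    and "\<And>x y. \<phi> (x + y) = \<phi> x + \<phi> y"
    and "\<And>r x. \<phi> (lscale L r x) = lscale K r (\<phi> x)"
    and "\<And>x y. \<phi> (lbracket L x y) = lbracket K (\<phi> x) (\<phi> y)"
  shows "lie_hom L K \<phi>"
  unfolding lie_hom_def using linear_of_rules[OF assms(1,2), of \<phi>] assms(3-5) by blast

lemma lie_hom_comp:
  assumes "lie_hom L K \<phi>" and "lie_hom K P \<psi>"
  shows "lie_hom L P (\<lambda>x. \<psi> (\<phi> x))"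
proof (rule lie_homI)
  show "vector_space (lscale L)"
    using assms(1) unfolding lie_hom_def by (meson Vector_Spaces.linear.axioms)
  show "vector_space (lscale P)"
    using assms(2) unfolding lie_hom_def by (meson Vector_Spaces.linear.axioms)
qed (simp_all add: lie_hom_simps[OF assms(1)] lie_hom_simps[OF assms(2)])

context lie_algebra
begin

abbreviation br :: "'a \<Rightarrow> 'a \<Rightarrow> 'a" where "br \<equiv> lbracket L"
abbreviation sc :: "complex \<Rightarrow> 'a \<Rightarrow> 'a" where "sc \<equiv> lscale L"

lemma br_zero_left [simp]: "br 0 x = 0"
  by (metis add_cancel_right_right bracket_add_left)

lemma br_zero_right [simp]: "br x 0 = 0"
  by (metis add_cancel_right_right bracket_add_right)

lemma br_minus_left: "br (- x) y = - br x y"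
  by (metis add.inverse_unique add.right_inverse bracket_add_left br_zero_left)

lemma br_minus_right: "br x (- y) = - br x y"
  by (metis add.inverse_unique add.right_inverse bracket_add_right br_zero_right)

lemma br_diff_left: "br (x - y) z = br x z - br y z"
  by (metis bracket_add_left br_minus_left diff_conv_add_uminus)

lemma br_diff_right: "br x (y - z) = br x y - br x z"
  by (metis bracket_add_right br_minus_right diff_conv_add_uminus)

lemma br_swap: "br y x = - br x y"
proof -
  have "br (x + y) (x + y) = 0" by (rule bracket_self)
  then have "br x y + br y x = 0"
    unfolding bracket_add_left bracket_add_right by (simp add: bracket_self add.commute)
  then show ?thesis by (simp add: eq_neg_iff_add_eq_0 add.commute)
qed

lemma br_eq_zero_swap: "br x y = 0 \<longleftrightarrow> br y x = 0"
  by (metis br_swap neg_equal_0_iff_equal)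

lemma br_derivation: "br x (br y z) = br (br x y) z + br y (br x z)"
proof -
  have "br x (br y z) + br y (br z x) + br z (br x y) = 0" by (rule jacobi)
  moreover have "br y (br z x) = - br y (br x z)"
    by (metis br_swap br_minus_right)
  moreover have "br z (br x y) = - br (br x y) z" by (rule br_swap)
  ultimately show ?thesis by (simp add: algebra_simps)
qed

lemma br_derivation_left: "br (br x y) z = br x (br y z) - br y (br x z)"
  using br_derivation[of x y z] by simp

lemmas br_simps = bracket_add_left bracket_add_right bracket_scale_left bracket_scale_right
  br_minus_left br_minus_right br_diff_left br_diff_right

abbreviation gen :: "'a set \<Rightarrow> 'a set" where "gen \<equiv> lie_generated L"

lemma subalgebraI:
  assumes "0 \<in> S" and "\<And>x y. x \<in> S \<Longrightarrow> y \<in> S \<Longrightarrow> x + y \<in> S"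
    and "\<And>r x. x \<in> S \<Longrightarrow> sc r x \<in> S" and "\<And>x y. x \<in> S \<Longrightarrow> y \<in> S \<Longrightarrow> br x y \<in> S"
  shows "lie_subalgebra L S"
  using assms unfolding lie_subalgebra_def subspace_def by blast

lemma gen_subalgebra: "lie_subalgebra L (gen U)"
  unfolding lie_generated_def lie_subalgebra_def subspace_def by blast

lemma gen_subspace: "subspace (gen U)"
  using gen_subalgebra unfolding lie_subalgebra_def by blast

lemma gen_bracket: "x \<in> gen U \<Longrightarrow> y \<in> gen U \<Longrightarrow> br x y \<in> gen U"
  using gen_subalgebra unfolding lie_subalgebra_def by blast

lemma gen_base: "u \<in> U \<Longrightarrow> u \<in> gen U"
  unfolding lie_generated_def by blast

lemma gen_induct [consumes 1, case_names base zero add scale bracket]: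
  assumes "x \<in> gen U" and "\<And>u. u \<in> U \<Longrightarrow> P u" and "P 0"
    and "\<And>x y. x \<in> gen U \<Longrightarrow> y \<in> gen U \<Longrightarrow> P x \<Longrightarrow> P y \<Longrightarrow> P (x + y)"
    and "\<And>r x. x \<in> gen U \<Longrightarrow> P x \<Longrightarrow> P (sc r x)"
    and "\<And>x y. x \<in> gen U \<Longrightarrow> y \<in> gen U \<Longrightarrow> P x \<Longrightarrow> P y \<Longrightarrow> P (br x y)"
  shows "P x"
proof -
  let ?S = "{x \<in> gen U. P x}"
  have "lie_subalgebra L ?S"
    by (rule subalgebraI)
       (auto simp: assms(3-6) subspace_0[OF gen_subspace] subspace_add[OF gen_subspace]
         subspace_scale[OF gen_subspace] gen_bracket)
  moreover have "U \<subseteq> ?S" using assms(2) gen_base by blast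
  ultimately have "gen U \<subseteq> ?S" unfolding lie_generated_def by blast
  then show ?thesis using assms(1) by blast
qed

lemma gen_minimal: "lie_subalgebra L S \<Longrightarrow> U \<subseteq> S \<Longrightarrow> gen U \<subseteq> S"
  unfolding lie_generated_def by blast

text \<open>A subspace is an ideal once it is stable under the generators of the algebra.\<close>

lemma normalizer_subalgebra:
  assumes "subspace X"
  shows "lie_subalgebra L {y. \<forall>x\<in>X. br y x \<in> X}"
proof (rule subalgebraI)
  fix y z assume "y \<in> {y. \<forall>x\<in>X. br y x \<in> X}" "z \<in> {y. \<forall>x\<in>X. br y x \<in> X}"
  then show "br y z \<in> {y. \<forall>x\<in>X. br y x \<in> X}"
    by (auto simp: br_derivation_left intro: subspace_diff[OF assms])
qed (auto simp: br_simps assms subspace_0 subspace_add subspace_scale)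

lemma central_of_generators:
  assumes "gen U = UNIV" and "\<And>u. u \<in> U \<Longrightarrow> br z u = 0"
  shows "z \<in> lie_center L UNIV"
proof -
  have "br z x = 0" if "x \<in> gen U" for x
    using that by (induction rule: gen_induct) (simp_all add: br_simps assms br_derivation)
  then show ?thesis using assms(1) by (auto simp: lie_center_def)
qed

lemma gen_ad_closed:
  assumes "x \<in> gen U" and "\<And>u. u \<in> U \<Longrightarrow> br y u \<in> gen U"
  shows "br y x \<in> gen U"
  using assms(1)
proof (induction rule: gen_induct)
  case (bracket x z)
  then show ?case
    unfolding br_derivation[of y x z]
    using subspace_add[OF gen_subspace] gen_bracket by blast
qed (auto simp: br_simps assms(2) subspace_0[OF gen_subspace]
       intro: subspace_add[OF gen_subspace] subspace_scale[OF gen_subspace])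

lemma span_bracket_mem:
  assumes "x \<in> span A" "y \<in> span B" and "subspace Z" and "\<And>a b. a \<in> A \<Longrightarrow> b \<in> B \<Longrightarrow> br a b \<in> Z"
  shows "br x y \<in> Z"
proof -
  have 1: "br a y \<in> Z" if "a \<in> A" for a
    using assms(2)
  proof (induction rule: span_induct_alt)
    case base then show ?case using subspace_0[OF assms(3)] by simp
  next
    case (step r b y)
    then show ?case using assms(3,4) that by (simp add: br_simps subspace_add subspace_scale)
  qed
  show ?thesis using assms(1)
  proof (induction rule: span_induct_alt)
    case base then show ?case using subspace_0[OF assms(3)] by simp
  next
    case (step r b x)
    then show ?case using assms(3) 1 by (simp add: br_simps subspace_add subspace_scale)
  qed
qed

end

text \<open>Gradings enter only through the eigenvalues of a linear map. Eigenvectors for distinct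
  eigenvalues are independent, so sums of eigenvectors with eigenvalues in disjoint sets \<open>P\<close> and
  \<open>Q\<close> have only zero in common.\<close>

context lie_algebra
begin

definition eigenspan :: "('a \<Rightarrow> 'a) \<Rightarrow> complex set \<Rightarrow> 'a set" where
  "eigenspan d P = span {x. \<exists>k\<in>P. d x = sc k x}"

lemma eigenspan_subspace: "subspace (eigenspan d P)"
  unfolding eigenspan_def by (rule subspace_span)

lemma eigenspan_base: "d x = sc k x \<Longrightarrow> k \<in> P \<Longrightarrow> x \<in> eigenspan d P"
  unfolding eigenspan_def by (blast intro: span_base)

lemma eigenspan_mono: "P \<subseteq> Q \<Longrightarrow> eigenspan d P \<subseteq> eigenspan d Q"
  unfolding eigenspan_def by (rule span_mono) blast

lemma eigenspan_decompose:
  assumes d: "\<And>x y. d (x + y) = d x + d y" "\<And>r x. d (sc r x) = sc r (d x)"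
    and x: "x \<in> eigenspan d P"
  shows "\<exists>K y. finite K \<and> K \<subseteq> P \<and> (\<forall>k. d (y k) = sc k (y k)) \<and> (\<forall>k. k \<notin> K \<longrightarrow> y k = 0)
           \<and> x = (\<Sum>k\<in>K. y k)"
  using x unfolding eigenspan_def
proof (induction rule: span_induct_alt)
  case base
  show ?case using d(2)[of 0 0] by (intro exI[of _ "{}"] exI[of _ "\<lambda>_. 0"]) simp
next
  case (step r a x)
  then obtain k0 where k0: "k0 \<in> P" "d a = sc k0 a" by blast
  obtain K y where K: "finite K" "K \<subseteq> P" "\<And>k. d (y k) = sc k (y k)" "\<And>k. k \<notin> K \<Longrightarrow> y k = 0"
      "x = (\<Sum>k\<in>K. y k)"
    using step.IH by blast
  define y' where "y' k = (if k = k0 then sc r a else 0) + y k" for k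
  have d0: "d 0 = 0" using d(2)[of 0 0] by simp
  have "d (y' k) = sc k (y' k)" for k
    unfolding y'_def by (auto simp: d d0 K(3) k0(2) scale_right_distrib scale_left_commute)
  moreover have "\<forall>k. k \<notin> insert k0 K \<longrightarrow> y' k = 0" by (simp add: y'_def K(4))
  moreover have "sc r a + x = (\<Sum>k\<in>insert k0 K. y' k)"
  proof -
    have "(\<Sum>k\<in>insert k0 K. y k) = (\<Sum>k\<in>K. y k)"
      by (rule sum.mono_neutral_right) (use K in auto)
    then show ?thesis using K(1,5) by (simp add: y'_def sum.distrib sum.delta)
  qed
  ultimately show ?case using K(1,2) k0(1) by (intro exI[of _ "insert k0 K"] exI[of _ y']) auto
qed

lemma eigenvectors_independent:
  assumes d: "\<And>x y. d (x + y) = d x + d y" "\<And>r x. d (sc r x) = sc r (d x)"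
    and "finite K" and "\<And>k. k \<in> K \<Longrightarrow> d (y k) = sc k (y k)" and "(\<Sum>k\<in>K. y k) = 0"
  shows "\<forall>k\<in>K. y k = 0"
  using assms(3-5)
proof (induction K arbitrary: y)
  case empty
  then show ?case by simp
next
  case (insert k0 K)
  have d0: "d 0 = 0" using d(2)[of 0 0] by simp
  have dsum: "d (\<Sum>k\<in>F. y k) = (\<Sum>k\<in>F. d (y k))" if "finite F" for F
    using that by (induction F) (simp_all add: d d0)
  \<comment> \<open>Applying \<open>d - k0\<close> to the relation removes the summand at \<open>k0\<close>.\<close>
  have "0 = d (\<Sum>k\<in>insert k0 K. y k) - sc k0 (\<Sum>k\<in>insert k0 K. y k)"
    using insert.prems(2) d0 by simp
  also have "\<dots> = (\<Sum>k\<in>insert k0 K. d (y k) - sc k0 (y k))"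
    using insert.hyps(1) by (subst dsum) (simp_all only: finite_insert scale_sum_right sum_subtractf)
  also have "\<dots> = (\<Sum>k\<in>insert k0 K. sc (k - k0) (y k))"
    by (rule sum.cong) (use insert.prems(1) in \<open>auto simp: scale_left_diff_distrib\<close>)
  also have "\<dots> = (\<Sum>k\<in>K. sc (k - k0) (y k))" using insert.hyps by simp
  finally have *: "(\<Sum>k\<in>K. sc (k - k0) (y k)) = 0" by simp
  have "\<forall>k\<in>K. sc (k - k0) (y k) = 0"
    by (rule insert.IH[OF _ *]) (use insert.prems(1) in \<open>simp add: d scale_left_commute\<close>)
  then have "\<forall>k\<in>K. y k = 0" using insert.hyps(2) by auto
  then show ?case using insert.prems(2) insert.hyps by simp
qed

lemma eigenspan_disjoint:
  assumes d: "\<And>x y. d (x + y) = d x + d y" "\<And>r x. d (sc r x) = sc r (d x)"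
    and "P \<inter> Q = {}" and "x \<in> eigenspan d P" and "x \<in> eigenspan d Q"
  shows "x = 0"
proof -
  obtain K y where K: "finite K" "K \<subseteq> P" "\<And>k. d (y k) = sc k (y k)" "\<And>k. k \<notin> K \<Longrightarrow> y k = 0"
      "x = (\<Sum>k\<in>K. y k)"
    using eigenspan_decompose[OF d assms(4)] by blast
  obtain K' y' where K': "finite K'" "K' \<subseteq> Q" "\<And>k. d (y' k) = sc k (y' k)" "\<And>k. k \<notin> K' \<Longrightarrow> y' k = 0"
      "x = (\<Sum>k\<in>K'. y' k)"
    using eigenspan_decompose[OF d assms(5)] by blast
  have "(\<Sum>k\<in>K \<union> K'. y k) = x" unfolding K(5)
    by (rule sum.mono_neutral_right) (use K K' in auto)
  moreover have "(\<Sum>k\<in>K \<union> K'. y' k) = x" unfolding K'(5)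
    by (rule sum.mono_neutral_right) (use K K' in auto)
  ultimately have 0: "(\<Sum>k\<in>K \<union> K'. y k + sc (-1) (y' k)) = 0"
    by (simp add: sum.distrib sum_subtractf)
  have "\<forall>k\<in>K \<union> K'. y k + sc (-1) (y' k) = 0"
    by (rule eigenvectors_independent[OF d _ _ 0])
       (use K(1,3) K'(1,3) in \<open>auto simp: d scale_right_distrib scale_left_commute
          simp del: scale_minus_left\<close>)
  moreover have "k \<notin> K'" if "k \<in> K" for k using that K(2) K'(2) assms(3) by blast
  ultimately have "\<forall>k\<in>K. y k = 0" using K'(4) by fastforce
  then show ?thesis using K(5) by simp
qed

end

context lie_algebra
begin

text \<open>A derivation that scales the generators is diagonalizable on the subalgebra that they generate,
  because its eigenvalues add under the bracket.\<close>

lemma derivation_eigenspan: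
  assumes d: "\<And>x y. d (x + y) = d x + d y" "\<And>r x. d (sc r x) = sc r (d x)"
    and der: "\<And>x y. x \<in> gen U \<Longrightarrow> y \<in> gen U \<Longrightarrow> d (br x y) = br (d x) y + br x (d y)"
    and U: "\<And>u. u \<in> U \<Longrightarrow> \<exists>k\<in>P. d u = sc k u"
    and P: "\<And>k k'. k \<in> P \<Longrightarrow> k' \<in> P \<Longrightarrow> k + k' \<in> P"
  shows "gen U \<subseteq> eigenspan d P"
proof
  let ?B = "{x \<in> gen U. \<exists>k\<in>P. d x = sc k x}"
  fix x assume "x \<in> gen U"
  then have "x \<in> span ?B"
  proof (induction rule: gen_induct)
    case (base u)
    then show ?case using U gen_base by (blast intro: span_base)
  next
    case (bracket x y)
    show ?case
    proof (rule span_bracket_mem[OF bracket.IH subspace_span])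
      fix a b assume a: "a \<in> ?B" and b: "b \<in> ?B"
      then obtain k k' where k: "k \<in> P" "k' \<in> P" "d a = sc k a" "d b = sc k' b" by blast
      have "d (br a b) = sc (k + k') (br a b)"
        using der[of a b] a b k(3,4) by (simp add: br_simps scale_left_distrib)
      then show "br a b \<in> span ?B" using P[OF k(1,2)] a b gen_bracket by (blast intro: span_base)
    qed
  qed (auto intro: span_zero span_add span_scale)
  moreover have "span ?B \<subseteq> eigenspan d P"
    unfolding eigenspan_def by (rule span_mono) blast
  ultimately show "x \<in> eigenspan d P" by blast
qed

lemma ad_eigenspan:
  assumes "\<And>u. u \<in> U \<Longrightarrow> \<exists>k\<in>P. br h u = sc k u"
    and "\<And>k k'. k \<in> P \<Longrightarrow> k' \<in> P \<Longrightarrow> k + k' \<in> P"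
  shows "gen U \<subseteq> eigenspan (br h) P"
  by (rule derivation_eigenspan) (use assms in \<open>auto simp: br_simps intro: br_derivation\<close>)

end

section \<open>The universal property of free Lie algebras\<close>

text \<open>Linear operators form a Lie algebra, but the commutator is not bilinear on the type of all
  maps. Homomorphisms are therefore constructed into a subset on which the axioms hold.\<close>

locale lie_algebra_within = vector_space "lscale K"
  for K :: "('a::ab_group_add) lie_alg" +
  fixes S :: "'a set"
  assumes within_subspace: "module.subspace (lscale K) S"
    and within_bracket: "x \<in> S \<Longrightarrow> y \<in> S \<Longrightarrow> lbracket K x y \<in> S"
    and within_add_left: "x \<in> S \<Longrightarrow> y \<in> S \<Longrightarrow> z \<in> S \<Longrightarrow>
      lbracket K (x + y) z = lbracket K x z + lbracket K y z"
    and within_add_right: "x \<in> S \<Longrightarrow> y \<in> S \<Longrightarrow> z \<in> S \<Longrightarrow>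
      lbracket K x (y + z) = lbracket K x y + lbracket K x z"
    and within_scale_left: "x \<in> S \<Longrightarrow> y \<in> S \<Longrightarrow>
      lbracket K (lscale K r x) y = lscale K r (lbracket K x y)"
    and within_scale_right: "x \<in> S \<Longrightarrow> y \<in> S \<Longrightarrow>
      lbracket K x (lscale K r y) = lscale K r (lbracket K x y)"
    and within_self: "x \<in> S \<Longrightarrow> lbracket K x x = 0"
    and within_jacobi: "x \<in> S \<Longrightarrow> y \<in> S \<Longrightarrow> z \<in> S \<Longrightarrow>
      lbracket K x (lbracket K y z) + lbracket K y (lbracket K z x)
        + lbracket K z (lbracket K x y) = 0"

lemma (in lie_algebra) lie_algebra_within_UNIV: "lie_algebra_within L UNIV"
  by unfold_locales
     (auto simp: br_simps bracket_self jacobi)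

primrec lie_eval :: "('b::ab_group_add) lie_alg \<Rightarrow> ('x \<Rightarrow> 'b) \<Rightarrow> 'x lie_term \<Rightarrow> 'b" where
  "lie_eval K g (TGen x) = g x"
| "lie_eval K g TZero = 0"
| "lie_eval K g (TAdd s t) = lie_eval K g s + lie_eval K g t"
| "lie_eval K g (TScale r t) = lscale K r (lie_eval K g t)"
| "lie_eval K g (TBr s t) = lbracket K (lie_eval K g s) (lie_eval K g t)"

lemma lscale_free: "lscale free_lie_alg = free_scale"
  and lbracket_free: "lbracket free_lie_alg = free_bracket"
  by (simp_all add: free_lie_alg_def)

context lie_algebra_within
begin

lemma lie_eval_mem: "(\<And>x. g x \<in> S) \<Longrightarrow> lie_eval K g t \<in> S"
  by (induction t)
     (auto simp: within_bracket subspace_0 subspace_add subspace_scale within_subspace)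

lemma lie_eval_cong:
  assumes "lie_eq s t" and g: "\<And>x. g x \<in> S"
  shows "lie_eval K g s = lie_eval K g t"
  using assms(1)
proof (induction rule: lie_eq.induct)
  case (le_jacobi s t u)
  then show ?case by (simp add: lie_eval_mem[OF g] within_jacobi)
qed (simp_all add: lie_eval_mem[OF g] within_add_left within_add_right within_scale_left
       within_scale_right within_self within_bracket scale_right_distrib
       scale_left_distrib ac_simps)

lemma free_lie_universal:
  assumes g: "\<And>x. g x \<in> S"
  obtains \<phi> where "lie_hom free_lie_alg K \<phi>" and "\<And>x. \<phi> (free_gen x) = g x"
    and "\<And>y. \<phi> y \<in> S"
proof
  let ?\<phi> = "\<lambda>x. lie_eval K g (rep_free_lie x)"
  have abs: "?\<phi> (abs_free_lie t) = lie_eval K g t" for t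
    by (rule lie_eval_cong[OF _ g])
       (metis Quotient3_free_lie Quotient3_rep_abs le_refl)
  show "lie_hom free_lie_alg K ?\<phi>"
  proof (rule lie_homI)
    show "vector_space (lscale free_lie_alg)"
      using lie_algebra_free by (rule lie_algebra.axioms)
    show "vector_space (lscale K)" by unfold_locales
    fix x y :: "'b free_lie" and r
    obtain s t where st: "x = abs_free_lie s" "y = abs_free_lie t"
      by (metis Quotient3_free_lie Quotient3_abs_rep)
    show "?\<phi> (x + y) = ?\<phi> x + ?\<phi> y"
      by (simp only: st plus_free_lie.abs_eq abs lie_eval.simps)
    show "?\<phi> (lscale free_lie_alg r x) = lscale K r (?\<phi> x)"
      by (simp only: st lscale_free free_scale.abs_eq abs lie_eval.simps)
    show "?\<phi> (lbracket free_lie_alg x y) = lbracket K (?\<phi> x) (?\<phi> y)"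
      by (simp only: st lbracket_free free_bracket.abs_eq abs lie_eval.simps)
  qed
  show "?\<phi> (free_gen x) = g x" for x
    by (simp add: free_gen_def abs)
  show "?\<phi> y \<in> S" for y by (rule lie_eval_mem[OF g])
qed

end

lemma free_lie_generated: "lie_generated free_lie_alg (range free_gen) = UNIV"
proof -
  interpret F: lie_algebra "free_lie_alg :: 'a free_lie lie_alg" by (rule lie_algebra_free)
  have "abs_free_lie t \<in> F.gen (range free_gen)" for t :: "'a lie_term"
  proof (induction t)
    case (TGen x)
    then show ?case using F.gen_base[of "free_gen x"] by (simp add: free_gen.abs_eq)
  next
    case TZero
    then show ?case using F.subspace_0[OF F.gen_subspace] by (simp add: zero_free_lie.abs_eq)
  next
    case (TAdd s t)
    then show ?case using F.subspace_add[OF F.gen_subspace]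
      by (metis plus_free_lie.abs_eq)
  next
    case (TScale r t)
    then show ?case using F.subspace_scale[OF F.gen_subspace]
      by (metis free_scale.abs_eq lscale_free)
  next
    case (TBr s t)
    then show ?case using F.gen_bracket by (metis free_bracket.abs_eq lbracket_free)
  qed
  then show ?thesis
    by (metis Quotient3_abs_rep Quotient3_free_lie UNIV_eq_I)
qed

lemma lie_hom_eq_on_generated:
  assumes "lie_algebra L" and \<phi>: "lie_hom L K \<phi>" and \<psi>: "lie_hom L K \<psi>"
    and U: "\<And>u. u \<in> U \<Longrightarrow> \<phi> u = \<psi> u" and x: "x \<in> lie_generated L U"
  shows "\<phi> x = \<psi> x"
proof -
  interpret lie_algebra L by fact
  from x show ?thesis
    by (induction rule: gen_induct) (simp_all add: U lie_hom_simps[OF \<phi>] lie_hom_simps[OF \<psi>])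
qed

lemma lie_hom_generated:
  assumes "lie_algebra L" and "lie_algebra K" and \<phi>: "lie_hom L K \<phi>" and x: "x \<in> lie_generated L U"
  shows "\<phi> x \<in> lie_generated K (\<phi> ` U)"
proof -
  interpret L: lie_algebra L by fact
  interpret K: lie_algebra K by fact
  from x show ?thesis
    by (induction rule: L.gen_induct)
       (auto simp: lie_hom_simps[OF \<phi>] intro: K.gen_base K.gen_bracket
         K.subspace_0[OF K.gen_subspace] K.subspace_add[OF K.gen_subspace]
         K.subspace_scale[OF K.gen_subspace])
qed

section \<open>Lie algebras of operators\<close>

definition gl :: "(complex \<Rightarrow> 'v \<Rightarrow> 'v) \<Rightarrow> ('v \<Rightarrow> 'v::ab_group_add) lie_alg" where
  "gl s = \<lparr>lscale = (\<lambda>r F v. s r (F v)), lbracket = (\<lambda>F G v. F (G v) - G (F v))\<rparr>"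

lemma lscale_gl: "lscale (gl s) r F = (\<lambda>v. s r (F v))"
  and lbracket_gl: "lbracket (gl s) F G = (\<lambda>v. F (G v) - G (F v))"
  by (simp_all add: gl_def)

lemma vector_space_pointwise:
  fixes s :: "complex \<Rightarrow> 'v::ab_group_add \<Rightarrow> 'v"
  assumes "vector_space s"
  shows "vector_space (\<lambda>r (F :: 'w \<Rightarrow> 'v) w. s r (F w))"
proof -
  interpret vector_space s by fact
  show ?thesis
    by unfold_locales (simp_all add: fun_eq_iff scale_right_distrib scale_left_distrib)
qed

lemma lie_algebra_within_gl:
  assumes "vector_space s"
  shows "lie_algebra_within (gl s) {F. (\<forall>v w. F (v + w) = F v + F w) \<and> (\<forall>r v. F (s r v) = s r (F v))}"
proof -
  interpret V: vector_space s by fact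
  interpret W: vector_space "lscale (gl s)"
    using vector_space_pointwise[OF assms] by (simp add: gl_def)
  have minus: "F (v - w) = F v - F w" if "\<forall>v w. F (v + w) = F v + F w" for F :: "'a \<Rightarrow> 'a" and v w
    by (metis add_diff_cancel diff_add_cancel that)
  show ?thesis
    by unfold_locales
       (auto simp: W.subspace_def lscale_gl lbracket_gl fun_eq_iff V.scale_right_distrib
         V.scale_right_diff_distrib V.scale_left_commute algebra_simps minus)
qed

section \<open>Presentations of Borcherds algebras\<close>

text \<open>The relations are formulated for arbitrary elements with a bracket, so that they make sense for operators too.\<close>

definition borcherds_relations ::
    "'i set \<Rightarrow> ('i \<Rightarrow> 'i \<Rightarrow> real) \<Rightarrow> ('b::ab_group_add) lie_alg \<Rightarrow>
     ('i \<Rightarrow> 'b) \<Rightarrow> ('i \<Rightarrow> 'b) \<Rightarrow> ('i \<Rightarrow> 'b) \<Rightarrow> bool" where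
  "borcherds_relations I A K E F H \<longleftrightarrow> (\<forall>i\<in>I. \<forall>j\<in>I.
     lbracket K (H i) (H j) = 0 \<and>
     lbracket K (H i) (E j) = lscale K (of_real (A i j)) (E j) \<and>
     lbracket K (H i) (F j) = - lscale K (of_real (A i j)) (F j) \<and>
     lbracket K (E i) (F j) = (if i = j then H i else 0) \<and>
     (A i j = 0 \<longrightarrow> lbracket K (E i) (E j) = 0 \<and> lbracket K (F i) (F j) = 0))"

lemma borcherds_relations_flip:
  assumes "lie_algebra K" and "borcherds_relations I A K E F H"
  shows "borcherds_relations I A K F E (\<lambda>i. - H i)"
proof -
  interpret lie_algebra K by fact
  have "br (F i) (E j) = (if i = j then - H i else 0)" if "i \<in> I" "j \<in> I" for i j
    using assms(2) that br_swap[of "F i" "E j"] unfolding borcherds_relations_def by auto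
  then show ?thesis
    using assms(2) unfolding borcherds_relations_def by (auto simp: br_simps)
qed

lemma relators_vanish_iff:
  fixes \<phi> :: "'i bgen free_lie \<Rightarrow> 'b::ab_group_add"
  assumes "lie_hom free_lie_alg K \<phi>"
  shows "(\<forall>x\<in>borcherds_relators I A. \<phi> x = 0) \<longleftrightarrow>
    borcherds_relations I A K (\<lambda>i. \<phi> (free_gen (Egen i))) (\<lambda>i. \<phi> (free_gen (Fgen i)))
      (\<lambda>i. \<phi> (free_gen (Hgen i))) \<and>
    (\<forall>i. i \<notin> I \<longrightarrow> \<phi> (free_gen (Egen i)) = 0 \<and> \<phi> (free_gen (Fgen i)) = 0 \<and>
      \<phi> (free_gen (Hgen i)) = 0)" (is "?L \<longleftrightarrow> ?R")
proof -
  note s = lie_hom_simps[OF assms, unfolded lscale_free lbracket_free]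
  show ?thesis
  proof
    assume L: ?L
    have r: "\<phi> x = 0" if "x \<in> borcherds_relators I A" for x using L that by blast
    note r = r[unfolded borcherds_relators_def Let_def Un_iff mem_Collect_eq]
    have "\<phi> (free_bracket (free_gen (Egen i)) (free_gen (Fgen j))
              - (if i = j then free_gen (Hgen i) else 0)) = 0" if "i \<in> I" "j \<in> I" for i j
      by (rule r) (use that in blast)
    then have EF: "lbracket K (\<phi> (free_gen (Egen i))) (\<phi> (free_gen (Fgen j)))
      = (if i = j then \<phi> (free_gen (Hgen i)) else 0)" if "i \<in> I" "j \<in> I" for i j
      using that by (cases "i = j") (fastforce simp: s)+
    have HH: "\<phi> (free_bracket (free_gen (Hgen i)) (free_gen (Hgen j))) = 0"
      if "i \<in> I" "j \<in> I" for i j by (rule r) (use that in blast)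
    have HE: "\<phi> (free_bracket (free_gen (Hgen i)) (free_gen (Egen j))
        - free_scale (of_real (A i j)) (free_gen (Egen j))) = 0"
      if "i \<in> I" "j \<in> I" for i j by (rule r) (use that in blast)
    have HF: "\<phi> (free_bracket (free_gen (Hgen i)) (free_gen (Fgen j))
        + free_scale (of_real (A i j)) (free_gen (Fgen j))) = 0"
      if "i \<in> I" "j \<in> I" for i j by (rule r) (use that in blast)
    have EE: "\<phi> (free_bracket (free_gen (Egen i)) (free_gen (Egen j))) = 0"
      if "i \<in> I" "j \<in> I" "A i j = 0" for i j by (rule r) (use that in blast)
    have FF: "\<phi> (free_bracket (free_gen (Fgen i)) (free_gen (Fgen j))) = 0"
      if "i \<in> I" "j \<in> I" "A i j = 0" for i j by (rule r) (use that in blast)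
    have out: "\<phi> (free_gen x) = 0" if "i \<notin> I" "x \<in> {Egen i, Fgen i, Hgen i}" for i x
      by (rule r) (use that in blast)
    show ?R
      unfolding borcherds_relations_def
      using EF HH HE HF EE FF out by (auto simp: s eq_neg_iff_add_eq_0)
  next
    assume R: ?R
    then show ?L
      unfolding borcherds_relators_def borcherds_relations_def Let_def
      by (auto simp: s)
  qed
qed

text \<open>The bilinearity on \<open>S\<close> gives \<open>[x, 0] = 0\<close> there, which is not available for nonlinear operators.\<close>

lemma lie_hom_kernel_ideal:
  assumes "lie_algebra L" and \<phi>: "lie_hom L K \<phi>" and "lie_algebra_within K S" and "\<And>x. \<phi> x \<in> S"
  shows "lie_ideal L {x. \<phi> x = 0}"
proof -
  interpret L: lie_algebra L by fact
  interpret K: lie_algebra_within K S by fact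
  have "lbracket K (\<phi> x) 0 = 0" for x
    using K.within_scale_right[OF assms(4)[of x] assms(4)[of x], of 0] by simp
  then show ?thesis
    unfolding lie_ideal_def L.subspace_def
    by (simp add: lie_hom_simps[OF \<phi>])
qed

lemma lie_ideal_generated_least:
  "lie_ideal L J \<Longrightarrow> R \<subseteq> J \<Longrightarrow> lie_ideal_generated L R \<subseteq> J"
  unfolding lie_ideal_generated_def by blast

lemma lie_ideal_generated_superset: "R \<subseteq> lie_ideal_generated L R"
  unfolding lie_ideal_generated_def by blast

lemma borcherds_algebra_facts:
  assumes "borcherds_algebra I A G e f h"
  shows "lie_algebra G" and "borcherds_relations I A G e f h"
    and "lie_generated G (e ` I \<union> f ` I \<union> h ` I) = UNIV"
proof -
  obtain \<phi> where q: "lie_algebra G" and hom: "lie_hom free_lie_alg G \<phi>" and surj: "surj \<phi>"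
      and ker: "{x. \<phi> x = 0} = lie_ideal_generated free_lie_alg (borcherds_relators I A)"
      and val: "\<forall>i\<in>I. \<phi> (free_gen (Egen i)) = e i \<and> \<phi> (free_gen (Fgen i)) = f i \<and>
                 \<phi> (free_gen (Hgen i)) = h i"
    using assms unfolding borcherds_algebra_def lie_quotient_map_def by blast
  interpret lie_algebra G by (rule q)
  show "lie_algebra G" by (rule q)
  have "\<forall>x\<in>borcherds_relators I A. \<phi> x = 0"
    using lie_ideal_generated_superset ker by blast
  note rel = this[unfolded relators_vanish_iff[OF hom]]
  then show "borcherds_relations I A G e f h"
    using val unfolding borcherds_relations_def by simp
  let ?X = "e ` I \<union> f ` I \<union> h ` I"
  have "\<phi> (free_gen u) \<in> gen ?X" for u
  proof (cases u)
    case (Egen i)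
    then show ?thesis using rel val gen_base[of "e i" ?X] subspace_0[OF gen_subspace, of ?X]
      by (cases "i \<in> I") auto
  next
    case (Fgen i)
    then show ?thesis using rel val gen_base[of "f i" ?X] subspace_0[OF gen_subspace, of ?X]
      by (cases "i \<in> I") auto
  next
    case (Hgen i)
    then show ?thesis using rel val gen_base[of "h i" ?X] subspace_0[OF gen_subspace, of ?X]
      by (cases "i \<in> I") auto
  qed
  then have "gen (\<phi> ` range free_gen) \<subseteq> gen ?X"
    by (intro gen_minimal gen_subalgebra) blast
  moreover have "\<phi> x \<in> gen (\<phi> ` range free_gen)" for x
    by (rule lie_hom_generated[OF lie_algebra_free q hom]) (simp add: free_lie_generated)
  ultimately have "\<phi> x \<in> gen ?X" for x by blast
  then show "gen ?X = UNIV" using surj by (metis UNIV_eq_I surjD)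
qed

text \<open>The kernel of the extension to the free Lie algebra is an ideal that contains the relators.\<close>

lemma borcherds_universal:
  assumes "borcherds_algebra I A G e f h" and K: "lie_algebra_within K S"
    and rel: "borcherds_relations I A K E F H"
    and S: "\<And>i. i \<in> I \<Longrightarrow> E i \<in> S \<and> F i \<in> S \<and> H i \<in> S"
  obtains R where "lie_hom G K R" and "\<And>i. i \<in> I \<Longrightarrow> R (e i) = E i"
proof -
  interpret K: lie_algebra_within K S by fact
  obtain \<phi> where q: "lie_algebra G" and hom: "lie_hom free_lie_alg G \<phi>" and surj: "surj \<phi>"
      and ker: "{x. \<phi> x = 0} = lie_ideal_generated free_lie_alg (borcherds_relators I A)"
      and val: "\<forall>i\<in>I. \<phi> (free_gen (Egen i)) = e i \<and> \<phi> (free_gen (Fgen i)) = f i \<and>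
                 \<phi> (free_gen (Hgen i)) = h i"
    using assms unfolding borcherds_algebra_def lie_quotient_map_def by blast
  interpret G: lie_algebra G by (rule q)
  define g where "g x = (case x of Egen i \<Rightarrow> if i \<in> I then E i else 0
      | Fgen i \<Rightarrow> if i \<in> I then F i else 0 | Hgen i \<Rightarrow> if i \<in> I then H i else 0)" for x
  have gS: "g x \<in> S" for x
    using S K.subspace_0[OF K.within_subspace] by (auto simp: g_def split: bgen.split)
  obtain R0 where R0: "lie_hom free_lie_alg K R0" "\<And>x. R0 (free_gen x) = g x" "\<And>y. R0 y \<in> S"
    using K.free_lie_universal[of g] gS by blast
  have "\<forall>x\<in>borcherds_relators I A. R0 x = 0"
    unfolding relators_vanish_iff[OF R0(1)]
    using rel by (auto simp: R0(2) g_def borcherds_relations_def)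
  then have "{x. \<phi> x = 0} \<subseteq> {x. R0 x = 0}"
    unfolding ker
    by (intro lie_ideal_generated_least lie_hom_kernel_ideal[OF lie_algebra_free R0(1) K R0(3)]) blast
  then have wd: "R0 x = R0 y" if "\<phi> x = \<phi> y" for x y
    using that lie_hom_diff[OF hom, of x y] lie_hom_diff[OF R0(1), of x y] by auto
  define R where "R a = R0 (inv \<phi> a)" for a
  have R: "R (\<phi> x) = R0 x" for x
    unfolding R_def by (rule wd) (simp add: surj surj_f_inv_f)
  have "lie_hom G K R"
  proof (rule lie_homI)
    show "vector_space (lscale G)" "vector_space (lscale K)" by unfold_locales
    fix a b r
    obtain x y where xy: "a = \<phi> x" "b = \<phi> y" using surj by (metis surjD)
    show "R (a + b) = R a + R b"
      unfolding xy lie_hom_add[OF hom, symmetric] R by (rule lie_hom_add[OF R0(1)])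
    show "R (lscale G r a) = lscale K r (R a)"
      unfolding xy lie_hom_scale[OF hom, symmetric] R by (rule lie_hom_scale[OF R0(1)])
    show "R (lbracket G a b) = lbracket K (R a) (R b)"
      unfolding xy lie_hom_bracket[OF hom, symmetric] R by (rule lie_hom_bracket[OF R0(1)])
  qed
  moreover have "R (e i) = E i" if "i \<in> I" for i
    using R[of "free_gen (Egen i)"] val R0(2) that by (simp add: g_def)
  ultimately show thesis using that by blast
qed

text \<open>The substitution \<open>e \<leftrightarrow> f\<close>, \<open>h \<mapsto> -h\<close> permutes the relators up to sign and is an involution of
  the free Lie algebra, so it maps the ideal of relations onto itself. Every statement on the
  positive half of a Borcherds algebra thus yields one on the negative half.\<close>

theorem borcherds_chevalley_involution:
  assumes "borcherds_algebra I A G e f h"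
  shows "borcherds_algebra I A G f e (\<lambda>i. - h i)"
proof -
  obtain \<phi> where q: "lie_algebra G" and hom: "lie_hom free_lie_alg G \<phi>" and surj: "surj \<phi>"
      and ker: "{x. \<phi> x = 0} = lie_ideal_generated free_lie_alg (borcherds_relators I A)"
      and val: "\<forall>i\<in>I. \<phi> (free_gen (Egen i)) = e i \<and> \<phi> (free_gen (Fgen i)) = f i \<and>
                 \<phi> (free_gen (Hgen i)) = h i"
    using assms unfolding borcherds_algebra_def lie_quotient_map_def by blast
  interpret F: lie_algebra "free_lie_alg :: 'a bgen free_lie lie_alg" by (rule lie_algebra_free)
  interpret G: lie_algebra G by (rule q)
  interpret F': lie_algebra_within "free_lie_alg :: 'a bgen free_lie lie_alg" UNIV
    by (rule F.lie_algebra_within_UNIV)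
  define g :: "'a bgen \<Rightarrow> 'a bgen free_lie" where
    "g x = (case x of Egen i \<Rightarrow> free_gen (Fgen i) | Fgen i \<Rightarrow> free_gen (Egen i)
        | Hgen i \<Rightarrow> - free_gen (Hgen i))" for x
  obtain \<omega> where \<omega>: "lie_hom free_lie_alg free_lie_alg \<omega>" "\<And>x. \<omega> (free_gen x) = g x"
    by (rule F'.free_lie_universal[of g, OF UNIV_I]) blast
  have \<omega>2: "\<omega> (\<omega> x) = x" for x
  proof (rule lie_hom_eq_on_generated[OF lie_algebra_free lie_hom_comp[OF \<omega>(1) \<omega>(1)]])
    show "lie_hom free_lie_alg free_lie_alg (\<lambda>x :: 'a bgen free_lie. x)"
      by (rule lie_homI) (simp_all add: F.vector_space_axioms)
    show "\<omega> (\<omega> u) = u" if "u \<in> range free_gen" for u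
      using that by (auto simp: \<omega>(2) g_def lie_hom_minus[OF \<omega>(1)] split: bgen.split)
    show "x \<in> lie_generated free_lie_alg (range free_gen)" by (simp add: free_lie_generated)
  qed
  let ?\<phi>' = "\<lambda>x. \<phi> (\<omega> x)"
  have hom': "lie_hom free_lie_alg G ?\<phi>'" by (rule lie_hom_comp[OF \<omega>(1) hom])
  have "\<forall>x\<in>borcherds_relators I A. \<phi> x = 0"
    using lie_ideal_generated_superset ker by blast
  note rel = this[unfolded relators_vanish_iff[OF hom]]
  have "\<forall>x\<in>borcherds_relators I A. ?\<phi>' x = 0"
    unfolding relators_vanish_iff[OF hom']
    using rel borcherds_relations_flip[OF q] by (auto simp: \<omega>(2) g_def lie_hom_minus[OF hom])
  then have "{x. \<phi> x = 0} \<subseteq> {x. ?\<phi>' x = 0}"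
    unfolding ker
    by (intro lie_ideal_generated_least
          lie_hom_kernel_ideal[OF lie_algebra_free hom' G.lie_algebra_within_UNIV]) auto
  then have sub: "?\<phi>' x = 0" if "\<phi> x = 0" for x using that by blast
  have "{x. ?\<phi>' x = 0} = {x. \<phi> x = 0}"
    using sub sub[of "\<omega> _", unfolded \<omega>2] by blast
  moreover have "surj ?\<phi>'" using surj \<omega>2 by (metis surj_def)
  ultimately show ?thesis
    unfolding borcherds_algebra_def lie_quotient_map_def
    using q hom' ker val by (intro exI[of _ ?\<phi>']) (auto simp: \<omega>(2) g_def lie_hom_minus[OF hom])
qed

section \<open>Free Lie algebras acting by shifts\<close>

text \<open>The iterated bracket of the letters of a word, the last letter being innermost. With the
  convention that the empty word has bracket zero, it is the Dynkin operator from
  words to the free Lie algebra.\<close>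

primrec bracket_word :: "('b \<Rightarrow> 'x) \<Rightarrow> 'b list \<Rightarrow> 'x free_lie" where
  "bracket_word nm [] = 0"
| "bracket_word nm (b # w) =
     (if w = [] then free_gen (nm b) else free_bracket (bracket_word nm w) (free_gen (nm b)))"

text \<open>The argument of Dynkin, Specht and Wever. Let the free generators act on functions of words by
  shifts, and let \<open>D\<close> be the function given by iterated brackets. An element \<open>a\<close> sends \<open>D\<close> to \<open>[D, a]\<close> on nonempty words,
  by the Jacobi identity. On the empty word the value \<open>E a\<close> satisfies
  \<open>E [a, b] = [E a, b] + [a, E b]\<close> and \<open>E u = u\<close> for generators. Hence \<open>E\<close> is the Euler
  derivation, whose eigenvalues on the free Lie algebra are positive integers, and \<open>a\<close> acting by zero forces \<open>E a = 0\<close>.\<close>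

theorem free_lie_shift_faithful:
  fixes S :: "'x free_lie \<Rightarrow> ('b list \<Rightarrow> 'x free_lie) \<Rightarrow> ('b list \<Rightarrow> 'x free_lie)"
  assumes S: "lie_hom free_lie_alg (gl (\<lambda>r F w. free_scale r (F w))) S"
    and shift: "\<And>u. u \<in> U \<Longrightarrow> S (free_gen u) = (\<lambda>F w. F (blk u # w))"
    and nm: "\<And>u. u \<in> U \<Longrightarrow> nm (blk u) = u"
    and x: "x \<in> lie_generated free_lie_alg (free_gen ` U)" and "S x = 0"
  shows "x = 0"
proof -
  interpret F: lie_algebra "free_lie_alg :: 'x free_lie lie_alg" by (rule lie_algebra_free)
  note [simp] = lscale_free lbracket_free
  note Fs = F.br_simps[simplified] F.br_zero_left[simplified] F.br_zero_right[simplified]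
  have Sadd: "S (a + b) F w = S a F w + S b F w" for a b F w
    using lie_hom_add[OF S, of a b] by simp
  have Ssc: "S (free_scale r a) F w = free_scale r (S a F w)" for r a F w
    using lie_hom_scale[OF S, of r a] by (simp add: lscale_gl)
  have Sbr: "S (free_bracket a b) F w = S a (S b F) w - S b (S a F) w" for a b F w
    using lie_hom_bracket[OF S, of a b] by (simp add: lbracket_gl)
  have S0: "S 0 F w = 0" for F w
    using lie_hom_zero[OF S] by simp
  note Ss = Sadd Ssc Sbr S0
  let ?g = "F.gen (free_gen ` U)"
  define D where "D = bracket_word nm"
  \<comment> \<open>The empty word is never read: every element of the subalgebra prepends at least one letter.\<close>
  have local: "S a F = S a F'" if "a \<in> ?g" "\<And>w. w \<noteq> [] \<Longrightarrow> F w = F' w" for a F F'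
    using that
  proof (induction arbitrary: F F' rule: F.gen_induct)
    case (bracket a b)
    have "S b F = S b F'" "S a F = S a F'" using bracket by blast+
    then show ?case by (intro ext) (simp add: Ss)
  next
    case (add a b)
    have "S b F = S b F'" "S a F = S a F'" using add by blast+
    then show ?case by (intro ext) (simp add: Ss)
  next
    case (scale r a)
    have "S a F = S a F'" using scale by blast
    then show ?case by (intro ext) (simp add: Ss)
  qed (auto simp: fun_eq_iff Ss shift)
  have natural: "S a (\<lambda>w. free_bracket (F w) y) = (\<lambda>w. free_bracket (S a F w) y)"
    if "a \<in> ?g" for a F y
    using that
  proof (induction arbitrary: F rule: F.gen_induct)
    case (bracket a b)
    show ?case by (intro ext) (simp add: Ss Fs bracket.IH)
  qed (auto simp: fun_eq_iff Ss shift Fs)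
  have step: "S a (S b D) = (\<lambda>w. free_bracket (S a D w) b)"
    if "a \<in> ?g" "\<And>w. w \<noteq> [] \<Longrightarrow> S b D w = free_bracket (D w) b" for a b
    using local[OF that(1), of "S b D" "\<lambda>w. free_bracket (D w) b"] that natural by simp
  have ad: "S a D w = free_bracket (D w) a" if "a \<in> ?g" "w \<noteq> []" for a w
    using that
  proof (induction arbitrary: w rule: F.gen_induct)
    case (base u)
    then show ?case by (auto simp: shift D_def nm)
  next
    case (bracket a b)
    have "S (free_bracket a b) D w
        = free_bracket (free_bracket (D w) a) b - free_bracket (free_bracket (D w) b) a"
      by (simp add: Ss step bracket)
    also have "\<dots> = free_bracket (D w) (free_bracket a b)"
      using F.br_derivation[of "D w" a b] F.br_swap[of a "free_bracket (D w) b"] by simp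
    finally show ?case by simp
  qed (simp_all add: Ss Fs)
  define E where "E a = S a D []" for a
  have Eadd: "E (a + b) = E a + E b" and Esc: "E (F.sc r a) = F.sc r (E a)" for a b r
    by (simp_all add: E_def Ss)
  have "?g \<subseteq> F.eigenspan E {of_nat n | n. n > 0}"
  proof (rule F.derivation_eigenspan[OF Eadd Esc])
    fix a b assume ab: "a \<in> ?g" "b \<in> ?g"
    show "E (F.br a b) = F.br (E a) b + F.br a (E b)"
      using ab F.br_swap[of a "E b"] by (simp add: E_def Ss step ad)
  next
    fix u assume "u \<in> free_gen ` U"
    then have "E u = F.sc (of_nat 1) u"
      using F.scale_one by (auto simp: E_def shift D_def nm)
    then show "\<exists>k\<in>{of_nat n | n. n > 0}. E u = F.sc k u" by (metis (mono_tags) mem_Collect_eq zero_less_one)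
  next
    fix k k' :: complex assume "k \<in> {of_nat n | n. n > 0}" "k' \<in> {of_nat n | n. n > 0}"
    then obtain n n' where "k = of_nat n" "k' = of_nat n'" "n > 0" by blast
    then have "k + k' = of_nat (n + n') \<and> n + n' > 0" by simp
    then show "k + k' \<in> {of_nat n | n. n > 0}" by blast
  qed
  then have "x \<in> F.eigenspan E {of_nat n | n. n > 0}" using x by blast
  moreover have "x \<in> F.eigenspan E {0}"
    by (rule F.eigenspan_base[of _ _ 0]) (use F.scale_zero_left in \<open>simp_all add: E_def \<open>S x = 0\<close>\<close>)
  ultimately show "x = 0"
    by (rule F.eigenspan_disjoint[OF Eadd Esc, rotated]) auto
qed

section \<open>The dual of a highest weight module\<close>

text \<open>The tensor algebra on the blocks \<open>(\<nu>, i)\<close> is a module in which \<open>f\<^sub>i\<close> for \<open>i \<in> K\<close> is multiplication by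
  \<open>({#}, i)\<close>, while \<open>e\<^sub>j\<close>, \<open>f\<^sub>j\<close> for \<open>j \<in> J\<close> and all \<open>h\<^sub>k\<close> are derivations that kill the empty word. It is
  convenient to work with its dual, the space of all functions on words: no finiteness of support
  is needed, and the transposed operators are given by recursion on words. Transposition reverses
  products, so that it is combined with the exchange of \<open>e\<close> and \<open>f\<close>.\<close>

text \<open>The transpose of the derivation that sends the letter \<open>b\<close> to \<open>c b\<close> times the letter \<open>t b\<close>.\<close>

primrec letterwise ::
    "(complex \<Rightarrow> 'y \<Rightarrow> 'y) \<Rightarrow> ('b \<Rightarrow> complex) \<Rightarrow> ('b \<Rightarrow> 'b) \<Rightarrow> ('b list \<Rightarrow> 'y) \<Rightarrow> 'b list \<Rightarrow> 'y::ab_group_add"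
  where
  "letterwise s c t F [] = 0"
| "letterwise s c t F (b # w) = s (c b) (F (t b # w)) + letterwise s c t (\<lambda>v. F (b # v)) w"

locale block_module = vector_space s
  for s :: "complex \<Rightarrow> 'y::ab_group_add \<Rightarrow> 'y" +
  fixes J K :: "'i set" and A :: "'i \<Rightarrow> 'i \<Rightarrow> real"
  assumes A_zero: "j \<in> J \<Longrightarrow> k \<in> J \<Longrightarrow> A j k = 0"
    and A_nonzero: "i \<in> K \<Longrightarrow> j \<in> J \<union> K \<Longrightarrow> A i j \<noteq> 0 \<and> A j i \<noteq> 0"
    and disjoint: "J \<inter> K = {}"
begin

abbreviation lw :: "('b \<Rightarrow> complex) \<Rightarrow> ('b \<Rightarrow> 'b) \<Rightarrow> ('b list \<Rightarrow> 'y) \<Rightarrow> 'b list \<Rightarrow> 'y" where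
  "lw \<equiv> letterwise s"

lemma lw_add: "lw c t (\<lambda>v. F v + F' v) w = lw c t F w + lw c t F' w"
  by (induction w arbitrary: F F') (simp_all add: scale_right_distrib)

lemma lw_scale: "lw c t (\<lambda>v. s r (F v)) w = s r (lw c t F w)"
  by (induction w arbitrary: F) (simp_all add: scale_right_distrib scale_left_commute)

lemma lw_minus: "lw c t (\<lambda>v. - F v) w = - lw c t F w"
  using lw_scale[of c t "-1" F w] by simp

lemma lw_zero: "lw c t (\<lambda>v. 0) w = 0"
  using lw_scale[of c t 0 "\<lambda>_. 0" w] by simp

text \<open>Derivations of a free algebra are determined by their values on letters, and so are their
  commutators: the terms in which the two operators act on different letters cancel. Most of the
  defining relations are checked on a single letter in this way.\<close>

lemma lw_commutator:
  assumes "\<And>b g. s (c b) (s (c' (t b)) (g (t' (t b)))) - s (c' b) (s (c (t' b)) (g (t (t' b))))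
    = s (c'' b) (g (t'' b))"
  shows "lw c t (lw c' t' F) w - lw c' t' (lw c t F) w = lw c'' t'' F w"
proof (induction w arbitrary: F)
  case (Cons b w)
  have "lw c t (lw c' t' F) (b # w) - lw c' t' (lw c t F) (b # w)
      = (s (c b) (s (c' (t b)) (F (t' (t b) # w))) - s (c' b) (s (c (t' b)) (F (t (t' b) # w))))
        + (lw c t (lw c' t' (\<lambda>v. F (b # v))) w - lw c' t' (lw c t (\<lambda>v. F (b # v))) w)"
    by (simp add: lw_add lw_scale scale_right_distrib algebra_simps)
  also have "\<dots> = s (c'' b) (F (t'' b # w)) + lw c'' t'' (\<lambda>v. F (b # v)) w"
    using assms[of b "\<lambda>b'. F (b' # w)"] Cons.IH by simp
  finally show ?case by simp
qed simp

text \<open>The weight of the block \<open>(\<nu>, i)\<close> under \<open>h\<^sub>k\<close>. Members of \<open>\<nu>\<close> outside \<open>J\<close> are inert labels; without the filter they would spoil the relation \<open>[e\<^sub>j, f\<^sub>j] = h\<^sub>j\<close>.\<close>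

definition weight :: "'i \<Rightarrow> 'i multiset \<times> 'i \<Rightarrow> complex" where
  "weight k b = of_real (A k (snd b) + (\<Sum>j\<in>#filter_mset (\<lambda>j. j \<in> J) (fst b). A k j))"

abbreviation Hop :: "'i \<Rightarrow> (('i multiset \<times> 'i) list \<Rightarrow> 'y) \<Rightarrow> ('i multiset \<times> 'i) list \<Rightarrow> 'y" where
  "Hop k \<equiv> lw (\<lambda>b. - weight k b) (\<lambda>b. b)"

abbreviation raise :: "'i \<Rightarrow> 'i multiset \<times> 'i \<Rightarrow> 'i multiset \<times> 'i" where
  "raise j b \<equiv> (add_mset j (fst b), snd b)"

abbreviation Eop_J :: "'i \<Rightarrow> (('i multiset \<times> 'i) list \<Rightarrow> 'y) \<Rightarrow> ('i multiset \<times> 'i) list \<Rightarrow> 'y" where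
  "Eop_J j \<equiv> lw (\<lambda>_. - 1) (raise j)"

abbreviation Fop_J :: "'i \<Rightarrow> (('i multiset \<times> 'i) list \<Rightarrow> 'y) \<Rightarrow> ('i multiset \<times> 'i) list \<Rightarrow> 'y" where
  "Fop_J j \<equiv> lw (\<lambda>b. of_real (A j (snd b)) * of_nat (count (fst b) j)) (\<lambda>b. (fst b - {#j#}, snd b))"

abbreviation Eop_K :: "'i \<Rightarrow> (('i multiset \<times> 'i) list \<Rightarrow> 'y) \<Rightarrow> ('i multiset \<times> 'i) list \<Rightarrow> 'y" where
  "Eop_K i F w \<equiv> F (({#}, i) # w)"

text \<open>In the algebra, bracketing the element of the block \<open>(\<nu>, i)\<close> with the opposite generator at \<open>i\<close>
  gives \<open>h\<^sub>i\<close> if \<open>\<nu>\<close> is empty, a multiple of the generator at \<open>k\<close> if \<open>\<nu> = {k}\<close>, and zero for larger \<open>\<nu>\<close>,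
  because the generators at elements of \<open>J\<close> commute. This is the term by which the operator at \<open>i\<close> fails to
  commute with multiplication by that block.\<close>

definition contract ::
    "'i \<Rightarrow> 'i multiset \<Rightarrow> (('i multiset \<times> 'i) list \<Rightarrow> 'y) \<Rightarrow> ('i multiset \<times> 'i) list \<Rightarrow> 'y" where
  "contract i \<nu> F w =
     (if \<nu> = {#} then Hop i F w
      else if \<exists>k\<in>J. \<nu> = {#k#} then - s (of_real (A i (THE k. \<nu> = {#k#}))) (Eop_J (THE k. \<nu> = {#k#}) F w)
      else 0)"

primrec Fop_K ::
    "'i \<Rightarrow> (('i multiset \<times> 'i) list \<Rightarrow> 'y) \<Rightarrow> ('i multiset \<times> 'i) list \<Rightarrow> 'y" where
  "Fop_K i F [] = 0"
| "Fop_K i F (b # w) =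
     (if snd b = i then contract i (fst b) F w else 0) + Fop_K i (\<lambda>v. F (b # v)) w"

lemma contract_empty: "contract i {#} F = Hop i F"
  by (simp add: contract_def fun_eq_iff)

lemma contract_single: "k \<in> J \<Longrightarrow> contract i {#k#} F = (\<lambda>w. - s (of_real (A i k)) (Eop_J k F w))"
  by (simp add: contract_def fun_eq_iff)

lemma contract_other:
  "\<nu> \<noteq> {#} \<Longrightarrow> (\<And>k. k \<in> J \<Longrightarrow> \<nu> \<noteq> {#k#}) \<Longrightarrow> contract i \<nu> F = (\<lambda>w. 0)"
  by (auto simp: contract_def fun_eq_iff)

lemma contract_cases:
  obtains "\<nu> = {#}" | k where "k \<in> J" "\<nu> = {#k#}"
    | "\<nu> \<noteq> {#}" "\<And>k. k \<in> J \<Longrightarrow> \<nu> \<noteq> {#k#}"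
  by blast

lemma contract_add: "contract i \<nu> (\<lambda>v. F v + F' v) w = contract i \<nu> F w + contract i \<nu> F' w"
  by (auto simp: contract_def lw_add scale_right_distrib)

lemma contract_scale: "contract i \<nu> (\<lambda>v. s r (F v)) w = s r (contract i \<nu> F w)"
  by (auto simp: contract_def lw_scale scale_left_commute)

lemma Fop_K_add: "Fop_K i (\<lambda>v. F v + F' v) w = Fop_K i F w + Fop_K i F' w"
  by (induction w arbitrary: F F') (auto simp: contract_add)

lemma Fop_K_scale: "Fop_K i (\<lambda>v. s r (F v)) w = s r (Fop_K i F w)"
  by (induction w arbitrary: F) (auto simp: contract_scale scale_right_distrib)

lemma Fop_K_diff: "Fop_K i (\<lambda>v. F v - F' v) w = Fop_K i F w - Fop_K i F' w"
  using Fop_K_add[of i F "\<lambda>v. s (-1) (F' v)" w] Fop_K_scale[of i "-1" F' w] by simp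

lemma weight_raise: "j \<in> J \<Longrightarrow> weight k (raise j b) = weight k b + of_real (A k j)"
  by (simp add: weight_def)

lemma weight_lower: "j \<in> J \<Longrightarrow> j \<in># fst b \<Longrightarrow> weight k (fst b - {#j#}, snd b) = weight k b - of_real (A k j)"
  by (simp add: weight_def filter_diff_mset sum_mset_diff image_mset_Diff)

lemma weight_J: "j \<in> J \<Longrightarrow> weight j b = of_real (A j (snd b))"
proof -
  assume j: "j \<in> J"
  have "image_mset (A j) (filter_mset (\<lambda>j. j \<in> J) (fst b)) = image_mset (\<lambda>_. 0) (filter_mset (\<lambda>j. j \<in> J) (fst b))"
    by (rule image_mset_cong) (simp add: A_zero[OF j])
  then show ?thesis by (simp add: weight_def)
qed

lemma Hop_Hop: "Hop k (Hop k' F) w = Hop k' (Hop k F) w"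
proof -
  have "Hop k (Hop k' F) w - Hop k' (Hop k F) w = lw (\<lambda>_. 0) (\<lambda>b. b) F w"
    by (rule lw_commutator) (simp add: mult.commute)
  also have "\<dots> = 0" by (induction w arbitrary: F) auto
  finally show ?thesis by simp
qed

lemma lw_const: "lw (\<lambda>b. r * c b) t F w = s r (lw c t F w)"
  by (induction w arbitrary: F) (simp_all add: scale_right_distrib)

lemma lw_coeff_zero: "lw (\<lambda>_. 0) t F w = 0"
  by (induction w arbitrary: F) auto

lemma Hop_Eop_J: "j \<in> J \<Longrightarrow> Hop k (Eop_J j F) w - Eop_J j (Hop k F) w = s (of_real (A k j)) (Eop_J j F w)"
  unfolding lw_const[symmetric]
  by (rule lw_commutator) (simp add: weight_raise scale_left_distrib)

lemma Hop_Fop_J: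
  assumes "j \<in> J"
  shows "Hop k (Fop_J j F) w - Fop_J j (Hop k F) w = - s (of_real (A k j)) (Fop_J j F w)"
proof -
  have "Hop k (Fop_J j F) w - Fop_J j (Hop k F) w
    = lw (\<lambda>b. - of_real (A k j) * (of_real (A j (snd b)) * of_nat (count (fst b) j)))
        (\<lambda>b. (fst b - {#j#}, snd b)) F w"
  proof (rule lw_commutator)
    fix b :: "'i multiset \<times> 'i" and g :: "'i multiset \<times> 'i \<Rightarrow> 'y"
    show "s (- weight k b)
            (s (of_real (A j (snd b)) * of_nat (count (fst b) j)) (g (fst b - {#j#}, snd b))) -
           s (of_real (A j (snd b)) * of_nat (count (fst b) j))
            (s (- weight k (fst b - {#j#}, snd b)) (g (fst b - {#j#}, snd b))) =
           s (- of_real (A k j) * (of_real (A j (snd b)) * of_nat (count (fst b) j))) (g (fst b - {#j#}, snd b))"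
    proof (cases "j \<in># fst b")
      case True
      show ?thesis
        unfolding weight_lower[OF assms True] scale_scale scale_left_diff_distrib[symmetric]
        by (rule arg_cong[where f = "\<lambda>r. s r _"]) (simp add: algebra_simps)
    next
      case False
      then show ?thesis by (simp add: not_in_iff)
    qed
  qed
  then show ?thesis by (simp only: lw_const scale_minus_left)
qed

lemma Eop_J_Eop_J: "Eop_J j (Eop_J k F) w = Eop_J k (Eop_J j F) w"
proof -
  have "Eop_J j (Eop_J k F) w - Eop_J k (Eop_J j F) w = lw (\<lambda>_. 0) (\<lambda>b. b) F w"
    by (rule lw_commutator) (simp add: add_mset_commute)
  then show ?thesis by (simp add: lw_coeff_zero)
qed

lemma Fop_J_Fop_J: "Fop_J j (Fop_J k F) w = Fop_J k (Fop_J j F) w"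
proof (cases "j = k")
  case False
  have "Fop_J j (Fop_J k F) w - Fop_J k (Fop_J j F) w = lw (\<lambda>_. 0) (\<lambda>b. b) F w"
    by (rule lw_commutator) (use False in \<open>simp add: add_mset_commute mult.commute\<close>)
  then show ?thesis by (simp add: lw_coeff_zero)
qed simp

lemma Eop_J_Fop_J:
  assumes "j \<in> J"
  shows "Eop_J j (Fop_J k F) w - Fop_J k (Eop_J j F) w = (if j = k then Hop j F w else 0)"
proof (cases "j = k")
  case False
  have "Eop_J j (Fop_J k F) w - Fop_J k (Eop_J j F) w = lw (\<lambda>_. 0) (\<lambda>b. b) F w"
  proof (rule lw_commutator)
    fix b :: "'i multiset \<times> 'i" and g :: "'i multiset \<times> 'i \<Rightarrow> 'y"
    show "s (- 1)
          (s (of_real (A k (snd (raise j b))) * of_nat (count (fst (raise j b)) k))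
            (g (fst (raise j b) - {#k#}, snd (raise j b)))) -
         s (of_real (A k (snd b)) * of_nat (count (fst b) k))
          (s (- 1) (g (raise j (fst b - {#k#}, snd b)))) =
         s 0 (g b)"
      using False by (cases "k \<in># fst b") (simp_all add: not_in_iff)
  qed
  then show ?thesis using False by (simp add: lw_coeff_zero)
next
  case True
  have "Eop_J j (Fop_J j F) w - Fop_J j (Eop_J j F) w = Hop j F w"
  proof (rule lw_commutator)
    fix b :: "'i multiset \<times> 'i" and g :: "'i multiset \<times> 'i \<Rightarrow> 'y"
    show "s (- 1)
          (s (of_real (A j (snd (raise j b))) * of_nat (count (fst (raise j b)) j))
            (g (fst (raise j b) - {#j#}, snd (raise j b)))) -
         s (of_real (A j (snd b)) * of_nat (count (fst b) j))
          (s (- 1) (g (raise j (fst b - {#j#}, snd b)))) =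
         s (- weight j b) (g b)"
      unfolding weight_J[OF assms]
      by (cases "j \<in># fst b")
         (simp_all add: not_in_iff scale_left_distrib scale_right_distrib algebra_simps)
  qed
  then show ?thesis using True by simp
qed

text \<open>By induction on the word this is the compatibility of \<open>contract\<close> with raising a block; its only
  nontrivial instances are the passages from the empty multiset to one element and from one element to two.\<close>

lemma Eop_J_Fop_K:
  assumes "j \<in> J"
  shows "Eop_J j (Fop_K i F) w = Fop_K i (Eop_J j F) w"
proof (induction w arbitrary: F)
  case (Cons b w)
  have *: "Eop_J j (contract i \<nu> F) w - contract i (add_mset j \<nu>) F w = contract i \<nu> (Eop_J j F) w" for \<nu>
  proof (cases \<nu> rule: contract_cases)
    case 1
    then show ?thesis
      using Hop_Eop_J[OF assms, of i F w] assms
      by (simp add: contract_empty contract_single algebra_simps)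
  next
    case (2 k)
    then show ?thesis
      using Eop_J_Eop_J[of j k F w]
      by (simp add: contract_other contract_single lw_minus lw_scale)
  next
    case 3
    then show ?thesis by (simp add: contract_other lw_zero)
  qed
  show ?case
    using *[of "fst b"] Cons.IH[of "\<lambda>v. F (b # v)"]
    by (auto simp: lw_add lw_zero Fop_K_add Fop_K_diff Fop_K_scale algebra_simps)
qed simp

lemma Hop_Fop_K: "Hop k (Fop_K i F) w - Fop_K i (Hop k F) w = - s (of_real (A k i)) (Fop_K i F w)"
proof (induction w arbitrary: F)
  case (Cons b w)
  have *: "- s (weight k b) (contract i (fst b) F w) + Hop k (contract i (fst b) F) w
      - contract i (fst b) (Hop k F) w = - s (of_real (A k i)) (contract i (fst b) F w)"
    if "snd b = i"
  proof (cases "fst b" rule: contract_cases)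
    case 1
    have "weight k b = of_real (A k i)" using 1 that by (simp add: weight_def)
    then show ?thesis using 1 Hop_Hop[of k i F w] by (simp add: contract_empty)
  next
    case (2 j)
    have "weight k b = of_real (A k i) + of_real (A k j)" using 2 that by (simp add: weight_def)
    then show ?thesis
      using 2 Hop_Eop_J[OF 2(1), of k F w]
      by (simp add: contract_single lw_minus lw_scale algebra_simps scale_left_distrib
            scale_right_distrib)
  next
    case 3
    then show ?thesis by (simp add: contract_other lw_zero)
  qed
  have IH: "Hop k (Fop_K i (\<lambda>v. F (b # v))) w
      = Fop_K i (Hop k (\<lambda>v. F (b # v))) w - s (of_real (A k i)) (Fop_K i (\<lambda>v. F (b # v)) w)"
    using Cons.IH[of "\<lambda>v. F (b # v)"] by (simp add: algebra_simps)
  show ?case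
  proof (cases "snd b = i")
    case True
    have "Hop k (contract i (fst b) F) w = contract i (fst b) (Hop k F) w
        + s (weight k b) (contract i (fst b) F w) - s (of_real (A k i)) (contract i (fst b) F w)"
      using *[OF True] by (simp add: algebra_simps)
    then show ?thesis using True
      by (simp add: lw_add Fop_K_add Fop_K_diff Fop_K_scale scale_right_distrib IH)
  next
    case False
    then show ?thesis
      by (simp add: lw_add lw_zero Fop_K_add Fop_K_diff Fop_K_scale scale_right_distrib IH)
  qed
qed simp

definition Eop :: "'i \<Rightarrow> (('i multiset \<times> 'i) list \<Rightarrow> 'y) \<Rightarrow> ('i multiset \<times> 'i) list \<Rightarrow> 'y" where
  "Eop k = (if k \<in> J then Eop_J k else Eop_K k)"

definition Fop :: "'i \<Rightarrow> (('i multiset \<times> 'i) list \<Rightarrow> 'y) \<Rightarrow> ('i multiset \<times> 'i) list \<Rightarrow> 'y" where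
  "Fop k = (if k \<in> J then Fop_J k else Fop_K k)"

lemma block_module_relations:
  "borcherds_relations (J \<union> K) A (gl (\<lambda>r F w. s r (F w))) Eop Fop Hop"
proof -
  have EF: "Eop i (Fop j F) w - Fop j (Eop i F) w = (if i = j then Hop i F w else 0)"
    if "i \<in> J \<union> K" "j \<in> J \<union> K" for i j F w
    using that disjoint Eop_J_Fop_J[of i j F w] Eop_J_Fop_K[of i j F w]
    by (auto simp: Eop_def Fop_def contract_empty)
  have HE: "Hop k (Eop j F) w - Eop j (Hop k F) w = s (of_real (A k j)) (Eop j F w)" for k j F w
    using Hop_Eop_J[of j k F w] by (auto simp: Eop_def weight_def)
  have HF: "Hop k (Fop j F) w - Fop j (Hop k F) w = - s (of_real (A k j)) (Fop j F w)" for k j F w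
    using Hop_Fop_J[of j k F w] Hop_Fop_K[of k j F w] by (auto simp: Fop_def)
  have J: "i \<in> J \<and> j \<in> J" if "i \<in> J \<union> K" "j \<in> J \<union> K" "A i j = 0" for i j
    using that A_nonzero by blast
  show ?thesis
    unfolding borcherds_relations_def lbracket_gl lscale_gl
  proof (intro ballI conjI impI ext)
    fix i j F assume ij: "i \<in> J \<union> K" "j \<in> J \<union> K"
    show "(\<lambda>v. Hop i (Hop j v) - Hop j (Hop i v)) F w = 0 F w" for w
      using Hop_Hop[of i j F w] by simp
    show "(\<lambda>v. Hop i (Eop j v) - Eop j (Hop i v)) F w = (\<lambda>v w. s (of_real (A i j)) (Eop j v w)) F w" for w
      using HE[of i j F w] by simp
    show "(\<lambda>v. Hop i (Fop j v) - Fop j (Hop i v)) F w = (- (\<lambda>v w. s (of_real (A i j)) (Fop j v w))) F w" for w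
      using HF[of i j F w] by simp
    show "(\<lambda>v. Eop i (Fop j v) - Fop j (Eop i v)) F w = (if i = j then Hop i else 0) F w" for w
      using EF[OF ij, of F w] by simp
    show "(\<lambda>v. Eop i (Eop j v) - Eop j (Eop i v)) F w = 0 F w" if "A i j = 0" for w
      using J[OF ij that] Eop_J_Eop_J[of i j F w] by (simp add: Eop_def)
    show "(\<lambda>v. Fop i (Fop j v) - Fop j (Fop i v)) F w = 0 F w" if "A i j = 0" for w
      using J[OF ij that] Fop_J_Fop_J[of i j F w] by (simp add: Fop_def)
  qed
qed

lemma block_module_linear:
  fixes s' defines "s' \<equiv> \<lambda>r (F :: ('i multiset \<times> 'i) list \<Rightarrow> 'y) w. s r (F w)"
  assumes "X \<in> {Eop k, Fop k, Hop k}"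
  shows "(\<forall>F F'. X (F + F') = X F + X F') \<and> (\<forall>r F. X (s' r F) = s' r (X F))"
proof -
  have "X = Eop k \<or> X = Fop k \<or> X = Hop k" using assms(2) by blast
  moreover have "Eop k (\<lambda>w. F w + F' w) w = Eop k F w + Eop k F' w"
    "Fop k (\<lambda>w. F w + F' w) w = Fop k F w + Fop k F' w"
    "Eop k (\<lambda>w. s r (F w)) w = s r (Eop k F w)"
    "Fop k (\<lambda>w. s r (F w)) w = s r (Fop k F w)" for F F' r w
    unfolding Eop_def Fop_def by (simp_all add: lw_add lw_scale Fop_K_add Fop_K_scale)
  ultimately have "X (\<lambda>w. F w + F' w) w = X F w + X F' w"
    "X (\<lambda>w. s r (F w)) w = s r (X F w)" for F F' r w
    by (elim disjE; simp only: lw_add lw_scale)+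
  then show ?thesis by (simp add: fun_eq_iff plus_fun_def s'_def)
qed

text \<open>Applying \<open>ad e\<^sub>j\<close> to the shift by a block raises the block, so that the words in \<open>U\<^sup>+\<close> act by shifts.\<close>

lemma Eop_shift_commutator:
  assumes "j \<in> J"
  shows "Eop j (\<lambda>v. F (b # v)) w - Eop j F (b # w) = F (raise j b # w)"
  using assms by (simp add: Eop_def)

end

section \<open>Iterated adjoint words\<close>

abbreviation ad_list :: "'a lie_alg \<Rightarrow> ('i \<Rightarrow> 'a) \<Rightarrow> 'i list \<Rightarrow> 'a \<Rightarrow> 'a" where
  "ad_list L x xs \<equiv> foldr (\<lambda>j. lbracket L (x j)) xs"

text \<open>An iterated adjoint word depends only on the multiset of its letters, since their adjoint actions commute.\<close>

lemma (in lie_algebra) ad_list_mset_cong: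
  assumes comm: "\<And>j k. j \<in> J \<Longrightarrow> k \<in> J \<Longrightarrow> br (x j) (x k) = 0"
    and "set xs \<subseteq> J" and "mset xs = mset ys"
  shows "ad_list L x xs = ad_list L x ys"
proof -
  have "br (x j) (br (x k) y) = br (x k) (br (x j) y)" if "j \<in> J" "k \<in> J" for j k y
    using br_derivation[of "x j" "x k" y] comm[OF that] by simp
  then show ?thesis
    unfolding foldr_conv_fold using assms(2,3)
    by (intro fold_multiset_equiv) (auto simp: fun_eq_iff subset_iff)
qed

lemma lex_less_trans: "lex_less p q \<Longrightarrow> lex_less q r \<Longrightarrow> lex_less p r"
  unfolding lex_less_def by auto

lemma ex_lex_sorted:
  assumes "finite X"
  shows "\<exists>xs. sorted_wrt lex_less xs \<and> set xs = X"
  using assms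
proof (induction X)
  case (insert x X)
  then obtain xs where xs: "sorted_wrt lex_less xs" "set xs = X" by blast
  let ?ys = "filter (\<lambda>y. lex_less y x) xs @ x # filter (\<lambda>y. lex_less x y) xs"
  have "lex_less y x \<or> lex_less x y" if "y \<in> X" for y
    using that insert.hyps(2) prod_eq_iff[of y x] unfolding lex_less_def by fastforce
  then have "set ?ys = insert x X" using xs(2) by auto
  moreover have "sorted_wrt lex_less ?ys"
    using xs(1) by (auto simp: sorted_wrt_append sorted_wrt_filter intro: lex_less_trans)
  ultimately show ?case by blast
qed simp

text \<open>Collecting equal letters and sorting them turns an arbitrary product of commuting operators
  \<open>ad x\<^sub>j\<close> into the normal form with increasing letters and positive exponents.\<close>

lemma (in lie_algebra) ad_words_eq:
  assumes comm: "\<And>j k. j \<in> J \<Longrightarrow> k \<in> J \<Longrightarrow> br (x j) (x k) = 0"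
  shows "ad_words L x J K = {ad_list L x xs (x i) | xs i. set xs \<subseteq> J \<and> i \<in> K}"
proof -
  define ex :: "((int \<times> int) \<times> nat) list \<Rightarrow> (int \<times> int) list" where
    "ex w = concat (map (\<lambda>(j, l). replicate l j) w)" for w
  have ex: "foldr (\<lambda>(j, l) y. (br (x j) ^^ l) y) w y = ad_list L x (ex w) y" for w y
    by (induction w) (auto simp: ex_def)
  show ?thesis
  proof (intro set_eqI iffI)
    fix u assume "u \<in> ad_words L x J K"
    then obtain w i where w: "u = foldr (\<lambda>(j, l) y. (br (x j) ^^ l) y) w (x i)"
        "\<forall>(j, l) \<in> set w. j \<in> J \<and> l > 0" "i \<in> K"
      unfolding ad_words_def by blast
    have "set (ex w) \<subseteq> J" using w(2) by (auto simp: ex_def)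
    then show "u \<in> {ad_list L x xs (x i) | xs i. set xs \<subseteq> J \<and> i \<in> K}"
      using w(1,3) ex by blast
  next
    fix u assume "u \<in> {ad_list L x xs (x i) | xs i. set xs \<subseteq> J \<and> i \<in> K}"
    then obtain xs i where u: "u = ad_list L x xs (x i)" "set xs \<subseteq> J" "i \<in> K" by blast
    obtain zs where zs: "sorted_wrt lex_less zs" "set zs = set xs"
      using ex_lex_sorted[of "set xs"] by auto
    let ?w = "map (\<lambda>j. (j, count (mset xs) j)) zs"
    have "distinct zs"
      using zs(1) by (induction zs) (auto simp: lex_less_def)
    then have "count (mset (ex ?w)) j = count (mset xs) j" for j
    proof -
      have "count (mset (ex (map (\<lambda>j. (j, c j)) ys))) j = (if j \<in> set ys then c j else 0)"
        if "distinct ys" for ys and c :: "int \<times> int \<Rightarrow> nat"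
        using that by (induction ys) (auto simp: ex_def)
      from this[OF \<open>distinct zs\<close>] show ?thesis
        by (simp add: zs(2) count_eq_zero_iff)
    qed
    then have "mset xs = mset (ex ?w)" by (simp add: multiset_eq_iff)
    then have "u = foldr (\<lambda>(j, l) y. (br (x j) ^^ l) y) ?w (x i)"
      using ad_list_mset_cong[where x = x and ys = "ex ?w", OF comm u(2)] u(1) by (simp only: ex)
    moreover have "sorted_wrt lex_less (map fst ?w)" using zs(1) by (simp add: comp_def)
    moreover have "\<forall>(j, l) \<in> set ?w. j \<in> J \<and> l > 0" using zs(2) u(2) by auto
    ultimately show "u \<in> ad_words L x J K" unfolding ad_words_def using u(3) by blast
  qed
qed

section \<open>Freeness of the positive part\<close>

lemma lie_quotient_center_zero_iff:
  "lie_quotient_map G (lie_center G UNIV) M \<pi> \<Longrightarrow> \<pi> x = 0 \<longleftrightarrow> x \<in> lie_center G UNIV"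
  unfolding lie_quotient_map_def by blast

text \<open>The feature of the Monstrous matrix that matters for freeness: a zero block on \<open>J\<close>, and all remaining entries negative.\<close>

locale borcherds_split =
  fixes J K :: "'i set" and A :: "'i \<Rightarrow> 'i \<Rightarrow> real" and G :: "('a::ab_group_add) lie_alg" and e f h
  assumes presented: "borcherds_algebra (J \<union> K) A G e f h"
    and A_zero: "j \<in> J \<Longrightarrow> k \<in> J \<Longrightarrow> A j k = 0"
    and A_negative: "i \<in> K \<Longrightarrow> j \<in> J \<union> K \<Longrightarrow> A i j < 0 \<and> A j i < 0"
    and disjoint: "J \<inter> K = {}"
    and J_nonempty: "J \<noteq> {}"
begin

sublocale lie_algebra G
  using borcherds_algebra_facts(1)[OF presented] .

lemma borcherds_split_flip: "borcherds_split J K A G f e (\<lambda>i. - h i)"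
  using borcherds_chevalley_involution[OF presented] A_zero A_negative disjoint J_nonempty
  by (intro borcherds_split.intro) auto

lemmas relations = borcherds_algebra_facts(2)[OF presented, unfolded borcherds_relations_def,
    rule_format]

lemma e_commute: "j \<in> J \<Longrightarrow> k \<in> J \<Longrightarrow> br (e j) (e k) = 0"
  using relations[of j k] A_zero by auto

lemma shift_representation:
  fixes s :: "complex \<Rightarrow> 'y::ab_group_add \<Rightarrow> 'y"
  assumes "vector_space s"
  obtains R :: "'a \<Rightarrow> (('i multiset \<times> 'i) list \<Rightarrow> 'y) \<Rightarrow> ('i multiset \<times> 'i) list \<Rightarrow> 'y"
  where "lie_hom G (gl (\<lambda>r F w. s r (F w))) R"
    and "\<And>xs i. set xs \<subseteq> J \<Longrightarrow> i \<in> K \<Longrightarrow> R (ad_list G e xs (e i)) = (\<lambda>F w. F ((mset xs, i) # w))"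
proof -
  interpret B: block_module s J K A
    using A_negative by (intro block_module.intro assms block_module_axioms.intro A_zero disjoint) fastforce+
  obtain R where R: "lie_hom G (gl (\<lambda>r F w. s r (F w))) R" "\<And>i. i \<in> J \<union> K \<Longrightarrow> R (e i) = B.Eop i"
    by (rule borcherds_universal[OF presented lie_algebra_within_gl[OF vector_space_pointwise[OF assms]]
          B.block_module_relations])
       (use B.block_module_linear in blast)+
  have "R (ad_list G e xs (e i)) = (\<lambda>F w. F ((mset xs, i) # w))" if "set xs \<subseteq> J" "i \<in> K" for xs i
    using that
  proof (induction xs)
    case Nil
    then show ?case using R(2)[of i] disjoint by (auto simp: B.Eop_def)
  next
    case (Cons j xs)
    then have IH: "R (ad_list G e xs (e i)) = (\<lambda>F w. F ((mset xs, i) # w))" by simp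
    have "R (e j) = B.Eop j" using R(2)[of j] Cons.prems by simp
    then have "R (ad_list G e (j # xs) (e i))
      = (\<lambda>F w. B.Eop j (\<lambda>v. F ((mset xs, i) # v)) w - B.Eop j F ((mset xs, i) # w))"
      by (simp add: lie_hom_bracket[OF R(1)] lbracket_gl IH fun_eq_iff)
    then show ?case using Cons.prems by (simp add: B.Eop_shift_commutator)
  qed
  then show thesis using that R(1) by blast
qed

text \<open>In the representation by shifts, \<open>e\<^sub>i\<close> does not kill the constant function.\<close>

lemma e_nonzero:
  assumes "i \<in> K"
  shows "e i \<noteq> 0"
proof
  assume "e i = 0"
  obtain R :: "'a \<Rightarrow> (('i multiset \<times> 'i) list \<Rightarrow> complex) \<Rightarrow> ('i multiset \<times> 'i) list \<Rightarrow> complex"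
    where R: "lie_hom G (gl (\<lambda>r F w. r * F w)) R"
    "\<And>xs i. set xs \<subseteq> J \<Longrightarrow> i \<in> K \<Longrightarrow> R (ad_list G e xs (e i)) = (\<lambda>F w. F ((mset xs, i) # w))"
    using shift_representation[OF vector_space_over_itself.vector_space_axioms] by blast
  have "R 0 (\<lambda>_. 1) [] = 1" using R(2)[of "[]" i] assms \<open>e i = 0\<close> by simp
  then show False using lie_hom_zero[OF R(1)] by simp
qed

text \<open>A Lie polynomial \<open>x\<close> in \<open>U\<^sup>+\<close> that vanishes in the quotient lifts to a central element of the Borcherds algebra. The
  lift is a sum of eigenvectors of \<open>ad h\<^sub>j\<close>, \<open>j \<in> J\<close>, with negative eigenvalues, so it is zero. It then acts by
  zero in the representation by shifts, and \<open>free_lie_shift_faithful\<close> gives \<open>x = 0\<close>.\<close>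

theorem positive_part_free:
  fixes M :: "('m::ab_group_add) lie_alg"
  assumes Q: "lie_quotient_map G (lie_center G UNIV) M \<pi>"
  defines "U \<equiv> {ad_list M (\<lambda>i. \<pi> (e i)) xs (\<pi> (e i)) | xs i. set xs \<subseteq> J \<and> i \<in> K}"
  shows "freely_generates M U (lie_generated M U)"
proof -
  have M: "lie_algebra M" and \<pi>: "lie_hom G M \<pi>"
    using Q unfolding lie_quotient_map_def by blast+
  interpret M: lie_algebra M by (rule M)
  interpret Mw: lie_algebra_within M UNIV by (rule M.lie_algebra_within_UNIV)
  interpret Gw: lie_algebra_within G UNIV by (rule lie_algebra_within_UNIV)
  interpret F: lie_algebra "free_lie_alg :: 'm free_lie lie_alg" by (rule lie_algebra_free)
  let ?e = "\<lambda>i. \<pi> (e i)"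
  have comm: "M.br (?e j) (?e k) = 0" if "j \<in> J" "k \<in> J" for j k
    using e_commute[OF that] by (simp add: lie_hom_bracket[OF \<pi>, symmetric] lie_hom_zero[OF \<pi>])
  obtain \<phi> where \<phi>: "lie_hom free_lie_alg M \<phi>" "\<And>u. \<phi> (free_gen u) = u"
    by (rule Mw.free_lie_universal[of "\<lambda>u. u", OF UNIV_I]) blast
  have "\<forall>u\<in>U. \<exists>p. set (fst p) \<subseteq> J \<and> snd p \<in> K \<and> u = ad_list M ?e (fst p) (?e (snd p))"
    unfolding U_def by auto
  \<comment> \<open>A block for each element of \<open>U\<close>; distinct elements get distinct blocks, as \<open>nm\<close> recovers the element.\<close>
  from bchoice[OF this] obtain p where p: "\<And>u. u \<in> U \<Longrightarrow> set (fst (p u)) \<subseteq> J"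
      "\<And>u. u \<in> U \<Longrightarrow> snd (p u) \<in> K" "\<And>u. u \<in> U \<Longrightarrow> u = ad_list M ?e (fst (p u)) (?e (snd (p u)))"
    by blast
  define blk where "blk u = (mset (fst (p u)), snd (p u))" for u
  define nm where "nm b = ad_list M ?e (SOME xs. mset xs = fst b) (?e (snd b))" for b
  have nm: "nm (blk u) = u" if "u \<in> U" for u
  proof -
    have "mset (SOME xs. mset xs = mset (fst (p u))) = mset (fst (p u))" by (rule someI) simp
    then have "ad_list M ?e (fst (p u)) = ad_list M ?e (SOME xs. mset xs = mset (fst (p u)))"
      by (intro M.ad_list_mset_cong[where x = ?e, OF comm p(1)[OF that]]) simp_all
    then show ?thesis
      using p(3)[OF that] unfolding nm_def blk_def fst_conv snd_conv by metis
  qed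
  define g where "g u = (if u \<in> U then ad_list G e (fst (p u)) (e (snd (p u))) else 0)" for u
  obtain \<psi> where \<psi>: "lie_hom free_lie_alg G \<psi>" "\<And>u. \<psi> (free_gen u) = g u"
    by (rule Gw.free_lie_universal[of g, OF UNIV_I]) blast
  have \<pi>_word: "\<pi> (ad_list G e xs y) = ad_list M ?e xs (\<pi> y)" for xs y
    by (induction xs) (simp_all add: lie_hom_bracket[OF \<pi>])
  have \<pi>\<psi>: "\<pi> (\<psi> x) = \<phi> x" if "x \<in> F.gen (free_gen ` U)" for x
    by (rule lie_hom_eq_on_generated[OF lie_algebra_free lie_hom_comp[OF \<psi>(1) \<pi>] \<phi>(1) _ that])
       (use p(3) in \<open>auto simp: \<phi>(2) \<psi>(2) g_def \<pi>_word\<close>)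
  obtain R :: "'a \<Rightarrow> (('i multiset \<times> 'i) list \<Rightarrow> 'm free_lie) \<Rightarrow> ('i multiset \<times> 'i) list \<Rightarrow> 'm free_lie"
    where R: "lie_hom G (gl (\<lambda>r F w. free_scale r (F w))) R"
    "\<And>xs i. set xs \<subseteq> J \<Longrightarrow> i \<in> K \<Longrightarrow> R (ad_list G e xs (e i)) = (\<lambda>F w. F ((mset xs, i) # w))"
    using shift_representation[of free_scale] F.vector_space_axioms[unfolded lscale_free] by blast
  obtain p0 where p0: "p0 \<in> J" using J_nonempty by blast
  let ?P = "of_real ` {..<0} :: complex set"
  have word: "br (h p0) (ad_list G e xs (e i)) = sc (of_real (A p0 i)) (ad_list G e xs (e i))"
    if "set xs \<subseteq> J" "i \<in> K" for xs i
    using that(1)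
  proof (induction xs)
    case Nil
    then show ?case using relations[of p0 i] p0 that(2) by simp
  next
    case (Cons j xs)
    then have "br (h p0) (e j) = 0" using relations[of p0 j] p0 A_zero[of p0 j] by simp
    then show ?case using Cons br_derivation[of "h p0" "e j"] by (simp add: br_simps)
  qed
  have inj: "x = 0" if x: "x \<in> F.gen (free_gen ` U)" and "\<phi> x = 0" for x
  proof -
    have "\<psi> x \<in> lie_center G UNIV"
      using \<pi>\<psi>[OF x] \<open>\<phi> x = 0\<close> lie_quotient_center_zero_iff[OF Q] by metis
    then have "br (h p0) (\<psi> x) = sc 0 (\<psi> x)"
      using br_eq_zero_swap unfolding lie_center_def by (simp; blast)
    then have "\<psi> x \<in> eigenspan (br (h p0)) {0}" by (rule eigenspan_base) simp
    moreover have "\<psi> x \<in> gen (\<psi> ` free_gen ` U)"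
      by (rule lie_hom_generated[OF lie_algebra_free _ \<psi>(1) x]) unfold_locales
    then have "\<psi> x \<in> eigenspan (br (h p0)) ?P"
    proof (rule subsetD[OF ad_eigenspan, rotated -1])
      fix v assume "v \<in> \<psi> ` free_gen ` U"
      then obtain u where u: "u \<in> U" "v = g u" using \<psi>(2) by auto
      have "br (h p0) v = sc (of_real (A p0 (snd (p u)))) v"
        using word[OF p(1,2)[OF u(1)]] u by (simp add: g_def)
      moreover have "A p0 (snd (p u)) < 0" using A_negative[OF p(2)[OF u(1)], of p0] p0 by blast
      ultimately show "\<exists>k\<in>?P. br (h p0) v = sc k v" by blast
    next
      fix k k' assume "k \<in> ?P" "k' \<in> ?P"
      then obtain r r' where "k = of_real r" "k' = of_real r'" "r < 0" "r' < 0" by blast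
      then have "k + k' = of_real (r + r')" "r + r' < 0" by simp_all
      then show "k + k' \<in> ?P" by blast
    qed
    ultimately have "\<psi> x = 0"
      by (intro eigenspan_disjoint[of "br (h p0)" "{0}" ?P]) (auto simp: br_simps)
    show "x = 0"
    proof (rule free_lie_shift_faithful[of "\<lambda>x. R (\<psi> x)" U blk nm])
      show "lie_hom free_lie_alg (gl (\<lambda>r F w. free_scale r (F w))) (\<lambda>x. R (\<psi> x))"
        by (rule lie_hom_comp[OF \<psi>(1) R(1)])
      show "R (\<psi> (free_gen u)) = (\<lambda>F w. F (blk u # w))" if "u \<in> U" for u
        using that R(2)[OF p(1,2)[OF that]] by (simp add: \<psi>(2) g_def blk_def)
      show "R (\<psi> x) = 0" using \<open>\<psi> x = 0\<close> lie_hom_zero[OF R(1)] by simp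
    qed (use nm x in auto)
  qed
  have "inj_on \<phi> (F.gen (free_gen ` U))"
  proof (rule inj_onI)
    fix x y assume "x \<in> F.gen (free_gen ` U)" "y \<in> F.gen (free_gen ` U)" "\<phi> x = \<phi> y"
    then have "x - y = 0"
      by (intro inj F.subspace_diff[OF F.gen_subspace]) (simp_all add: lie_hom_diff[OF \<phi>(1)])
    then show "x = y" by simp
  qed
  then show ?thesis unfolding freely_generates_def using \<phi> by blast
qed

end

section \<open>The structure of the quotient by the center\<close>

text \<open>The relations that the generators satisfy modulo the center, with \<open>c\<close> and \<open>d\<close> spanning the image of the
  Cartan subalgebra. They are invariant under \<open>e \<leftrightarrow> f\<close>, \<open>c \<mapsto> -c\<close>, \<open>d \<mapsto> -d\<close>, which turns each lemma on the
  positive part into its mirror image.\<close>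

locale charged_generators = lie_algebra L
  for L :: "('a::ab_group_add) lie_alg" +
  fixes J K :: "(int \<times> int) set" and e f :: "int \<times> int \<Rightarrow> 'a" and c d :: 'a
  assumes J_neg: "j \<in> J \<Longrightarrow> fst j < 0" and K_pos: "i \<in> K \<Longrightarrow> fst i > 0"
    and cd: "br c d = 0"
    and c_J: "j \<in> J \<Longrightarrow> br c (e j) = 0" "j \<in> J \<Longrightarrow> br c (f j) = 0"
    and d_J: "j \<in> J \<Longrightarrow> br d (e j) = sc (of_int (fst j)) (e j)"
      "j \<in> J \<Longrightarrow> br d (f j) = - sc (of_int (fst j)) (f j)"
    and c_K: "i \<in> K \<Longrightarrow> br c (e i) = - sc (of_int (fst i)) (e i)"
      "i \<in> K \<Longrightarrow> br c (f i) = sc (of_int (fst i)) (f i)"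
    and d_K: "i \<in> K \<Longrightarrow> br d (e i) = - e i" "i \<in> K \<Longrightarrow> br d (f i) = f i"
    and ef_distinct: "i \<in> J \<union> K \<Longrightarrow> j \<in> J \<union> K \<Longrightarrow> i \<noteq> j \<Longrightarrow> br (e i) (f j) = 0"
    and ef_J: "j \<in> J \<Longrightarrow> br (e j) (f j) = - sc (of_int (fst j)) c"
    and ef_K: "i \<in> K \<Longrightarrow> br (e i) (f i) = sc (of_int (fst i)) d + c"
    and ee_J: "j \<in> J \<Longrightarrow> k \<in> J \<Longrightarrow> br (e j) (e k) = 0"
    and ff_J: "j \<in> J \<Longrightarrow> k \<in> J \<Longrightarrow> br (f j) (f k) = 0"
    and generated: "gen (e ` (J \<union> K) \<union> f ` (J \<union> K) \<union> {c, d}) = UNIV"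
begin

lemma flip: "charged_generators L J K f e (- c) (- d)"
proof (intro charged_generators.intro charged_generators_axioms.intro)
  show "lie_algebra L" by unfold_locales
  let ?X = "f ` (J \<union> K) \<union> e ` (J \<union> K) \<union> {- c, - d}"
  have "- (- c) \<in> gen ?X" "- (- d) \<in> gen ?X"
    by (intro subspace_neg[OF gen_subspace] gen_base; simp)+
  then have "gen (e ` (J \<union> K) \<union> f ` (J \<union> K) \<union> {c, d}) \<subseteq> gen ?X"
    by (intro gen_minimal gen_subalgebra) (auto intro: gen_base)
  then show "gen ?X = UNIV" using generated by auto
  fix i j
  show "br (f i) (e j) = 0" if "i \<in> J \<union> K" "j \<in> J \<union> K" "i \<noteq> j"
    using ef_distinct[OF that(2,1)] that(3) br_eq_zero_swap by metis
  show "br (f j) (e j) = - sc (of_int (fst j)) (- c)" if "j \<in> J"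
    unfolding br_swap[of "f j" "e j"] using ef_J[OF that] by simp
  show "br (f i) (e i) = sc (of_int (fst i)) (- d) + - c" if "i \<in> K"
    unfolding br_swap[of "f i" "e i"] using ef_K[OF that] by simp
qed (auto simp: br_simps J_neg K_pos cd c_J c_K d_J d_K ee_J ff_J)

definition words :: "'a set" where
  "words = {ad_list L e xs (e i) | xs i. set xs \<subseteq> J \<and> i \<in> K}"

definition pos :: "'a set" where "pos = gen words"

text \<open>The part of \<open>ad c\<close>-weight zero: the Heisenberg algebra together with \<open>d\<close>.\<close>

definition middle :: "'a set" where "middle = span (e ` J \<union> f ` J \<union> {c, d})"

lemma middle_subspace: "subspace middle"
  unfolding middle_def by (rule subspace_span)

lemma pos_subspace: "subspace pos"
  unfolding pos_def by (rule gen_subspace)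

lemma middle_base: "j \<in> J \<Longrightarrow> e j \<in> middle" "j \<in> J \<Longrightarrow> f j \<in> middle" "c \<in> middle" "d \<in> middle"
  unfolding middle_def by (auto intro: span_base)

lemma word_pos: "set xs \<subseteq> J \<Longrightarrow> i \<in> K \<Longrightarrow> ad_list L e xs (e i) \<in> pos"
  unfolding pos_def words_def by (rule gen_base) blast

lemma c_word: "set xs \<subseteq> J \<Longrightarrow> i \<in> K \<Longrightarrow>
    br c (ad_list L e xs (e i)) = - sc (of_int (fst i)) (ad_list L e xs (e i))"
proof (induction xs)
  case (Cons j xs)
  then show ?case using br_derivation[of c "e j" "ad_list L e xs (e i)"] by (simp add: c_J br_simps)
qed (simp add: c_K)

lemma d_word: "set xs \<subseteq> J \<Longrightarrow> i \<in> K \<Longrightarrow>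
    \<exists>r. br d (ad_list L e xs (e i)) = sc r (ad_list L e xs (e i))"
proof (induction xs)
  case Nil
  have "br d (e i) = sc (-1) (e i)" using d_K Nil by simp
  then show ?case by (metis foldr.simps(1) id_apply)
next
  case (Cons j xs)
  then obtain r where "br d (ad_list L e xs (e i)) = sc r (ad_list L e xs (e i))" by auto
  then have "br d (ad_list L e (j # xs) (e i))
      = sc (of_int (fst j) + r) (ad_list L e (j # xs) (e i))"
    using Cons.prems br_derivation[of d "e j" "ad_list L e xs (e i)"]
    by (simp add: d_J br_simps scale_left_distrib)
  then show ?case by blast
qed

text \<open>Moving \<open>f\<^sub>j\<close> past a letter \<open>e\<^sub>j\<close> produces a multiple of \<open>[c, w]\<close>, itself a multiple of the shorter
  word \<open>w\<close>; the other letters, in particular the innermost one, commute with \<open>f\<^sub>j\<close>.\<close>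

lemma f_J_word: "j \<in> J \<Longrightarrow> set xs \<subseteq> J \<Longrightarrow> i \<in> K \<Longrightarrow> br (f j) (ad_list L e xs (e i)) \<in> pos"
proof (induction xs)
  case Nil
  then have "i \<noteq> j" using J_neg[of j] K_pos[of i] by auto
  then show ?case
    using Nil ef_distinct[of i j] br_eq_zero_swap[of "e i" "f j"] subspace_0[OF pos_subspace] by simp
next
  case (Cons k xs)
  let ?w = "ad_list L e xs (e i)"
  have w: "?w \<in> pos" "br (f j) ?w \<in> pos" using Cons word_pos by auto
  have "br (f j) (e k) = (if j = k then sc (of_int (fst j)) c else 0)"
    using Cons.prems ef_J[of j] ef_distinct[of k j] br_swap[of "f j" "e k"] by auto
  then have "br (br (f j) (e k)) ?w \<in> pos"
    using Cons.prems w(1) c_word[of xs i]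
    by (auto simp: br_simps subspace_0 subspace_neg subspace_scale pos_subspace)
  moreover have "br (e k) (br (f j) ?w) \<in> pos"
    unfolding pos_def
  proof (rule gen_ad_closed)
    show "br (f j) ?w \<in> gen words" using w(2) unfolding pos_def .
    fix u assume "u \<in> words"
    then obtain ys i' where u: "u = ad_list L e ys (e i')" "set ys \<subseteq> J" "i' \<in> K"
      unfolding words_def by blast
    then show "br (e k) u \<in> gen words"
      using word_pos[of "k # ys" i'] Cons.prems(2) unfolding pos_def by simp
  qed
  ultimately show ?case
    using br_derivation[of "f j" "e k" ?w] subspace_add[OF pos_subspace] by simp
qed

lemma middle_pos:
  assumes "x \<in> middle" and "y \<in> pos"
  shows "br x y \<in> pos"
proof (rule span_bracket_mem[OF _ span_base pos_subspace])
  show "x \<in> span (e ` J \<union> f ` J \<union> {c, d})" using assms(1) unfolding middle_def .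
  show "y \<in> {y}" by simp
  fix a b assume a: "a \<in> e ` J \<union> f ` J \<union> {c, d}" and "b \<in> {y}"
  then have b: "b \<in> gen words" using assms(2) unfolding pos_def by simp
  show "br a b \<in> pos"
    unfolding pos_def
  proof (rule gen_ad_closed[OF b])
    fix u assume "u \<in> words"
    then obtain xs i where u: "u = ad_list L e xs (e i)" "set xs \<subseteq> J" "i \<in> K"
      unfolding words_def by blast
    have "u \<in> pos" using u word_pos by simp
    moreover have "br (e j) u \<in> pos" if "j \<in> J" for j
      using word_pos[of "j # xs" i] u that by simp
    ultimately have "br a u \<in> pos"
      using a u f_J_word[of _ xs i] c_word[of xs i] d_word[of xs i]
      by (auto simp: subspace_neg subspace_scale pos_subspace)
    then show "br a u \<in> gen words" unfolding pos_def .
  qed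
qed

lemma middle_bracket: "x \<in> middle \<Longrightarrow> y \<in> middle \<Longrightarrow> br x y \<in> middle"
  unfolding middle_def
proof (rule span_bracket_mem[OF _ _ subspace_span], assumption, assumption, fold middle_def)
  note m = subspace_0[OF middle_subspace] middle_base subspace_neg[OF middle_subspace]
    subspace_scale[OF middle_subspace]
  have dc: "br d c = 0" using cd br_eq_zero_swap by blast
  have ef: "br (e j) (f k) \<in> middle" if "j \<in> J" "k \<in> J" for j k
    using that ef_J[of j] ef_distinct[of j k] by (cases "j = k") (auto intro: m)
  have fe: "br (f k) (e j) \<in> middle" if "j \<in> J" "k \<in> J" for j k
    unfolding br_swap[of "f k" "e j"] by (rule subspace_neg[OF middle_subspace ef[OF that]])
  have ec: "br (e j) c = 0" "br (f j) c = 0" if "j \<in> J" for j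
    using that c_J br_eq_zero_swap by blast+
  have ed: "br (e j) d \<in> middle" "br (f j) d \<in> middle" if "j \<in> J" for j
    using that br_swap[of "e j" d] br_swap[of "f j" d] by (auto simp: d_J intro: m)
  fix a b assume "a \<in> e ` J \<union> f ` J \<union> {c, d}" "b \<in> e ` J \<union> f ` J \<union> {c, d}"
  then show "br a b \<in> middle"
    using ef fe ed
    by (elim UnE insertE imageE; simp add: m ee_J ff_J ec c_J d_J cd dc bracket_self)
qed

text \<open>Here \<open>f\<close> commutes with the outer letters and meets only the innermost one, with bracket in the Cartan subalgebra.\<close>

lemma f_K_word:
  "i' \<in> K \<Longrightarrow> set xs \<subseteq> J \<Longrightarrow> i \<in> K \<Longrightarrow> br (f i') (ad_list L e xs (e i)) \<in> middle"
proof (induction xs)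
  case Nil
  have "br (e i) (f i') \<in> middle"
    using Nil ef_K[of i] ef_distinct[of i i']
    by (cases "i = i'")
       (auto simp: subspace_0 subspace_add subspace_scale middle_subspace middle_base)
  then show ?case
    unfolding foldr.simps id_apply br_swap[of "f i'" "e i"] by (rule subspace_neg[OF middle_subspace])
next
  case (Cons j xs)
  then have "j \<noteq> i'" using J_neg[of j] K_pos[of i'] by auto
  then have "br (f i') (e j) = 0" using ef_distinct[of j i'] br_eq_zero_swap Cons.prems by auto
  then show ?case
    using Cons br_derivation[of "f i'" "e j" "ad_list L e xs (e i)"]
    by (simp add: middle_bracket middle_base)
qed

text \<open>Along a bracket \<open>[a, b]\<close> of elements of \<open>u\<^sup>+\<close>, the parts of \<open>[f\<^sub>i, a]\<close> and \<open>[f\<^sub>i, b]\<close> of weight zero are absorbed,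
  because the middle part normalizes \<open>u\<^sup>+\<close>.\<close>

lemma f_K_pos:
  assumes "i \<in> K" and "y \<in> pos"
  shows "br (f i) y \<in> span (middle \<union> pos)"
  using assms(2) unfolding pos_def
proof (induction rule: gen_induct)
  case (base u)
  then show ?case using f_K_word[OF assms(1)] unfolding words_def by (auto intro: span_base)
next
  case (bracket a b)
  have "br x z \<in> pos" if "x \<in> span (middle \<union> gen words)" "z \<in> gen words" for x z
  proof (rule span_bracket_mem[OF that(1) span_base[of z "{z}"] pos_subspace])
    fix p q assume "p \<in> middle \<union> gen words" "q \<in> {z}"
    then show "br p q \<in> pos" using that(2) middle_pos gen_bracket unfolding pos_def by blast
  qed simp
  then have "br (br (f i) a) b \<in> pos" "br (br (f i) b) a \<in> pos" using bracket by blast+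
  then have "br (f i) (br a b) \<in> pos"
    unfolding br_derivation[of "f i" a b] br_swap[of a "br (f i) b"]
    by (intro subspace_add[OF pos_subspace] subspace_neg[OF pos_subspace])
  then show ?case unfolding pos_def by (auto intro: span_base)
qed (auto simp: br_simps intro: span_zero span_add span_scale)

lemma e_K_middle:
  assumes "i \<in> K" and "x \<in> middle"
  shows "br (e i) x \<in> pos"
proof (rule span_bracket_mem[OF span_base[of "e i" "{e i}"] _ pos_subspace])
  show "x \<in> span (e ` J \<union> f ` J \<union> {c, d})" using assms(2) unfolding middle_def .
  fix a b assume "a \<in> {e i}" and b: "b \<in> e ` J \<union> f ` J \<union> {c, d}"
  have ei: "e i \<in> pos" using word_pos[of "[]" i] assms(1) by simp
  have "br b (e i) \<in> pos" using middle_pos[OF _ ei] b unfolding middle_def by (blast intro: span_base)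
  then show "br a b \<in> pos"
    using \<open>a \<in> {e i}\<close> subspace_neg[OF pos_subspace] br_swap[of "e i" b] by (metis singletonD)
qed simp

abbreviation neg_words :: "'a set" where
  "neg_words \<equiv> charged_generators.words L J K f"

abbreviation neg :: "'a set" where
  "neg \<equiv> charged_generators.pos L J K f"

lemma middle_flip: "charged_generators.middle L J f e (- c) (- d) = middle"
proof -
  have 1: "c \<in> span {- c, - d}" "d \<in> span {- c, - d}" "- c \<in> span {c, d}" "- d \<in> span {c, d}"
    using span_neg[OF span_base[of "- c" "{- c, - d}"]] span_neg[OF span_base[of "- d" "{- c, - d}"]]
      span_neg[OF span_base[of c "{c, d}"]] span_neg[OF span_base[of d "{c, d}"]] by simp_all
  have 2: "span {- c, - d} = span {c, d}"
    unfolding span_eq using 1 by simp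
  show ?thesis
    unfolding charged_generators.middle_def[OF flip] middle_def
    by (subst (1 2) span_Un) (simp only: 2 Un_commute)
qed

text \<open>The span contains the generators and is stable under their adjoint actions, so it is an ideal containing them.\<close>

lemma triangular_decomposition: "span (neg \<union> middle \<union> pos) = UNIV"
proof -
  interpret N: charged_generators L J K f e "- c" "- d" by (rule flip)
  let ?X = "span (neg \<union> middle \<union> pos)"
  have mX: "middle \<subseteq> ?X" and pX: "pos \<subseteq> ?X" and nX: "neg \<subseteq> ?X"
    by (auto intro: span_base)
  have mp: "span (middle \<union> pos) \<subseteq> ?X" and nm: "span (middle \<union> neg) \<subseteq> ?X"
    by (intro span_mono; blast)+
  let ?U = "e ` (J \<union> K) \<union> f ` (J \<union> K) \<union> {c, d}"
  have UX: "u \<in> ?X" if "u \<in> ?U" for u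
  proof -
    have "e i \<in> pos" "f i \<in> neg" if "i \<in> K" for i
      using word_pos[of "[]" i] N.word_pos[of "[]" i] that by simp_all
    then show ?thesis using that middle_base mX pX nX by auto
  qed
  have ad: "br u x \<in> ?X" if u: "u \<in> ?U" and x: "x \<in> ?X" for u x
  proof (rule span_bracket_mem[OF span_base[of u "{u}"] x subspace_span])
    fix a b assume "a \<in> {u}" and b: "b \<in> neg \<union> middle \<union> pos"
    show "br a b \<in> ?X"
    proof (cases "u \<in> middle")
      case True
      then have "br u b \<in> neg \<union> middle \<union> pos"
        using b middle_pos middle_bracket N.middle_pos[unfolded middle_flip] by blast
      then show ?thesis using \<open>a \<in> {u}\<close> by (auto intro: span_base)
    next
      case False
      then obtain i where i: "i \<in> K" "u = e i \<or> u = f i"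
        using u middle_base by blast
      have "br (e i) b \<in> ?X"
        using b e_K_middle[OF i(1)] N.f_K_pos[OF i(1), unfolded middle_flip] nm pX
          gen_bracket[of "e i" words] word_pos[of "[]" i] i(1) unfolding pos_def by auto
      moreover have "br (f i) b \<in> ?X"
        using b N.e_K_middle[OF i(1), unfolded middle_flip] f_K_pos[OF i(1)] mp nX
          gen_bracket[of "f i" neg_words] N.word_pos[of "[]" i] i(1) unfolding N.pos_def by auto
      ultimately show ?thesis using \<open>a \<in> {u}\<close> i by blast
    qed
  qed simp
  have "gen ?U \<subseteq> {y. \<forall>x\<in>?X. br y x \<in> ?X}"
    by (rule gen_minimal[OF normalizer_subalgebra[OF subspace_span]]) (use ad in blast)
  then have "lie_subalgebra L ?X"
    unfolding lie_subalgebra_def generated using subspace_span by blast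
  then have "gen ?U \<subseteq> ?X" by (rule gen_minimal) (use UX in blast)
  then show ?thesis using generated by auto
qed

definition heis :: "'a set" where "heis = span (e ` J \<union> f ` J \<union> {c})"

lemma middle_eq: "middle = span (heis \<union> {c + d})"
proof
  have "d = (c + d) - c" by simp
  then have "d \<in> span (heis \<union> {c + d})"
    by (metis UnCI heis_def insertCI span_base span_diff)
  then show "middle \<subseteq> span (heis \<union> {c + d})"
    unfolding middle_def by (intro span_minimal) (auto intro: span_base simp: heis_def)
  have "heis \<subseteq> middle" unfolding heis_def middle_def by (rule span_mono) blast
  then show "span (heis \<union> {c + d}) \<subseteq> middle"
    using subspace_add[OF middle_subspace middle_base(3,4)]
    by (intro span_minimal middle_subspace) blast
qed

lemma pos_eigenspan: "pos \<subseteq> eigenspan (br c) (of_real ` {..<0})"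
  unfolding pos_def
proof (rule ad_eigenspan)
  fix u assume "u \<in> words"
  then obtain xs i where u: "u = ad_list L e xs (e i)" "set xs \<subseteq> J" "i \<in> K"
    unfolding words_def by blast
  have "br c u = sc (of_real (of_int (- fst i))) u"
    using u c_word by simp
  moreover have "of_int (- fst i) < (0::real)" using K_pos[OF u(3)] by simp
  ultimately show "\<exists>k\<in>of_real ` {..<0}. br c u = sc k u" by blast
next
  fix k k' :: complex assume "k \<in> of_real ` {..<0}" "k' \<in> of_real ` {..<0}"
  then obtain r r' where "k = of_real r" "k' = of_real r'" "r < 0" "r' < 0" by blast
  then have "k + k' = of_real (r + r')" "r + r' < 0" by simp_all
  then show "k + k' \<in> of_real ` {..<0}" by blast
qed

lemma neg_eigenspan: "neg \<subseteq> eigenspan (br c) (of_real ` {0<..})"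
proof -
  interpret N: charged_generators L J K f e "- c" "- d" by (rule flip)
  have "eigenspan (br (- c)) (of_real ` {..<0}) \<subseteq> eigenspan (br c) (of_real ` {0<..})"
    unfolding eigenspan_def
  proof (rule span_mono, safe)
    fix x and r :: real assume "r < 0" "br (- c) x = sc (of_real r) x"
    moreover have "br c x = - br (- c) x" by (simp add: br_minus_left)
    ultimately have "br c x = sc (of_real (- r)) x" "- r > 0" by simp_all
    then show "\<exists>k\<in>of_real ` {0<..}. br c x = sc k x" by blast
  qed
  then show ?thesis using N.pos_eigenspan by blast
qed

lemma middle_eigenspan: "middle \<subseteq> eigenspan (br c) {0}"
  unfolding middle_def
proof (rule span_minimal[OF _ eigenspan_subspace], safe)
  have "x \<in> eigenspan (br c) {0}" if "br c x = 0" for x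
    by (rule eigenspan_base[of _ _ 0]) (simp_all add: that)
  then show "\<And>j. j \<in> J \<Longrightarrow> e j \<in> eigenspan (br c) {0}" "\<And>j. j \<in> J \<Longrightarrow> f j \<in> eigenspan (br c) {0}"
    "c \<in> eigenspan (br c) {0}" "d \<in> eigenspan (br c) {0}"
    by (simp_all add: c_J cd bracket_self)
qed

text \<open>The eigenvalues of \<open>ad c\<close> on the three summands are positive, zero and negative.\<close>

lemma triangular_independent:
  assumes "a \<in> neg" and "b \<in> middle" and "p \<in> pos" and "a + b + p = 0"
  shows "a = 0 \<and> b = 0 \<and> p = 0"
proof -
  note es = eigenspan_subspace[of "br c"]
  have b0: "b \<in> eigenspan (br c) {0}" and p0: "p \<in> eigenspan (br c) (of_real ` {..<0})"
    and a0: "a \<in> eigenspan (br c) (of_real ` {0<..})"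
    using assms middle_eigenspan pos_eigenspan neg_eigenspan by blast+
  have "b + p \<in> eigenspan (br c) ({0} \<union> of_real ` {..<0})"
    using b0 p0 eigenspan_mono[of "{0}" "{0} \<union> of_real ` {..<0}"]
      eigenspan_mono[of "of_real ` {..<0}" "{0} \<union> of_real ` {..<0}"]
    by (intro subspace_add[OF es]) blast+
  moreover have "b + p = - a" using assms(4) by (metis add.assoc add.commute eq_neg_iff_add_eq_0)
  ultimately have "b + p = 0"
    using a0 by (intro eigenspan_disjoint[of "br c" "{0} \<union> of_real ` {..<0}" "of_real ` {0<..}"])
      (auto simp: br_simps subspace_neg[OF es])
  moreover have "b = 0"
    using b0 p0 \<open>b + p = 0\<close>
    by (intro eigenspan_disjoint[of "br c" "{0}" "of_real ` {..<0}"])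
       (auto simp: br_simps eq_neg_iff_add_eq_0[symmetric] subspace_neg[OF es])
  ultimately show ?thesis using assms(4) by simp
qed

text \<open>The bracket pairs \<open>e\<^sub>j\<close> and \<open>f\<^sub>k\<close> to a nonzero multiple of \<open>c\<close> if \<open>j = k\<close> and to zero otherwise, so bracketing with \<open>f\<^sub>k\<close> reads off the coefficient of \<open>e\<^sub>k\<close>.\<close>

lemma span_e_J_detect:
  assumes c0: "c \<noteq> 0" and p: "p \<in> span (e ` J)" and z: "\<And>k. k \<in> J \<Longrightarrow> br p (f k) = 0"
  shows "p = 0"
proof -
  obtain t r where t: "finite t" "t \<subseteq> e ` J" "p = (\<Sum>a\<in>t. sc (r a) a)"
    using p unfolding span_explicit by blast
  have sum: "br (\<Sum>a\<in>F. g a) y = (\<Sum>a\<in>F. br (g a) y)" if "finite F" for F :: "'a set" and g y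
    using that by (induction F) (simp_all add: br_simps)
  have "r a = 0" if "a \<in> t" for a
  proof -
    obtain k where k: "k \<in> J" "a = e k" using \<open>a \<in> t\<close> t(2) by blast
    have other: "br b (f k) = 0" if "b \<in> t - {a}" for b
    proof -
      obtain j where "j \<in> J" "b = e j" using \<open>b \<in> t - {a}\<close> t(2) by blast
      then show ?thesis using k that ef_distinct[of j k] by auto
    qed
    have "0 = (\<Sum>b\<in>t. sc (r b) (br b (f k)))"
      using z[OF k(1)] t(1) by (simp add: t(3) sum br_simps)
    also have "\<dots> = sc (r a) (br a (f k))"
      using other t(1) that by (subst sum.remove[of _ a]) auto
    finally show ?thesis using ef_J[OF k(1)] J_neg[OF k(1)] c0 k(2) by simp
  qed
  then show ?thesis by (simp add: t(3))
qed

lemma heis_bracket: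
  assumes "x \<in> heis" and "y \<in> heis"
  shows "br x y \<in> span {c}"
proof (rule span_bracket_mem[OF assms[unfolded heis_def] subspace_span])
  have cc: "c \<in> span {c}" by (rule span_base) simp
  have ef: "br (e j) (f k) \<in> span {c}" if "j \<in> J" "k \<in> J" for j k
    using that ef_J[of j] ef_distinct[of j k] cc
    by (cases "j = k") (auto intro: span_neg span_scale span_zero)
  have fe: "br (f k) (e j) \<in> span {c}" if "j \<in> J" "k \<in> J" for j k
    unfolding br_swap[of "f k" "e j"] by (rule span_neg[OF ef[OF that]])
  have ec: "br (e j) c = 0" "br (f j) c = 0" if "j \<in> J" for j
    using that c_J br_eq_zero_swap by blast+
  fix a b assume "a \<in> e ` J \<union> f ` J \<union> {c}" "b \<in> e ` J \<union> f ` J \<union> {c}"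
  then show "br a b \<in> span {c}"
    using ef fe
    by (elim UnE insertE imageE emptyE; simp add: span_zero ee_J ff_J ec c_J bracket_self)
qed

lemma heis_base: "j \<in> J \<Longrightarrow> e j \<in> heis" "j \<in> J \<Longrightarrow> f j \<in> heis" "c \<in> heis"
  unfolding heis_def by (auto intro: span_base)

lemma heis_decompose:
  assumes "x \<in> heis"
  obtains p q s where "p \<in> span (e ` J)" and "q \<in> span (f ` J)" and "x = p + q + sc s c"
proof -
  have "x \<in> span (e ` J \<union> f ` J \<union> {c})" using assms unfolding heis_def .
  then show thesis using that unfolding span_Un span_singleton by blast
qed

lemma heis_center:
  assumes c0: "c \<noteq> 0"
  shows "lie_center L heis = span {c}"
proof
  interpret N: charged_generators L J K f e "- c" "- d" by (rule flip)
  have "c \<in> lie_center L heis"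
  proof -
    have "br c x \<in> {0}" if "x \<in> heis" for x
      by (rule span_bracket_mem[OF span_base[of c "{c}"] that[unfolded heis_def] subspace_single_0])
         (auto simp: c_J bracket_self)
    then show ?thesis by (simp add: lie_center_def heis_base)
  qed
  moreover have "subspace (lie_center L heis)"
    unfolding subspace_def lie_center_def heis_def
    by (auto simp: br_simps intro: span_zero span_add span_scale)
  ultimately show "span {c} \<subseteq> lie_center L heis" by (intro span_minimal) auto
  show "lie_center L heis \<subseteq> span {c}"
  proof
    fix x assume x: "x \<in> lie_center L heis"
    then have "x \<in> heis" by (simp add: lie_center_def)
    then obtain p q s where d: "p \<in> span (e ` J)" "q \<in> span (f ` J)" "x = p + q + sc s c"
      by (rule heis_decompose)
    have xe: "br x (e k) = 0" and xf: "br x (f k) = 0" if "k \<in> J" for k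
      using x heis_base(1,2)[OF that] by (simp_all add: lie_center_def)
    have "br p (e k) \<in> {0}" if "k \<in> J" for k
      by (rule span_bracket_mem[OF d(1) span_base[of "e k" "{e k}"] subspace_single_0])
         (use that ee_J in blast)+
    then have pe: "br p (e k) = 0" if "k \<in> J" for k using that by blast
    have "br q (f k) \<in> {0}" if "k \<in> J" for k
      by (rule span_bracket_mem[OF d(2) span_base[of "f k" "{f k}"] subspace_single_0])
         (use that ff_J in blast)+
    then have qf: "br q (f k) = 0" if "k \<in> J" for k using that by blast
    have "br p (f k) = 0" if "k \<in> J" for k
      using xf[OF that] qf[OF that] that by (simp add: d(3) br_simps c_J)
    then have "p = 0" by (rule span_e_J_detect[OF c0 d(1)])
    have "br q (e k) = 0" if "k \<in> J" for k
      using xe[OF that] pe[OF that] that by (simp add: d(3) br_simps c_J)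
    then have "q = 0" using c0 by (intro N.span_e_J_detect[OF _ d(2)]) auto
    show "x \<in> span {c}" using d(3) \<open>p = 0\<close> \<open>q = 0\<close> by (simp add: span_scale span_base)
  qed
qed

lemma heis_heisenberg:
  assumes c0: "c \<noteq> 0" and "J \<noteq> {}"
  shows "heisenberg_lie L heis"
proof -
  have ch: "span {c} \<subseteq> heis" unfolding heis_def by (rule span_mono) simp
  obtain j where j: "j \<in> J" using \<open>J \<noteq> {}\<close> by blast
  let ?D = "{br x y | x y. x \<in> heis \<and> y \<in> heis}"
  have "br (e j) (f j) \<in> span ?D" using heis_base(1,2)[OF j] by (blast intro: span_base)
  then have "sc (- 1 / of_int (fst j)) (br (e j) (f j)) \<in> span ?D" by (rule span_scale)
  then have "c \<in> span ?D" using J_neg[OF j] by (simp add: ef_J[OF j])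
  then have "lie_derived L heis = span {c}"
    unfolding lie_derived_def using heis_bracket
    by (intro antisym span_minimal) auto
  moreover have "lie_subalgebra L heis"
    unfolding lie_subalgebra_def using heis_bracket ch by (auto simp: heis_def)
  moreover have "dim (span {c}) = 1"
    using c0 by (simp add: dim_eq_card_independent)
  ultimately show ?thesis by (simp add: heisenberg_lie_def heis_center[OF c0])
qed

lemma heis_infinite_dim:
  assumes c0: "c \<noteq> 0" and "infinite J"
  shows "\<not> finite_dim sc heis"
proof
  assume "finite_dim sc heis"
  then obtain B where B: "finite B" "heis \<subseteq> span B" unfolding finite_dim_def by blast
  have nz: "br (e j) (f j) \<noteq> 0" if "j \<in> J" for j
    using ef_J[OF that] J_neg[OF that] c0 by simp
  have "inj_on e J"
    by (rule inj_onI) (metis UnCI ef_distinct nz)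
  have "independent (e ` J)"
    unfolding dependent_def
  proof safe
    fix k assume k: "k \<in> J" "e k \<in> span (e ` J - {e k})"
    have "br (e k) (f k) \<in> {0}"
    proof (rule span_bracket_mem[OF k(2) span_base[of "f k" "{f k}"] subspace_single_0])
      fix a b assume a: "a \<in> e ` J - {e k}" and "b \<in> {f k}"
      then obtain j where "j \<in> J" "a = e j" "j \<noteq> k" by blast
      then show "br a b \<in> {0}" using k(1) ef_distinct[of j k] \<open>b \<in> {f k}\<close> by simp
    qed simp
    then show False using nz[OF k(1)] by simp
  qed
  moreover have "e ` J \<subseteq> span B" using heis_base B(2) by blast
  ultimately have "finite (e ` J)" using independent_span_bound[OF B(1)] by blast
  then show False using finite_imageD[OF _ \<open>inj_on e J\<close>] \<open>infinite J\<close> by blast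
qed

text \<open>If \<open>r (c + d) = p + q + s c\<close> with \<open>p\<close>, \<open>q\<close> in the spans of the \<open>e\<^sub>j\<close> and the \<open>f\<^sub>j\<close>, then \<open>p + q\<close> has only nonzero eigenvalues under
  \<open>ad d\<close> but lies in the span of \<open>c\<close> and \<open>d\<close>, which \<open>ad d\<close> kills. So \<open>p + q = 0\<close>, and \<open>d\<close> would be a multiple of \<open>c\<close>
  although it does not commute with \<open>e\<^sub>j\<close>.\<close>

lemma heis_cartan_independent:
  assumes c0: "c \<noteq> 0" and "J \<noteq> {}" and t: "t \<in> span {c + d}" "t \<in> heis"
  shows "t = 0"
proof (rule ccontr)
  assume "t \<noteq> 0"
  obtain r where r: "t = sc r (c + d)" using t(1) unfolding span_singleton by blast
  then have "r \<noteq> 0" using \<open>t \<noteq> 0\<close> by auto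
  obtain p q s where d: "p \<in> span (e ` J)" "q \<in> span (f ` J)" "t = p + q + sc s c"
    by (rule heis_decompose[OF t(2)])
  let ?P = "- {0} :: complex set"
  have ef: "e j \<in> eigenspan (br d) ?P" "f j \<in> eigenspan (br d) ?P" if "j \<in> J" for j
    using that J_neg[OF that]
    by (auto simp: d_J intro: eigenspan_base[where k = "of_int (fst j)"]
      eigenspan_base[where k = "- of_int (fst j)"])
  have "p \<in> eigenspan (br d) ?P"
    by (rule subsetD[OF span_minimal[OF _ eigenspan_subspace] d(1)]) (use ef in blast)
  moreover have "q \<in> eigenspan (br d) ?P"
    by (rule subsetD[OF span_minimal[OF _ eigenspan_subspace] d(2)]) (use ef in blast)
  ultimately have "p + q \<in> eigenspan (br d) ?P" by (rule subspace_add[OF eigenspan_subspace])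
  moreover have pq: "p + q = sc (r - s) c + sc r d"
    using d(3) r by (simp add: scale_left_diff_distrib scale_right_distrib algebra_simps)
  have "br d (p + q) = sc 0 (p + q)"
    using cd br_eq_zero_swap[of c d] by (simp add: pq br_simps bracket_self)
  then have "p + q \<in> eigenspan (br d) {0}" by (rule eigenspan_base) simp
  ultimately have 0: "p + q = 0"
    by (intro eigenspan_disjoint[of "br d" ?P "{0}"]) (auto simp: br_simps)
  obtain j where j: "j \<in> J" using \<open>J \<noteq> {}\<close> by blast
  have "0 = br (p + q) (e j)" by (simp add: 0)
  also have "\<dots> = sc (r * of_int (fst j)) (e j)"
    unfolding pq using j by (simp add: br_simps c_J d_J)
  finally have "e j = 0" using \<open>r \<noteq> 0\<close> J_neg[OF j] by simp
  then show False using ef_J[OF j] J_neg[OF j] c0 by simp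
qed

theorem heis_direct_sum:
  assumes c0: "c \<noteq> 0" and "J \<noteq> {}"
  shows "direct_sum4 neg heis (span {c + d}) pos"
proof -
  interpret N: charged_generators L J K f e "- c" "- d" by (rule flip)
  have mid: "middle = {x + y | x y. x \<in> heis \<and> y \<in> span {c + d}}"
    unfolding middle_eq span_Un by (simp add: heis_def span_span)
  have hm: "heis \<subseteq> middle" "span {c + d} \<subseteq> middle"
    unfolding middle_eq by (auto intro: span_base subsetD[OF span_mono])
  have sub: "subspace neg" "subspace heis" "subspace (span {c + d})" "subspace pos"
    unfolding heis_def by (auto intro: N.pos_subspace pos_subspace)
  show ?thesis
    unfolding direct_sum4_def
  proof (intro allI ex_ex1I)
    fix x
    have "x \<in> span (neg \<union> middle \<union> pos)" by (simp add: triangular_decomposition)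
    then obtain a m p where 1: "a \<in> neg" "m \<in> middle" "p \<in> pos" "x = a + m + p"
      unfolding span_Un N.pos_subspace[folded span_eq_iff] pos_subspace[folded span_eq_iff]
        middle_subspace[folded span_eq_iff] by blast
    obtain b t where "b \<in> heis" "t \<in> span {c + d}" "m = b + t" using 1(2) mid by blast
    then show "\<exists>p. p \<in> neg \<times> heis \<times> span {c + d} \<times> pos \<and>
        x = (case p of (a, b, c, d) \<Rightarrow> a + b + c + d)"
      using 1 by (intro exI[of _ "(a, b, t, p)"]) (simp add: add.assoc)
  next
    fix x y y'
    assume y: "y \<in> neg \<times> heis \<times> span {c + d} \<times> pos \<and> x = (case y of (a, b, c, d) \<Rightarrow> a + b + c + d)"
      and y': "y' \<in> neg \<times> heis \<times> span {c + d} \<times> pos \<and> x = (case y' of (a, b, c, d) \<Rightarrow> a + b + c + d)"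
    obtain a b t p a' b' t' p' where yy: "y = (a, b, t, p)" "y' = (a', b', t', p')"
      by (metis prod_cases4)
    note m = y[unfolded yy] y'[unfolded yy]
    have *: "(a - a') + ((b - b') + (t - t')) + (p - p') = 0" using m by (simp add: algebra_simps)
    have "a - a' \<in> neg" "p - p' \<in> pos" and b: "b - b' \<in> heis" and t: "t - t' \<in> span {c + d}"
      using m by (auto intro: subspace_diff[OF sub(1)] subspace_diff[OF sub(2)]
        subspace_diff[OF sub(3)] subspace_diff[OF sub(4)])
    moreover have "(b - b') + (t - t') \<in> middle"
      using b t hm by (intro subspace_add[OF middle_subspace]) blast+
    ultimately have 0: "a - a' = 0 \<and> (b - b') + (t - t') = 0 \<and> p - p' = 0"
      using * by (intro triangular_independent)
    then have "t - t' = - (b - b')" by (metis eq_neg_iff_add_eq_0 add.commute)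
    then have "t - t' = 0"
      using heis_cartan_independent[OF assms t] subspace_neg[OF sub(2) b] by simp
    then show "y = y'" using 0 yy by simp
  qed
qed

end

section \<open>The product expansion has infinitely many factors\<close>

lemma qpow_imaginary: "qpow (\<i> * of_real t) r = of_real (exp (- (2 * pi * r * t)))"
proof -
  have "2 * complex_of_real pi * \<i> * of_real r * (\<i> * of_real t) = of_real (- (2 * pi * r * t))"
    by (simp add: algebra_simps)
  then show ?thesis unfolding qpow_def by (metis exp_of_real)
qed

text \<open>Otherwise \<open>T(it) q\<close> is a finite product of powers of \<open>1 - exp(-2 \<pi> m t) \<ge> t/2\<close> for small \<open>t\<close>, hence at least
  \<open>(t/2)\<^sup>D\<close>, where \<open>D\<close> is the sum of the exponents. On the other hand \<open>T(it)\<close> is a power series without constant term in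
  \<open>exp(-2 \<pi> / (N t))\<close>, hence bounded by a multiple of this quantity. With \<open>x = 2 \<pi> / (N t)\<close> this
  contradicts the growth of \<open>exp x\<close>.\<close>

theorem infinitely_many_zero_exponents:
  assumes z: "zero_exponents T c0" and o: "one_coefficients T N c1"
  shows "infinite {m. m > 0 \<and> c0 m \<noteq> 0}"
proof
  assume fin: "finite {m. m > 0 \<and> c0 m \<noteq> 0}"
  then obtain b where bound: "\<forall>m\<in>{m. m > 0 \<and> c0 m \<noteq> 0}. m \<le> b"
    unfolding finite_nat_set_iff_bounded_le by blast
  have b: "c0 m = 0" if "m > b" for m
    using bound[rule_format, of m] that by force
  define D where "D = (\<Sum>m<b. c0 (Suc m))"
  have N: "N > 0" using o unfolding one_coefficients_def by simp
  have lower: "(t / 2) ^ D \<le> norm (T (\<i> * of_real t))" if t: "0 < t" "t \<le> 1" for t :: real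
  proof -
    let ?\<tau> = "\<i> * of_real t :: complex"
    let ?f = "\<lambda>m. (1 - qpow ?\<tau> (of_nat (Suc m))) ^ c0 (Suc m)"
    have "?f has_prod (T ?\<tau> * qpow ?\<tau> 1)"
      using z t unfolding zero_exponents_def by simp
    moreover have "?f has_prod (\<Prod>m<b. ?f m)"
      by (rule has_prod_finite) (use b in auto)
    ultimately have eq: "T ?\<tau> * qpow ?\<tau> 1 = (\<Prod>m<b. ?f m)"
      by (rule has_prod_unique2)
    have factor: "t / 2 \<le> norm (1 - qpow ?\<tau> (of_nat (Suc m)))" for m
    proof -
      have "1 * t \<le> (2 * pi * real (Suc m)) * t"
      proof (rule mult_right_mono)
        have "1 * 1 \<le> (2 * pi) * real (Suc m)"
          by (rule mult_mono) (use pi_ge_two in auto)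
        then show "1 \<le> 2 * pi * real (Suc m)" by simp
      qed (use t in simp)
      then have 1: "exp (- (2 * pi * real (Suc m) * t)) \<le> exp (- t)" by simp
      have "exp (- t) \<le> 1 / (1 + t)"
        using exp_ge_add_one_self[of t] t by (simp add: exp_minus field_simps)
      also have "1 / (1 + t) \<le> 1 - t / 2"
      proof -
        have "t * t \<le> t * 1" using t by (intro mult_left_mono) auto
        then show ?thesis using t by (simp add: field_simps)
      qed
      finally have "t / 2 \<le> 1 - exp (- (2 * pi * real (Suc m) * t))" using 1 by linarith
      also have "\<dots> \<le> norm (complex_of_real (1 - exp (- (2 * pi * real (Suc m) * t))))"
        unfolding norm_of_real by (rule abs_ge_self)
      also have "complex_of_real (1 - exp (- (2 * pi * real (Suc m) * t)))
          = 1 - qpow ?\<tau> (of_nat (Suc m))"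
        by (simp only: qpow_imaginary of_real_diff of_real_1)
      finally show ?thesis .
    qed
    have "(t / 2) ^ D = (\<Prod>m<b. (t / 2) ^ c0 (Suc m))"
      unfolding D_def by (rule power_sum)
    also have "\<dots> \<le> (\<Prod>m<b. norm (?f m))"
      by (rule prod_mono) (use factor t in \<open>auto simp: norm_power intro: power_mono\<close>)
    also have "\<dots> = norm (T ?\<tau>) * norm (qpow ?\<tau> 1)"
      by (simp only: prod_norm eq[symmetric] norm_mult)
    also have "\<dots> \<le> norm (T ?\<tau>) * 1"
      using t by (intro mult_left_mono) (simp_all add: qpow_imaginary)
    finally show ?thesis by simp
  qed
  define a where "a = 2 * pi / real N"
  have a: "a > 0" using N by (simp add: a_def)
  define y where "y x = exp (- x)" for x :: real
  have series: "(\<lambda>n. of_nat (c1 (Suc n)) * of_real (y x ^ Suc n)) sums T (\<i> * of_real (a / x))"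
    if "x \<ge> a" for x
  proof -
    have x: "x > 0" using that a by simp
    have "\<i> * of_real (a / x) = - 1 / (\<i> * of_real (x / a) :: complex)"
      using x a by (simp add: field_simps)
    moreover have "qpow (\<i> * of_real (x / a)) (of_nat (Suc n) / of_nat N) = of_real (y x ^ Suc n)" for n
    proof -
      have "2 * pi * (real (Suc n) / real N) * (x / a) = real (Suc n) * x"
        using a N by (simp add: a_def field_simps)
      then show ?thesis
        by (simp only: qpow_imaginary y_def exp_of_nat_mult[symmetric] mult_minus_right)
    qed
    moreover have "Im (\<i> * of_real (x / a)) > 0" using x a by simp
    ultimately show ?thesis
      using o unfolding one_coefficients_def by (metis (no_types, lifting) sums_cong)
  qed
  have real_series: "summable (\<lambda>n. real (c1 (Suc n)) * y x ^ Suc n)"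
    and norm_le: "norm (T (\<i> * of_real (a / x))) \<le> suminf (\<lambda>n. real (c1 (Suc n)) * y x ^ Suc n)"
    if "x \<ge> a" for x
  proof -
    have s: "(\<lambda>n. complex_of_real (real (c1 (Suc n)) * y x ^ Suc n)) sums T (\<i> * of_real (a / x))"
      using series[OF that] by simp
    then have "summable (\<lambda>n. complex_of_real (real (c1 (Suc n)) * y x ^ Suc n))"
      by (rule sums_summable)
    then show sm: "summable (\<lambda>n. real (c1 (Suc n)) * y x ^ Suc n)"
      by (simp only: summable_complex_of_real)
    have "T (\<i> * of_real (a / x)) = of_real (suminf (\<lambda>n. real (c1 (Suc n)) * y x ^ Suc n))"
      by (rule sums_unique2[OF s]) (rule sums_of_real[OF summable_sums[OF sm]])
    moreover have "suminf (\<lambda>n. real (c1 (Suc n)) * y x ^ Suc n) \<ge> 0"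
      by (rule suminf_nonneg[OF sm]) (simp add: y_def)
    ultimately show "norm (T (\<i> * of_real (a / x))) \<le> suminf (\<lambda>n. real (c1 (Suc n)) * y x ^ Suc n)"
      by (simp del: power_Suc)
  qed
  define C where "C = suminf (\<lambda>n. real (c1 (Suc n)) * y a ^ Suc n)"
  have upper: "norm (T (\<i> * of_real (a / x))) \<le> C * exp a * exp (- x)" if x: "x \<ge> a" for x
  proof -
    have yx: "y x = y a * exp (a - x)" by (simp add: y_def flip: exp_add)
    have le: "real (c1 (Suc n)) * y x ^ Suc n
        \<le> real (c1 (Suc n)) * y a ^ Suc n * exp (a - x)" for n
    proof -
      have "exp (a - x) ^ Suc n \<le> exp (a - x) ^ 1"
        by (rule power_decreasing) (use x in auto)
      then have "y a ^ Suc n * exp (a - x) ^ Suc n \<le> y a ^ Suc n * exp (a - x)"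
        by (intro mult_left_mono) (simp_all add: y_def)
      then have "real (c1 (Suc n)) * (y a ^ Suc n * exp (a - x) ^ Suc n)
          \<le> real (c1 (Suc n)) * (y a ^ Suc n * exp (a - x))"
        by (rule mult_left_mono) simp
      then show ?thesis by (simp only: yx power_mult_distrib mult.assoc)
    qed
    have "suminf (\<lambda>n. real (c1 (Suc n)) * y x ^ Suc n)
        \<le> suminf (\<lambda>n. real (c1 (Suc n)) * y a ^ Suc n * exp (a - x))"
      by (rule suminf_le[OF le real_series[OF x] summable_mult2[OF real_series]]) simp
    also have "\<dots> = C * exp (a - x)"
      unfolding C_def by (rule suminf_mult2[OF real_series, symmetric]) simp
    finally have "norm (T (\<i> * of_real (a / x))) \<le> C * exp (a - x)"
      by (rule order_trans[OF norm_le[OF x]])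
    then show ?thesis by (simp only: diff_conv_add_uminus exp_add mult.assoc)
  qed
  have "((\<lambda>x. C * exp a * (x ^ D / exp x)) \<longlongrightarrow> C * exp a * 0) at_top"
    by (intro tendsto_mult_left tendsto_power_div_exp_0)
  moreover have "eventually (\<lambda>x. (a / 2) ^ D \<le> C * exp a * (x ^ D / exp x)) at_top"
    using eventually_ge_at_top[of a]
  proof eventually_elim
    case (elim x)
    then have x: "x > 0" using a by simp
    have "(a / x / 2) ^ D \<le> norm (T (\<i> * of_real (a / x)))"
      by (rule lower) (use a elim x in auto)
    also have "\<dots> \<le> C * exp a * exp (- x)" by (rule upper[OF elim])
    finally have "(a / x / 2) ^ D * x ^ D \<le> C * exp a * exp (- x) * x ^ D"
      using x by (intro mult_right_mono) auto
    moreover have "(a / x / 2) ^ D * x ^ D = (a / 2) ^ D"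
      unfolding power_mult_distrib[symmetric] using x by simp
    moreover have "C * exp a * exp (- x) * x ^ D = C * exp a * (x ^ D / exp x)"
      by (simp add: exp_minus divide_inverse)
    ultimately show ?case by argo
  qed
  ultimately have "(a / 2) ^ D \<le> C * exp a * 0"
    by (rule tendsto_lowerbound) simp
  moreover have "(a / 2) ^ D > 0" using a by (intro zero_less_power) simp
  ultimately show False by simp
qed

section \<open>The Monstrous Lie algebra\<close>

context borcherds_split
begin

text \<open>A linear relation between rows of the matrix gives an element of the Cartan subalgebra that commutes with all generators.\<close>

lemma quotient_cartan_combination:
  assumes Q: "lie_quotient_map G (lie_center G UNIV) M \<pi>"
    and ipq: "i \<in> J \<union> K" "p \<in> J \<union> K" "q \<in> J \<union> K"
    and A: "\<And>j. j \<in> J \<union> K \<Longrightarrow> A i j = a * A p j + b * A q j"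
  shows "\<pi> (h i) = lscale M (of_real a) (\<pi> (h p)) + lscale M (of_real b) (\<pi> (h q))"
proof -
  have \<pi>: "lie_hom G M \<pi>" using Q unfolding lie_quotient_map_def by blast
  let ?z = "h i - (sc (of_real a) (h p) + sc (of_real b) (h q))"
  have "?z \<in> lie_center G UNIV"
  proof (rule central_of_generators[OF borcherds_algebra_facts(3)[OF presented]])
    fix u assume "u \<in> e ` (J \<union> K) \<union> f ` (J \<union> K) \<union> h ` (J \<union> K)"
    then obtain j where j: "j \<in> J \<union> K" "u = e j \<or> u = f j \<or> u = h j" by blast
    have "br ?z (e j) = 0" "br ?z (f j) = 0" "br ?z (h j) = 0"
      using relations[of i j] relations[of p j] relations[of q j] ipq j(1)
      by (simp_all add: br_simps A[OF j(1)] scale_left_distrib)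
    then show "br ?z u = 0" using j(2) by blast
  qed
  then have "\<pi> ?z = 0" by (simp only: lie_quotient_center_zero_iff[OF Q])
  then show ?thesis by (simp add: lie_hom_simps[OF \<pi>])
qed

text \<open>As \<open>[h\<^sub>p, e\<^sub>q]\<close> is a nonzero multiple of \<open>e\<^sub>q\<close>, the element \<open>h\<^sub>p\<close> is not central.\<close>

lemma quotient_h_nonzero:
  assumes Q: "lie_quotient_map G (lie_center G UNIV) M \<pi>" and "p \<in> J" and "q \<in> K"
  shows "\<pi> (h p) \<noteq> 0"
proof
  assume "\<pi> (h p) = 0"
  then have "br (h p) (e q) = 0"
    by (simp add: lie_quotient_center_zero_iff[OF Q] lie_center_def)
  then show False
    using relations[of p q] assms(2,3) A_negative[of q p] e_nonzero[of q] by auto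
qed

end

text \<open>Each row of the matrix is a combination of the rows at \<open>p \<in> J\<close> and at \<open>q \<in> K\<close>, where \<open>q\<close> has first component one:
  the row at \<open>j \<in> J\<close> is a multiple of the row at \<open>p\<close>, and the row at \<open>(n, k)\<close> is \<open>n\<close> times the row at \<open>q\<close> plus
  \<open>(n - 1) / fst p\<close> times the row at \<open>p\<close>.\<close>

lemma charged_generators_of_borcherds:
  fixes G :: "('a::ab_group_add) lie_alg" and M :: "('m::ab_group_add) lie_alg"
  assumes B: "borcherds_split J K A_matrix G e f h"
    and Q: "lie_quotient_map G (lie_center G UNIV) M \<pi>"
    and J_neg: "\<And>j. j \<in> J \<Longrightarrow> fst j < 0" and K_pos: "\<And>i. i \<in> K \<Longrightarrow> fst i > 0"
    and p: "p \<in> J" and q: "q \<in> K" "fst q = 1"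
  defines "c \<equiv> lscale M (- 1 / of_int (fst p)) (\<pi> (h p))"
  shows "charged_generators M J K (\<lambda>i. \<pi> (e i)) (\<lambda>i. \<pi> (f i)) c (\<pi> (h q) - c)"
proof -
  interpret B: borcherds_split J K A_matrix G e f h by (rule B)
  have M: "lie_algebra M" and \<pi>: "lie_hom G M \<pi>" and surj: "surj \<pi>"
    using Q unfolding lie_quotient_map_def by blast+
  interpret M: lie_algebra M by (rule M)
  let ?d = "\<pi> (h q) - c"
  note p0 = J_neg[OF p]
  note [simp] = lie_hom_simps[OF \<pi>]
  have hc: "\<pi> (h p) = - M.sc (of_int (fst p)) c"
    using p0 by (simp add: c_def)
  have rel: "M.br (\<pi> (h i)) (\<pi> (h j)) = 0"
    "M.br (\<pi> (h i)) (\<pi> (e j)) = M.sc (of_real (A_matrix i j)) (\<pi> (e j))"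
    "M.br (\<pi> (h i)) (\<pi> (f j)) = - M.sc (of_real (A_matrix i j)) (\<pi> (f j))"
    "M.br (\<pi> (e i)) (\<pi> (f j)) = (if i = j then \<pi> (h i) else 0)"
    if "i \<in> J \<union> K" "j \<in> J \<union> K" for i j
    using B.relations[of i j] that by (simp_all flip: lie_hom_bracket[OF \<pi>])
  have hJ: "\<pi> (h j) = - M.sc (of_int (fst j)) c" if j: "j \<in> J" for j
  proof -
    have "\<pi> (h j) = M.sc (of_real (of_int (fst j) / of_int (fst p))) (\<pi> (h p))
        + M.sc (of_real 0) (\<pi> (h p))"
      by (rule B.quotient_cartan_combination[OF Q])
         (use j p p0 J_neg K_pos in \<open>auto simp: A_matrix_def dest!: J_neg K_pos\<close>)
    then show ?thesis using p0 by (simp add: hc)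
  qed
  have hK: "\<pi> (h i) = M.sc (of_int (fst i)) ?d + c" if i: "i \<in> K" for i
  proof -
    have "\<pi> (h i) = M.sc (of_real (of_int (fst i))) (\<pi> (h q))
        + M.sc (of_real ((of_int (fst i) - 1) / of_int (fst p))) (\<pi> (h p))"
      by (rule B.quotient_cartan_combination[OF Q])
         (use i p p0 q J_neg K_pos in \<open>auto simp: A_matrix_def field_simps dest!: J_neg K_pos\<close>)
    also have "\<dots> = M.sc (of_int (fst i)) ?d + c"
      using p0 by (simp add: hc M.scale_left_diff_distrib M.scale_right_diff_distrib)
    finally show ?thesis .
  qed
  have A: "A_matrix p j = 0" "A_matrix q j = of_int (fst j)" if "j \<in> J" for j
    using J_neg[OF that] p0 q(2) by (simp_all add: A_matrix_def)
  have A': "A_matrix p i = of_int (fst p * fst i)" "A_matrix q i = - 1 - of_int (fst i)"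
    if "i \<in> K" for i
    using K_pos[OF that] p0 q(2) by (simp_all add: A_matrix_def)
  have c_br: "M.br c x = M.sc (- 1 / of_int (fst p)) (M.br (\<pi> (h p)) x)" for x
    by (simp add: c_def M.br_simps)
  show ?thesis
  proof (intro charged_generators.intro charged_generators_axioms.intro M)
    show "M.br c ?d = 0"
      using rel(1)[of p q] p q(1) by (simp add: M.br_simps M.bracket_self c_br)
    let ?X = "(\<lambda>i. \<pi> (e i)) ` (J \<union> K) \<union> (\<lambda>i. \<pi> (f i)) ` (J \<union> K) \<union> {c, ?d}"
    note sub = M.gen_subspace[of ?X]
    have c: "c \<in> M.gen ?X" and d: "?d \<in> M.gen ?X" by (auto intro: M.gen_base)
    have "\<pi> (h i) \<in> M.gen ?X" if "i \<in> J \<union> K" for i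
      using that hJ[of i] hK[of i] c d M.subspace_add[OF sub] M.subspace_scale[OF sub]
        M.subspace_neg[OF sub] by auto
    then have "M.gen (\<pi> ` (e ` (J \<union> K) \<union> f ` (J \<union> K) \<union> h ` (J \<union> K))) \<subseteq> M.gen ?X"
      by (intro M.gen_minimal M.gen_subalgebra) (auto intro: M.gen_base)
    moreover have "\<pi> x \<in> M.gen (\<pi> ` (e ` (J \<union> K) \<union> f ` (J \<union> K) \<union> h ` (J \<union> K)))" for x
      by (rule lie_hom_generated[OF B.lie_algebra_axioms M \<pi>])
         (simp add: borcherds_algebra_facts(3)[OF B.presented])
    ultimately have "\<pi> x \<in> M.gen ?X" for x by blast
    then show "M.gen ?X = UNIV" using surj by (metis UNIV_eq_I surjD)
    fix i j k
    show "fst j < 0" if "j \<in> J" using J_neg[OF that] .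
    show "0 < fst i" if "i \<in> K" using K_pos[OF that] .
    show "M.br c (\<pi> (e j)) = 0" "M.br c (\<pi> (f j)) = 0" if "j \<in> J"
      using rel(2,3)[of p j] that p by (simp_all add: c_br A)
    show "M.br ?d (\<pi> (e j)) = M.sc (of_int (fst j)) (\<pi> (e j))"
      "M.br ?d (\<pi> (f j)) = - M.sc (of_int (fst j)) (\<pi> (f j))" if "j \<in> J"
      using rel(2,3)[of p j] rel(2,3)[of q j] that p q(1) by (simp_all add: M.br_simps c_br A)
    show "M.br c (\<pi> (e i)) = - M.sc (of_int (fst i)) (\<pi> (e i))"
      "M.br c (\<pi> (f i)) = M.sc (of_int (fst i)) (\<pi> (f i))" if "i \<in> K"
      using rel(2,3)[of p i] that p p0 by (simp_all add: c_br A')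
    show "M.br ?d (\<pi> (e i)) = - \<pi> (e i)" "M.br ?d (\<pi> (f i)) = \<pi> (f i)" if "i \<in> K"
      using rel(2,3)[of p i] rel(2,3)[of q i] that p q(1) p0
      by (simp_all add: M.br_simps c_br A' M.scale_left_diff_distrib)
    show "M.br (\<pi> (e i)) (\<pi> (f j)) = 0" if "i \<in> J \<union> K" "j \<in> J \<union> K" "i \<noteq> j"
      using rel(4)[OF that(1,2)] that(3) by simp
    show "M.br (\<pi> (e j)) (\<pi> (f j)) = - M.sc (of_int (fst j)) c" if "j \<in> J"
      using rel(4)[of j j] hJ that by simp
    show "M.br (\<pi> (e i)) (\<pi> (f i)) = M.sc (of_int (fst i)) ?d + c" if "i \<in> K"
      using rel(4)[of i i] hK that by simp
    show "M.br (\<pi> (e j)) (\<pi> (e k)) = 0" "M.br (\<pi> (f j)) (\<pi> (f k)) = 0" if "j \<in> J" "k \<in> J"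
      using B.relations[of j k] B.A_zero[of j k] that
      by (simp_all flip: lie_hom_bracket[OF \<pi>])
  qed
qed

lemma (in lie_algebra) span_insert_scaled:
  assumes "r \<noteq> 0"
  shows "span (X \<union> {sc r x}) = span (X \<union> {x})"
proof -
  have "sc (inverse r) (sc r x) \<in> span (X \<union> {sc r x})"
    by (intro span_scale span_base) simp
  then have "x \<in> span (X \<union> {sc r x})" using assms by simp
  moreover have "sc r x \<in> span (X \<union> {x})" by (intro span_scale span_base) simp
  ultimately show ?thesis unfolding span_eq by (auto intro: span_base)
qed

theorem theorem4p3:
  fixes V :: "('v::ab_group_add) voa" and g :: "'v \<Rightarrow> 'v" and T :: "complex \<Rightarrow> complex"
    and c0 c1 :: "nat \<Rightarrow> nat" and N l :: nat
    and G :: "('a::ab_group_add) lie_alg" and e f h :: "int \<times> int \<Rightarrow> 'a"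
    and M :: "('m::ab_group_add) lie_alg" and \<pi> :: "'a \<Rightarrow> 'm"
  assumes "moonshine_module V" and "g \<in> Monster V" and "\<not> fricke V g"
    and "mckay_thompson V g T" and "eta_quotient T"
    and "zero_exponents T c0" and "one_coefficients T N c1"
    and "l > 0" and "c0 l \<noteq> 0" and "\<And>m. 0 < m \<Longrightarrow> m < l \<Longrightarrow> c0 m = 0"
    and "borcherds_algebra (I_minus c0 \<union> I_plus c1) A_matrix G e f h"
    and "lie_quotient_map G (lie_center G UNIV) M \<pi>"
  defines "e' \<equiv> \<lambda>i. \<pi> (e i)" and "f' \<equiv> \<lambda>i. \<pi> (f i)" and "h' \<equiv> \<lambda>i. \<pi> (h i)"
  defines "H \<equiv> lspan M (e' ` I_minus c0 \<union> f' ` I_minus c0 \<union> {h' (- int l, 1)})"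
  shows "\<exists>u_minus u_plus.
           freely_generates M (ad_words M e' (I_minus c0) (I_plus c1)) u_plus \<and>
           freely_generates M (ad_words M f' (I_minus c0) (I_plus c1)) u_minus \<and>
           heisenberg_lie M H \<and> \<not> finite_dim (lscale M) H \<and>
           lie_center M H = lspan M {h' (- int l, 1)} \<and>
           direct_sum4 u_minus H (lspan M {h' (1, 1)}) u_plus"
proof -
  let ?J = "I_minus c0" and ?K = "I_plus c1" and ?p = "(- int l, 1 :: int)" and ?q = "(1 :: int, 1 :: int)"
  note Q = assms(12)
  have J_neg: "fst j < 0" if "j \<in> ?J" for j using that unfolding I_minus_def by auto
  have K_pos: "fst i > 0" if "i \<in> ?K" for i using that unfolding I_plus_def by auto
  have p: "?p \<in> ?J" using assms(8,9) unfolding I_minus_def by force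
  have "c1 1 \<noteq> 0" using assms(7) unfolding one_coefficients_def by blast
  then have q: "?q \<in> ?K" unfolding I_plus_def by force
  have A0: "A_matrix j k = 0" if "j \<in> ?J" "k \<in> ?J" for j k
    using J_neg[OF that(1)] J_neg[OF that(2)] by (simp add: A_matrix_def)
  have An: "A_matrix i j < 0 \<and> A_matrix j i < 0" if "i \<in> ?K" "j \<in> ?J \<union> ?K" for i j
    using K_pos[OF that(1)] K_pos[of j] J_neg[of j] that(2)
    by (auto simp: A_matrix_def mult_pos_neg mult_neg_pos simp flip: of_int_mult)
  have disjoint: "?J \<inter> ?K = {}" using J_neg K_pos by fastforce
  have B: "borcherds_split ?J ?K A_matrix G e f h"
    by (rule borcherds_split.intro[OF assms(11) A0 An disjoint]) (use p in blast)+
  interpret B: borcherds_split ?J ?K A_matrix G e f h by (rule B)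
  interpret B': borcherds_split ?J ?K A_matrix G f e "\<lambda>i. - h i" by (rule B.borcherds_split_flip)
  define c where "c = lscale M (- 1 / of_int (fst ?p)) (\<pi> (h ?p))"
  interpret M: charged_generators M ?J ?K e' f' c "h' ?q - c"
    unfolding c_def e'_def f'_def h'_def
    by (rule charged_generators_of_borcherds[OF B Q J_neg K_pos p q]) simp_all
  interpret M': charged_generators M ?J ?K f' e' "- c" "- (h' ?q - c)" by (rule M.flip)
  have hp: "h' ?p = M.sc (of_nat l) c" using assms(8) by (simp add: c_def h'_def)
  have c0: "c \<noteq> 0" using B.quotient_h_nonzero[OF Q p q] hp unfolding h'_def by auto
  have "infinite ((\<lambda>m. (- int m, 1 :: int)) ` {m. m > 0 \<and> c0 m \<noteq> 0})"
    using infinitely_many_zero_exponents[OF assms(6,7)]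
    by (subst finite_image_iff) (auto simp: inj_on_def)
  moreover have "(\<lambda>m. (- int m, 1 :: int)) ` {m. m > 0 \<and> c0 m \<noteq> 0} \<subseteq> ?J"
    unfolding I_minus_def by force
  ultimately have inf: "infinite ?J" using finite_subset by blast
  have H: "H = M.heis"
    unfolding H_def M.heis_def hp using assms(8) by (intro M.span_insert_scaled) simp
  have span_p: "M.span {h' ?p} = M.span {c}"
    unfolding hp using assms(8) M.span_insert_scaled[of "of_nat l" "{}" c] by simp
  have "ad_words M e' ?J ?K = M.words"
    unfolding M.words_def by (rule M.ad_words_eq) (rule M.ee_J)
  then have "freely_generates M (ad_words M e' ?J ?K) M.pos"
    unfolding M.pos_def M.words_def using B.positive_part_free[OF Q] by (simp only: e'_def)
  moreover have "ad_words M f' ?J ?K = M'.words"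
    unfolding M'.words_def by (rule M.ad_words_eq) (rule M.ff_J)
  then have "freely_generates M (ad_words M f' ?J ?K) M'.pos"
    unfolding M'.pos_def M'.words_def using B'.positive_part_free[OF Q] by (simp only: f'_def)
  moreover have "heisenberg_lie M H" unfolding H by (rule M.heis_heisenberg[OF c0]) (use p in blast)
  moreover have "\<not> finite_dim (lscale M) H" unfolding H by (rule M.heis_infinite_dim[OF c0 inf])
  moreover have "lie_center M H = lspan M {h' ?p}" unfolding H span_p by (rule M.heis_center[OF c0])
  moreover have "direct_sum4 M.neg H (lspan M {h' ?q}) M.pos"
    using M.heis_direct_sum[OF c0] p unfolding H by auto
  ultimately show ?thesis by blast
qed

end
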